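(* Let $\psi\colon S\to M$ be a codimension-two spacelike submanifold in a spacetime $(M,g)$ of dimension $n+2\ge4$. The following conditions are equivalent: 1. There exists a globally defined umbilical lightlike normal vector field $\xi$ on $S$ that can be locally rescaled to be parallel with respect to the normal connection. 2. There exists a globally defined umbilical lightlike normal vector field $\xi$ on $S$ such that $\bigl(\widetilde R(X,Y)\xi\bigr)^\perp=0$ for all $X,Y\in\mathfrak X(S)$, where $\widetilde R$ is the curvature tensor of $M$. In this case, $S$ has a flat normal connection.
   Context: A spacetime $(M,g)$ is a connected time-oriented Lorentzian manifold of signature $(-,+,\dots,+)$. A vector $v$ is lightlike if $g(v,v)=0$ and $v\ne0$. A codimension-two spacelike submanifold $\psi\colon S\to M$ is an immersion of a connected $n$-manifold whose induced metric is Riemannian. $(\cdot)^\perp$ is projection onto the normal bundle. For a normal field $\zeta$, the Weingarten formula $\widetilde\nabla_X\zeta=-A_\zeta X+\nabla^\perp_X\zeta$ defines the shape operator $A_\zeta$ and the normal connection $\nabla^\perp$. A normal field $\zeta$ is umbilical if $A_\zeta=\rho I$ for some function $\rho$. "$\xi$ can be locally rescaled to be parallel" means: every $p\in S$ has an open neighborhood $\mathscr U$ and a smooth function $f$ on $\mathscr U$ such that $\nabla^\perp(e^{-f}\xi)=0$ on $\mathscr U$. Flat normal connection means that the curvature $R^\perp$ of $\nabla^\perp$ vanishes. Convention: $\widetilde R(X,Y)Z=\widetilde\nabla_X\widetilde\nabla_YZ-\widetilde\nabla_Y\widetilde\nabla_XZ-\widetilde\nabla_{[X,Y]}Z$. 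*)

theory Defs
  imports "HOL-Analysis.Analysis"
begin

section \<open>Smooth maps between Euclidean spaces\<close>

text \<open>Only used on open sets \<open>U\<close>. Since the spaces are finite-dimensional, \<open>f\<close> is of class
  \<open>C\<^sup>k\<^sup>+\<^sup>1\<close> iff it is differentiable and all its directional derivatives are of class \<open>C\<^sup>k\<close>.\<close>

fun Ck_on :: "nat \<Rightarrow> 'e set \<Rightarrow> ('e::euclidean_space \<Rightarrow> 'f::real_normed_vector) \<Rightarrow> bool" where
  "Ck_on 0 U f \<longleftrightarrow> continuous_on U f"
| "Ck_on (Suc k) U f \<longleftrightarrow>
     (\<forall>x\<in>U. f differentiable (at x)) \<and> (\<forall>v. Ck_on k U (\<lambda>x. frechet_derivative f (at x) v))"

definition smooth_on :: "'e set \<Rightarrow> ('e::euclidean_space \<Rightarrow> 'f::real_normed_vector) \<Rightarrow> bool" where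
  "smooth_on U f \<longleftrightarrow> (\<forall>k. Ck_on k U f)"

section \<open>Smooth manifolds\<close>

text \<open>A chart is a pair of its domain and its coordinate map; values of the coordinate map outside
  the domain are irrelevant. The atlas need not be maximal. The points of the manifold are the
  points of \<open>topspace (mtop M)\<close>, and its dimension is \<open>DIM('e)\<close>.\<close>

type_synonym ('a, 'e) chart = "'a set \<times> ('a \<Rightarrow> 'e)"

record ('a, 'e) manifold =
  mtop :: "'a topology"
  atlas :: "('a, 'e) chart set"

definition chart_inv :: "('a, 'e) chart \<Rightarrow> 'e \<Rightarrow> 'a" where
  "chart_inv c = inv_into (fst c) (snd c)"

definition transition :: "('a, 'e) chart \<Rightarrow> ('a, 'e) chart \<Rightarrow> 'e \<Rightarrow> 'e" where
  "transition c d = snd d \<circ> chart_inv c"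

definition smooth_manifold :: "('a, 'e::euclidean_space) manifold \<Rightarrow> bool" where
  "smooth_manifold M \<longleftrightarrow>
     Hausdorff_space (mtop M) \<and> second_countable (mtop M) \<and>
     (\<forall>c\<in>atlas M. openin (mtop M) (fst c) \<and> open (snd c ` fst c) \<and>
        homeomorphic_map (subtopology (mtop M) (fst c)) (top_of_set (snd c ` fst c)) (snd c)) \<and>
     (\<Union>c\<in>atlas M. fst c) = topspace (mtop M) \<and>
     (\<forall>c\<in>atlas M. \<forall>d\<in>atlas M. smooth_on (snd c ` (fst c \<inter> fst d)) (transition c d))"

definition chart_at :: "('a, 'e) manifold \<Rightarrow> 'a \<Rightarrow> ('a, 'e) chart" where
  "chart_at M p = (SOME c. c \<in> atlas M \<and> p \<in> fst c)"

text \<open>The tangent space at \<open>p\<close> is the model space \<open>'e\<close>: a tangent vector at \<open>p\<close> is identified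
  with its components in the preferred chart \<open>chart_at M p\<close>. Its components in another chart
  are obtained by the usual transformation law. Since the preferred chart depends on \<open>p\<close> in an
  arbitrary way, regularity of vector fields and tensors always has to be tested on components
  in a fixed chart.\<close>

definition components ::
    "('a, 'e::euclidean_space) manifold \<Rightarrow> ('a, 'e) chart \<Rightarrow> 'a \<Rightarrow> 'e \<Rightarrow> 'e" where
  "components M c p v =
     frechet_derivative (transition (chart_at M p) c) (at (snd (chart_at M p) p)) v"

definition of_components ::
    "('a, 'e::euclidean_space) manifold \<Rightarrow> ('a, 'e) chart \<Rightarrow> 'a \<Rightarrow> 'e \<Rightarrow> 'e" where
  "of_components M c p u =
     frechet_derivative (transition c (chart_at M p)) (at (snd c p)) u"

definition smooth_fun :: "('a, 'e::euclidean_space) manifold \<Rightarrow> 'a set \<Rightarrow> ('a \<Rightarrow> real) \<Rightarrow> bool" where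
  "smooth_fun M U f \<longleftrightarrow> (\<forall>c\<in>atlas M. smooth_on (snd c ` (U \<inter> fst c)) (f \<circ> chart_inv c))"

definition smooth_map ::
    "('b, 'f::euclidean_space) manifold \<Rightarrow> ('a, 'e::euclidean_space) manifold \<Rightarrow> ('b \<Rightarrow> 'a) \<Rightarrow> bool" where
  "smooth_map S M \<psi> \<longleftrightarrow>
     continuous_map (mtop S) (mtop M) \<psi> \<and>
     (\<forall>c\<in>atlas S. \<forall>d\<in>atlas M.
        smooth_on (snd c ` (fst c \<inter> \<psi> -` fst d)) (snd d \<circ> \<psi> \<circ> chart_inv c))"

definition differential ::
    "('b, 'f::euclidean_space) manifold \<Rightarrow> ('a, 'e::euclidean_space) manifold \<Rightarrow> ('b \<Rightarrow> 'a) \<Rightarrow>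
     'b \<Rightarrow> 'f \<Rightarrow> 'e" where
  "differential S M \<psi> p v =
     frechet_derivative (snd (chart_at M (\<psi> p)) \<circ> \<psi> \<circ> chart_inv (chart_at S p))
       (at (snd (chart_at S p) p)) v"

definition immersion ::
    "('b, 'f::euclidean_space) manifold \<Rightarrow> ('a, 'e::euclidean_space) manifold \<Rightarrow> ('b \<Rightarrow> 'a) \<Rightarrow> bool" where
  "immersion S M \<psi> \<longleftrightarrow>
     smooth_map S M \<psi> \<and> (\<forall>p\<in>topspace (mtop S). inj (differential S M \<psi> p))"

text \<open>\<open>V p\<close> is a tangent vector of \<open>M\<close> at \<open>\<psi> p\<close>, for \<open>p\<close> in the open set \<open>U\<close> of \<open>S\<close>.
  Vector fields on \<open>M\<close> are vector fields along the identity.\<close>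

definition vector_field_along ::
    "('b, 'f::euclidean_space) manifold \<Rightarrow> ('a, 'e::euclidean_space) manifold \<Rightarrow> ('b \<Rightarrow> 'a) \<Rightarrow>
     'b set \<Rightarrow> ('b \<Rightarrow> 'e) \<Rightarrow> bool" where
  "vector_field_along S M \<psi> U V \<longleftrightarrow>
     (\<forall>c\<in>atlas S. \<forall>d\<in>atlas M.
        smooth_on (snd c ` (U \<inter> fst c \<inter> \<psi> -` fst d))
          (\<lambda>x. components M d (\<psi> (chart_inv c x)) (V (chart_inv c x))))"

definition vector_field :: "('a, 'e::euclidean_space) manifold \<Rightarrow> 'a set \<Rightarrow> ('a \<Rightarrow> 'e) \<Rightarrow> bool" where
  "vector_field M U X \<longleftrightarrow> vector_field_along M M id U X"

definition lie_bracket ::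
    "('a, 'e::euclidean_space) manifold \<Rightarrow> ('a \<Rightarrow> 'e) \<Rightarrow> ('a \<Rightarrow> 'e) \<Rightarrow> 'a \<Rightarrow> 'e" where
  "lie_bracket M X Y p =
     (let c = chart_at M p;
          comp = (\<lambda>Z x. components M c (chart_inv c x) (Z (chart_inv c x)))
      in frechet_derivative (comp Y) (at (snd c p)) (X p)
       - frechet_derivative (comp X) (at (snd c p)) (Y p))"

section \<open>Spacetimes\<close>

definition metric_in_chart ::
    "('a, 'e::euclidean_space) manifold \<Rightarrow> ('a \<Rightarrow> 'e \<Rightarrow> 'e \<Rightarrow> real) \<Rightarrow> ('a, 'e) chart \<Rightarrow>
     'e \<Rightarrow> 'e \<Rightarrow> 'e \<Rightarrow> real" where
  "metric_in_chart M g c x u v =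
     (let p = chart_inv c x in g p (of_components M c p u) (of_components M c p v))"

text \<open>The signature is expressed by a basis \<open>L i\<close>, indexed by the standard basis of the model
  space, in which the metric is \<open>diag (-1, 1, \<dots>, 1)\<close>.\<close>

definition lorentzian_metric ::
    "('a, 'e::euclidean_space) manifold \<Rightarrow> ('a \<Rightarrow> 'e \<Rightarrow> 'e \<Rightarrow> real) \<Rightarrow> bool" where
  "lorentzian_metric M g \<longleftrightarrow>
     (\<forall>p\<in>topspace (mtop M). bilinear (g p) \<and> (\<forall>u v. g p u v = g p v u) \<and>
        (\<exists>(L :: 'e \<Rightarrow> 'e) e. linear L \<and> bij L \<and> e \<in> Basis \<and>
           (\<forall>i\<in>Basis. \<forall>j\<in>Basis.
              g p (L i) (L j) = (if i = j then if i = e then -1 else 1 else 0)))) \<and>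
     (\<forall>c\<in>atlas M. \<forall>u v. smooth_on (snd c ` fst c) (\<lambda>x. metric_in_chart M g c x u v))"

text \<open>A time orientation selects at every point one of the two time cones, in such a way that
  locally the selected cone is the one containing some smooth timelike vector field.\<close>

definition time_orientation ::
    "('a, 'e::euclidean_space) manifold \<Rightarrow> ('a \<Rightarrow> 'e \<Rightarrow> 'e \<Rightarrow> real) \<Rightarrow> ('a \<Rightarrow> 'e set) \<Rightarrow> bool" where
  "time_orientation M g \<tau> \<longleftrightarrow>
     (\<forall>p\<in>topspace (mtop M). \<exists>U V. openin (mtop M) U \<and> p \<in> U \<and> vector_field M U V \<and>
        (\<forall>q\<in>U. g q (V q) (V q) < 0 \<and> \<tau> q = {w. g q w w < 0 \<and> g q (V q) w < 0}))"

definition spacetime ::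
    "('a, 'e::euclidean_space) manifold \<Rightarrow> ('a \<Rightarrow> 'e \<Rightarrow> 'e \<Rightarrow> real) \<Rightarrow> ('a \<Rightarrow> 'e set) \<Rightarrow> bool" where
  "spacetime M g \<tau> \<longleftrightarrow>
     smooth_manifold M \<and> connected_space (mtop M) \<and> lorentzian_metric M g \<and> time_orientation M g \<tau>"

section \<open>Levi-Civita connection and curvature\<close>

text \<open>The Christoffel symbols of the Levi-Civita connection in a chart, as a bilinear map: the
  symmetry is the vanishing of the torsion and the last condition is the compatibility with the
  metric.\<close>

definition christoffel ::
    "('a, 'e::euclidean_space) manifold \<Rightarrow> ('a \<Rightarrow> 'e \<Rightarrow> 'e \<Rightarrow> real) \<Rightarrow> ('a, 'e) chart \<Rightarrow>
     'e \<Rightarrow> 'e \<Rightarrow> 'e \<Rightarrow> 'e" where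
  "christoffel M g c x =
     (THE \<Gamma>. bilinear \<Gamma> \<and> (\<forall>u v. \<Gamma> u v = \<Gamma> v u) \<and>
        (\<forall>u v w. frechet_derivative (\<lambda>y. metric_in_chart M g c y v w) (at x) u =
           metric_in_chart M g c x (\<Gamma> u v) w + metric_in_chart M g c x v (\<Gamma> u w)))"

text \<open>The Levi-Civita derivative of a vector field \<open>V\<close> along \<open>\<psi>\<close> in the direction of the tangent
  vector \<open>v\<close> of \<open>S\<close> at \<open>p\<close>. In the preferred charts around \<open>p\<close> and \<open>\<psi> p\<close>, the vectors at these
  points are their own components.\<close>

definition cov_deriv_along ::
    "('b, 'f::euclidean_space) manifold \<Rightarrow> ('a, 'e::euclidean_space) manifold \<Rightarrow>
     ('a \<Rightarrow> 'e \<Rightarrow> 'e \<Rightarrow> real) \<Rightarrow> ('b \<Rightarrow> 'a) \<Rightarrow> ('b \<Rightarrow> 'e) \<Rightarrow> 'b \<Rightarrow> 'f \<Rightarrow> 'e" where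
  "cov_deriv_along S M g \<psi> V p v =
     (let c = chart_at S p; d = chart_at M (\<psi> p)
      in frechet_derivative (\<lambda>x. components M d (\<psi> (chart_inv c x)) (V (chart_inv c x)))
           (at (snd c p)) v
       + christoffel M g d (snd d (\<psi> p)) (differential S M \<psi> p v) (V p))"

definition levi_civita ::
    "('a, 'e::euclidean_space) manifold \<Rightarrow> ('a \<Rightarrow> 'e \<Rightarrow> 'e \<Rightarrow> real) \<Rightarrow>
     ('a \<Rightarrow> 'e) \<Rightarrow> ('a \<Rightarrow> 'e) \<Rightarrow> 'a \<Rightarrow> 'e" where
  "levi_civita M g X Y p = cov_deriv_along M M g id Y p (X p)"

text \<open>The curvature tensor at a point is evaluated on arbitrary smooth local extensions of the
  three vectors; by tensoriality the value does not depend on them.\<close>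

definition curvature ::
    "('a, 'e::euclidean_space) manifold \<Rightarrow> ('a \<Rightarrow> 'e \<Rightarrow> 'e \<Rightarrow> real) \<Rightarrow>
     'a \<Rightarrow> 'e \<Rightarrow> 'e \<Rightarrow> 'e \<Rightarrow> 'e" where
  "curvature M g q u v w =
     (THE z. \<forall>U X Y Z. openin (mtop M) U \<and> q \<in> U \<and>
        vector_field M U X \<and> vector_field M U Y \<and> vector_field M U Z \<and>
        X q = u \<and> Y q = v \<and> Z q = w \<longrightarrow>
        z = levi_civita M g X (levi_civita M g Y Z) q
          - levi_civita M g Y (levi_civita M g X Z) q
          - levi_civita M g (lie_bracket M X Y) Z q)"

section \<open>Spacelike submanifolds\<close>

definition spacelike_submanifold ::
    "('b, 'f::euclidean_space) manifold \<Rightarrow> ('a, 'e::euclidean_space) manifold \<Rightarrow>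
     ('a \<Rightarrow> 'e \<Rightarrow> 'e \<Rightarrow> real) \<Rightarrow> ('b \<Rightarrow> 'a) \<Rightarrow> bool" where
  "spacelike_submanifold S M g \<psi> \<longleftrightarrow>
     smooth_manifold S \<and> connected_space (mtop S) \<and> immersion S M \<psi> \<and>
     (\<forall>p\<in>topspace (mtop S). \<forall>v. v \<noteq> 0 \<longrightarrow>
        g (\<psi> p) (differential S M \<psi> p v) (differential S M \<psi> p v) > 0)"

definition normal_space ::
    "('b, 'f::euclidean_space) manifold \<Rightarrow> ('a, 'e::euclidean_space) manifold \<Rightarrow>
     ('a \<Rightarrow> 'e \<Rightarrow> 'e \<Rightarrow> real) \<Rightarrow> ('b \<Rightarrow> 'a) \<Rightarrow> 'b \<Rightarrow> 'e set" where
  "normal_space S M g \<psi> p = {w. \<forall>v. g (\<psi> p) w (differential S M \<psi> p v) = 0}"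

definition normal_part ::
    "('b, 'f::euclidean_space) manifold \<Rightarrow> ('a, 'e::euclidean_space) manifold \<Rightarrow>
     ('a \<Rightarrow> 'e \<Rightarrow> 'e \<Rightarrow> real) \<Rightarrow> ('b \<Rightarrow> 'a) \<Rightarrow> 'b \<Rightarrow> 'e \<Rightarrow> 'e" where
  "normal_part S M g \<psi> p w =
     (THE z. z \<in> normal_space S M g \<psi> p \<and> w - z \<in> range (differential S M \<psi> p))"

definition normal_field ::
    "('b, 'f::euclidean_space) manifold \<Rightarrow> ('a, 'e::euclidean_space) manifold \<Rightarrow>
     ('a \<Rightarrow> 'e \<Rightarrow> 'e \<Rightarrow> real) \<Rightarrow> ('b \<Rightarrow> 'a) \<Rightarrow> 'b set \<Rightarrow> ('b \<Rightarrow> 'e) \<Rightarrow> bool" where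
  "normal_field S M g \<psi> U \<zeta> \<longleftrightarrow>
     vector_field_along S M \<psi> U \<zeta> \<and> (\<forall>p\<in>U. \<zeta> p \<in> normal_space S M g \<psi> p)"

definition normal_connection ::
    "('b, 'f::euclidean_space) manifold \<Rightarrow> ('a, 'e::euclidean_space) manifold \<Rightarrow>
     ('a \<Rightarrow> 'e \<Rightarrow> 'e \<Rightarrow> real) \<Rightarrow> ('b \<Rightarrow> 'a) \<Rightarrow> ('b \<Rightarrow> 'e) \<Rightarrow> 'b \<Rightarrow> 'f \<Rightarrow> 'e" where
  "normal_connection S M g \<psi> \<zeta> p v = normal_part S M g \<psi> p (cov_deriv_along S M g \<psi> \<zeta> p v)"

definition shape_operator ::
    "('b, 'f::euclidean_space) manifold \<Rightarrow> ('a, 'e::euclidean_space) manifold \<Rightarrow>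
     ('a \<Rightarrow> 'e \<Rightarrow> 'e \<Rightarrow> real) \<Rightarrow> ('b \<Rightarrow> 'a) \<Rightarrow> ('b \<Rightarrow> 'e) \<Rightarrow> 'b \<Rightarrow> 'f \<Rightarrow> 'f" where
  "shape_operator S M g \<psi> \<zeta> p v =
     (THE a. cov_deriv_along S M g \<psi> \<zeta> p v =
        - differential S M \<psi> p a + normal_connection S M g \<psi> \<zeta> p v)"

definition umbilical ::
    "('b, 'f::euclidean_space) manifold \<Rightarrow> ('a, 'e::euclidean_space) manifold \<Rightarrow>
     ('a \<Rightarrow> 'e \<Rightarrow> 'e \<Rightarrow> real) \<Rightarrow> ('b \<Rightarrow> 'a) \<Rightarrow> ('b \<Rightarrow> 'e) \<Rightarrow> bool" where
  "umbilical S M g \<psi> \<zeta> \<longleftrightarrow>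
     (\<exists>\<rho>::'b \<Rightarrow> real. \<forall>p\<in>topspace (mtop S). \<forall>v. shape_operator S M g \<psi> \<zeta> p v = \<rho> p *\<^sub>R v)"

definition lightlike :: "('a \<Rightarrow> 'e \<Rightarrow> 'e \<Rightarrow> real) \<Rightarrow> 'a \<Rightarrow> 'e::euclidean_space \<Rightarrow> bool" where
  "lightlike g q v \<longleftrightarrow> g q v v = 0 \<and> v \<noteq> 0"

definition umbilical_lightlike_normal_field ::
    "('b, 'f::euclidean_space) manifold \<Rightarrow> ('a, 'e::euclidean_space) manifold \<Rightarrow>
     ('a \<Rightarrow> 'e \<Rightarrow> 'e \<Rightarrow> real) \<Rightarrow> ('b \<Rightarrow> 'a) \<Rightarrow> ('b \<Rightarrow> 'e) \<Rightarrow> bool" where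
  "umbilical_lightlike_normal_field S M g \<psi> \<xi> \<longleftrightarrow>
     normal_field S M g \<psi> (topspace (mtop S)) \<xi> \<and>
     (\<forall>p\<in>topspace (mtop S). lightlike g (\<psi> p) (\<xi> p)) \<and>
     umbilical S M g \<psi> \<xi>"

definition locally_rescalable_to_parallel ::
    "('b, 'f::euclidean_space) manifold \<Rightarrow> ('a, 'e::euclidean_space) manifold \<Rightarrow>
     ('a \<Rightarrow> 'e \<Rightarrow> 'e \<Rightarrow> real) \<Rightarrow> ('b \<Rightarrow> 'a) \<Rightarrow> ('b \<Rightarrow> 'e) \<Rightarrow> bool" where
  "locally_rescalable_to_parallel S M g \<psi> \<xi> \<longleftrightarrow>
     (\<forall>p\<in>topspace (mtop S). \<exists>U f. openin (mtop S) U \<and> p \<in> U \<and> smooth_fun S U f \<and>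
        (\<forall>q\<in>U. \<forall>v. normal_connection S M g \<psi> (\<lambda>r. exp (- f r) *\<^sub>R \<xi> r) q v = 0))"

definition normal_curvature ::
    "('b, 'f::euclidean_space) manifold \<Rightarrow> ('a, 'e::euclidean_space) manifold \<Rightarrow>
     ('a \<Rightarrow> 'e \<Rightarrow> 'e \<Rightarrow> real) \<Rightarrow> ('b \<Rightarrow> 'a) \<Rightarrow>
     ('b \<Rightarrow> 'f) \<Rightarrow> ('b \<Rightarrow> 'f) \<Rightarrow> ('b \<Rightarrow> 'e) \<Rightarrow> 'b \<Rightarrow> 'e" where
  "normal_curvature S M g \<psi> X Y \<zeta> p =
     normal_connection S M g \<psi> (\<lambda>q. normal_connection S M g \<psi> \<zeta> q (Y q)) p (X p)
   - normal_connection S M g \<psi> (\<lambda>q. normal_connection S M g \<psi> \<zeta> q (X q)) p (Y p)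
   - normal_connection S M g \<psi> \<zeta> p (lie_bracket S X Y p)"

definition flat_normal_connection ::
    "('b, 'f::euclidean_space) manifold \<Rightarrow> ('a, 'e::euclidean_space) manifold \<Rightarrow>
     ('a \<Rightarrow> 'e \<Rightarrow> 'e \<Rightarrow> real) \<Rightarrow> ('b \<Rightarrow> 'a) \<Rightarrow> bool" where
  "flat_normal_connection S M g \<psi> \<longleftrightarrow>
     (\<forall>U X Y \<zeta>. openin (mtop S) U \<and> vector_field S U X \<and> vector_field S U Y \<and>
        normal_field S M g \<psi> U \<zeta> \<longrightarrow> (\<forall>p\<in>U. normal_curvature S M g \<psi> X Y \<zeta> p = 0))"

end

theory Submission
  imports Defs
begin

text \<open>
  The null field \<open>\<xi>\<close> spans one of the two null directions of the Lorentzian plane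
  normal to \<open>S\<close>, so \<open>\<nabla>\<^sup>\<bottom>\<xi> = \<omega> \<otimes> \<xi>\<close> for a one-form \<open>\<omega>\<close>, and umbilicity gives
  \<open>\<nabla>\<^sub>X \<xi> = - \<rho> X + \<omega>(X) \<xi>\<close>. Differentiating once more, the derivatives of tangent fields cancel
  because the connection has no torsion, which leaves \<open>(R(X, Y)\<xi>)\<^sup>\<bottom> = d\<omega>(X, Y) \<xi>\<close>. On the other hand
  \<open>\<nabla>\<^sup>\<bottom>(exp(-f) \<xi>) = exp(-f) (\<omega> - df) \<otimes> \<xi>\<close>, so \<open>\<xi>\<close> can be rescaled to be parallel near a point iff
  \<open>\<omega>\<close> is exact there, and the equivalence is the Poincare lemma. If \<open>\<xi>\<close> is parallel, then so is the
  null normal field \<open>\<eta>\<close> with \<open>g(\<xi>, \<eta>) = 1\<close>, and a parallel frame makes the normal connection flat.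
\<close>

section \<open>Calculus of smooth maps\<close>

text \<open>The definitions evaluate every object at \<open>p\<close> in a preferred chart that
  jumps with \<open>p\<close>, so nothing can be differentiated before a chart is fixed. Hence each
  analytic fact is proved on open subsets of Euclidean spaces (\<open>metric_patch\<close>,
  \<open>connection_patch\<close>, \<open>spacelike_patch\<close>), and independence of the charts
  is shown once, for the covariant derivative along a map (\<open>Dc_change\<close>). The identity
  of \<open>M\<close> and the immersion are two instances of it, so one Ricci identity yields both
  the curvature tensor of \<open>M\<close> and the second derivatives of \<xi>. The factor in
  umbilicity is only given as a function; its smoothness has to be recovered before \<omega> can be
  differentiated. Smoothness of the Christoffel symbols and of tangential components comes from one
  principle: the solution of a smooth linear system with injective coefficients is smooth. Condition
  2 tests globally defined fields only, so bump functions are needed to reach arbitrary tangent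
  vectors.\<close>

abbreviation fd :: "('a::real_normed_vector \<Rightarrow> 'b::real_normed_vector) \<Rightarrow> 'a \<Rightarrow> 'a \<Rightarrow> 'b" where
  "fd f x \<equiv> frechet_derivative f (at x)"

lemma fd_eqI: "(f has_derivative f') (at x) \<Longrightarrow> fd f x = f'"
  using frechet_derivative_at by metis

lemma differentiable_fd: "f differentiable (at x) \<Longrightarrow> (f has_derivative fd f x) (at x)"
  by (simp add: frechet_derivative_works)

section \<open>Closure rules for maps of class C^k\<close>

lemma Ck_on_cong:
  assumes "open U" "\<And>x. x \<in> U \<Longrightarrow> f x = g x" "Ck_on k U f"
  shows "Ck_on k U g"
  using assms(2,3)
proof (induction k arbitrary: f g)
  case 0
  then show ?case by (metis Ck_on.simps(1) continuous_on_cong)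
next
  case (Suc k)
  have d: "f differentiable (at x)" if "x \<in> U" for x
    using Suc.prems that by auto
  have "fd f x = fd g x" if "x \<in> U" for x
    using frechet_derivative_transform_within_open[OF d[OF that] assms(1) that] Suc.prems(1) by blast
  moreover have "g differentiable (at x)" if "x \<in> U" for x
    using has_derivative_transform_within_open[OF differentiable_fd[OF d[OF that]] assms(1) that]
      Suc.prems(1) by (meson differentiableI)
  moreover have "Ck_on k U (\<lambda>x. fd g x v)" for v
    by (rule Suc.IH[of "\<lambda>x. fd f x v"]) (use Suc.prems calculation(1) in auto)
  ultimately show ?case
    by simp
qed

lemma Ck_on_subset: "Ck_on k U f \<Longrightarrow> V \<subseteq> U \<Longrightarrow> Ck_on k V f"
  by (induction k arbitrary: f) (auto intro: continuous_on_subset)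

lemma Ck_on_SucD: "Ck_on (Suc k) U f \<Longrightarrow> Ck_on k U f"
proof (induction k arbitrary: f)
  case 0
  then show ?case
    by (auto intro!: continuous_at_imp_continuous_on differentiable_imp_continuous_within)
next
  case (Suc k)
  have "Ck_on k U (\<lambda>x. fd f x v)" for v
    using Suc.IH Suc.prems by (auto simp del: Ck_on.simps simp: Ck_on.simps(2)[of "Suc k"])
  then show ?case using Suc.prems by auto
qed

lemma Ck_on_const: "Ck_on k U (\<lambda>x. c)"
  by (induction k arbitrary: c) auto

lemma Ck_on_linear:
  assumes "bounded_linear f"
  shows "Ck_on k U f"
proof (cases k)
  case 0
  then show ?thesis using assms by (simp add: linear_continuous_on)
next
  case (Suc m)
  have "fd f x = f" for x
    using assms by (intro fd_eqI bounded_linear_imp_has_derivative)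
  then show ?thesis
    using assms Suc by (auto simp: Ck_on_const bounded_linear_imp_differentiable)
qed

lemma Ck_on_add:
  assumes "open U" "Ck_on k U f" "Ck_on k U g"
  shows "Ck_on k U (\<lambda>x. f x + g x)"
  using assms(2,3)
proof (induction k arbitrary: f g)
  case 0
  then show ?case by (auto intro: continuous_on_add)
next
  case (Suc k)
  have e: "fd (\<lambda>x. f x + g x) x = (\<lambda>v. fd f x v + fd g x v)" if "x \<in> U" for x
    using Suc.prems that by (intro fd_eqI has_derivative_add differentiable_fd) auto
  have c: "Ck_on k U (\<lambda>x. fd f x v + fd g x v)" for v
    using Suc by auto
  have "Ck_on k U (\<lambda>x. fd (\<lambda>x. f x + g x) x v)" for v
    by (rule Ck_on_cong[OF assms(1) _ c]) (simp add: e)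
  then show ?case using Suc.prems by auto
qed

text \<open>The product rule pairs one factor with the derivative of the other, so the induction
  runs over all pairs of maps, and the undifferentiated factor is lowered by one order.\<close>

lemma Ck_on_bilinear:
  assumes "bounded_bilinear p" "open U" "Ck_on k U f" "Ck_on k U g"
  shows "Ck_on k U (\<lambda>x. p (f x) (g x))"
  using assms(3,4)
proof (induction k arbitrary: f g)
  case 0
  then show ?case using bounded_bilinear.continuous_on[OF assms(1)] by auto
next
  case (Suc k)
  have der: "((\<lambda>x. p (f x) (g x)) has_derivative (\<lambda>v. p (f x) (fd g x v) + p (fd f x v) (g x))) (at x)"
    if "x \<in> U" for x
    using Suc.prems that by (intro bounded_bilinear.FDERIV[OF assms(1)] differentiable_fd) auto
  then have e: "fd (\<lambda>x. p (f x) (g x)) x = (\<lambda>v. p (f x) (fd g x v) + p (fd f x v) (g x))"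
    if "x \<in> U" for x
    using fd_eqI that by blast
  have c: "Ck_on k U (\<lambda>x. p (f x) (fd g x v) + p (fd f x v) (g x))" for v
    using Suc.prems Ck_on_SucD[OF Suc.prems(1)] Ck_on_SucD[OF Suc.prems(2)]
    by (intro Ck_on_add Suc.IH assms) auto
  have "Ck_on k U (\<lambda>x. fd (\<lambda>x. p (f x) (g x)) x v)" for v
    by (rule Ck_on_cong[OF assms(2) _ c]) (simp add: e)
  then show ?case using der by (auto simp: differentiable_def)
qed

lemma Ck_on_bounded_linear:
  assumes "bounded_linear h" "open U" "Ck_on k U f"
  shows "Ck_on k U (\<lambda>x. h (f x))"
  using assms(3)
proof (induction k arbitrary: f)
  case 0
  then show ?case using bounded_linear.continuous_on[OF assms(1)] by auto
next
  case (Suc k)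
  have der: "((\<lambda>x. h (f x)) has_derivative (\<lambda>v. h (fd f x v))) (at x)" if "x \<in> U" for x
    using Suc.prems that by (intro bounded_linear.has_derivative[OF assms(1)] differentiable_fd) auto
  then have e: "fd (\<lambda>x. h (f x)) x = (\<lambda>v. h (fd f x v))" if "x \<in> U" for x
    using fd_eqI that by blast
  have c: "Ck_on k U (\<lambda>x. h (fd f x v))" for v
    using Suc by auto
  have "Ck_on k U (\<lambda>x. fd (\<lambda>x. h (f x)) x v)" for v
    by (rule Ck_on_cong[OF assms(2) _ c]) (simp add: e)
  then show ?case using der by (auto simp: differentiable_def)
qed

lemma Ck_on_sum:
  assumes "open U" "\<And>i. i \<in> I \<Longrightarrow> Ck_on k U (f i)"
  shows "Ck_on k U (\<lambda>x. \<Sum>i\<in>I. f i x)"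
  using assms(2)
  by (induction I rule: infinite_finite_induct) (auto intro!: Ck_on_const Ck_on_add assms(1))

text \<open>In the chain rule the direction \<open>fd h x v\<close> moves with \<open>x\<close>,
  while \<open>Ck_on\<close> speaks of fixed directions only. Expanding it in the basis leaves
  coefficients times \<open>fd f (h x) i\<close>, and the induction hypothesis applies to the
  latter.\<close>

lemma Ck_on_compose:
  fixes f :: "'e::euclidean_space \<Rightarrow> 'g::real_normed_vector" and h :: "'x::euclidean_space \<Rightarrow> 'e"
  assumes "open U" "h ` U \<subseteq> V" "Ck_on k V f" "Ck_on k U h"
  shows "Ck_on k U (\<lambda>x. f (h x))"
  using assms(3,4)
proof (induction k arbitrary: f)
  case 0
  then show ?case using assms(2) by (auto intro: continuous_on_compose2)
next
  case (Suc k)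
  have der: "((\<lambda>x. f (h x)) has_derivative (\<lambda>v. fd f (h x) (fd h x v))) (at x)" if "x \<in> U" for x
    using Suc.prems that assms(2)
    by (intro has_derivative_compose[OF differentiable_fd differentiable_fd]) auto
  have lin: "linear (fd f (h x))" if "x \<in> U" for x
    using Suc.prems that assms(2) by (auto intro!: linear_frechet_derivative)
  have e: "fd (\<lambda>x. f (h x)) x v = (\<Sum>i\<in>Basis. (fd h x v \<bullet> i) *\<^sub>R fd f (h x) i)" if "x \<in> U" for x v
  proof -
    have "fd (\<lambda>x. f (h x)) x v = fd f (h x) (\<Sum>i\<in>Basis. (fd h x v \<bullet> i) *\<^sub>R i)"
      using fd_eqI[OF der[OF that]] by (simp add: euclidean_representation)
    also have "\<dots> = (\<Sum>i\<in>Basis. (fd h x v \<bullet> i) *\<^sub>R fd f (h x) i)"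
      by (simp add: linear_sum[OF lin[OF that]] linear_cmul[OF lin[OF that]])
    finally show ?thesis .
  qed
  have c: "Ck_on k U (\<lambda>x. \<Sum>i\<in>Basis. (fd h x v \<bullet> i) *\<^sub>R fd f (h x) i)" for v
  proof (intro Ck_on_sum assms(1) Ck_on_bilinear[OF bounded_bilinear_scaleR]
      Ck_on_bounded_linear[OF bounded_linear_inner_left])
    show "Ck_on k U (\<lambda>x. fd h x v)" using Suc.prems by auto
    show "Ck_on k U (\<lambda>x. fd f (h x) i)" for i
      using Suc.prems Ck_on_SucD[OF Suc.prems(2)] by (intro Suc.IH) auto
  qed
  have "Ck_on k U (\<lambda>x. fd (\<lambda>x. f (h x)) x v)" for v
    by (rule Ck_on_cong[OF assms(1) _ c]) (simp add: e)
  then show ?case using der by (auto simp: differentiable_def)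
qed

lemma Ck_on_local:
  assumes "\<And>x. x \<in> U \<Longrightarrow> \<exists>V. open V \<and> x \<in> V \<and> Ck_on k V f"
  shows "Ck_on k U f"
  using assms
proof (induction k arbitrary: f)
  case 0
  then have "isCont f x" if "x \<in> U" for x
    using that continuous_on_eq_continuous_at by fastforce
  then show ?case
    by (simp add: continuous_at_imp_continuous_on)
next
  case (Suc k)
  have "f differentiable (at x)" if "x \<in> U" for x
    using Suc.prems[OF that] by auto
  moreover have "Ck_on k U (\<lambda>x. fd f x v)" for v
    by (rule Suc.IH) (use Suc.prems in force)
  ultimately show ?case by auto
qed

section \<open>Closure rules for smooth maps\<close>

lemma smooth_on_cong:
  "open U \<Longrightarrow> smooth_on U f \<Longrightarrow> (\<And>x. x \<in> U \<Longrightarrow> f x = g x) \<Longrightarrow> smooth_on U g"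
  unfolding smooth_on_def by (meson Ck_on_cong)

lemma smooth_on_subset: "smooth_on U f \<Longrightarrow> V \<subseteq> U \<Longrightarrow> smooth_on V f"
  unfolding smooth_on_def by (meson Ck_on_subset)

lemma smooth_on_local:
  "(\<And>x. x \<in> U \<Longrightarrow> \<exists>V. open V \<and> x \<in> V \<and> smooth_on V f) \<Longrightarrow> smooth_on U f"
  unfolding smooth_on_def by (intro allI Ck_on_local) blast

lemma smooth_on_const [intro, simp]: "smooth_on U (\<lambda>x. c)"
  unfolding smooth_on_def by (simp add: Ck_on_const)

lemma smooth_on_linear: "bounded_linear f \<Longrightarrow> smooth_on U f"
  unfolding smooth_on_def by (simp add: Ck_on_linear)

lemma smooth_on_ident [intro, simp]: "smooth_on U (\<lambda>x. x)"
  by (rule smooth_on_linear[OF bounded_linear_ident])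

lemma smooth_on_add: "open U \<Longrightarrow> smooth_on U f \<Longrightarrow> smooth_on U g \<Longrightarrow> smooth_on U (\<lambda>x. f x + g x)"
  unfolding smooth_on_def by (simp add: Ck_on_add)

lemma smooth_on_bilinear:
  "bounded_bilinear p \<Longrightarrow> open U \<Longrightarrow> smooth_on U f \<Longrightarrow> smooth_on U g \<Longrightarrow> smooth_on U (\<lambda>x. p (f x) (g x))"
  unfolding smooth_on_def by (simp add: Ck_on_bilinear)

lemmas smooth_on_scaleR = smooth_on_bilinear[OF bounded_bilinear_scaleR]
  and smooth_on_inner = smooth_on_bilinear[OF bounded_bilinear_inner]

lemma smooth_on_mult:
  fixes f g :: "'e::euclidean_space \<Rightarrow> real"
  shows "open U \<Longrightarrow> smooth_on U f \<Longrightarrow> smooth_on U g \<Longrightarrow> smooth_on U (\<lambda>x. f x * g x)"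
  by (rule smooth_on_bilinear[OF bounded_bilinear_mult])

lemma smooth_on_bounded_linear:
  "bounded_linear h \<Longrightarrow> open U \<Longrightarrow> smooth_on U f \<Longrightarrow> smooth_on U (\<lambda>x. h (f x))"
  unfolding smooth_on_def by (simp add: Ck_on_bounded_linear)

lemma smooth_on_minus: "open U \<Longrightarrow> smooth_on U f \<Longrightarrow> smooth_on U (\<lambda>x. - f x)"
  by (rule smooth_on_bounded_linear[OF bounded_linear_minus[OF bounded_linear_ident]])

lemma smooth_on_diff: "open U \<Longrightarrow> smooth_on U f \<Longrightarrow> smooth_on U g \<Longrightarrow> smooth_on U (\<lambda>x. f x - g x)"
  using smooth_on_add[of U f "\<lambda>x. - g x"] smooth_on_minus[of U g] by simp

lemma smooth_on_sum:
  "open U \<Longrightarrow> (\<And>i. i \<in> I \<Longrightarrow> smooth_on U (f i)) \<Longrightarrow> smooth_on U (\<lambda>x. \<Sum>i\<in>I. f i x)"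
  unfolding smooth_on_def by (simp add: Ck_on_sum)

lemma smooth_on_compose:
  "smooth_on V f \<Longrightarrow> open U \<Longrightarrow> smooth_on U h \<Longrightarrow> h ` U \<subseteq> V \<Longrightarrow> smooth_on U (\<lambda>x. f (h x))"
  unfolding smooth_on_def using Ck_on_compose by blast

lemma smooth_on_differentiable: "smooth_on U f \<Longrightarrow> x \<in> U \<Longrightarrow> f differentiable (at x)"
  unfolding smooth_on_def using Ck_on.simps(2) by blast

lemma smooth_on_has_derivative:
  "smooth_on U f \<Longrightarrow> x \<in> U \<Longrightarrow> (f has_derivative fd f x) (at x)"
  using smooth_on_differentiable differentiable_fd by blast

lemma smooth_on_linear_fd: "smooth_on U f \<Longrightarrow> x \<in> U \<Longrightarrow> linear (fd f x)"
  using smooth_on_differentiable linear_frechet_derivative by blast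

lemma smooth_on_fd: "smooth_on U f \<Longrightarrow> smooth_on U (\<lambda>x. fd f x v)"
  unfolding smooth_on_def using Ck_on.simps(2) by blast

lemma smooth_on_continuous: "smooth_on U f \<Longrightarrow> continuous_on U f"
  unfolding smooth_on_def using Ck_on.simps(1) by blast

text \<open>Meant for maps whose derivative is already known as a smooth family, such as the
  primitive in \<open>poincare_ball\<close>.\<close>

lemma smooth_on_if_fd:
  assumes "\<And>x. x \<in> U \<Longrightarrow> f differentiable (at x)" "\<And>v. smooth_on U (\<lambda>x. fd f x v)"
  shows "smooth_on U f"
  unfolding smooth_on_def
proof
  fix k
  have "Ck_on (Suc k) U f" using assms by (auto simp: smooth_on_def)
  then show "Ck_on k U f" by (rule Ck_on_SucD)
qed

lemma smooth_on_cong_fd: "open U \<Longrightarrow> smooth_on U f \<Longrightarrow> (\<And>x. x \<in> U \<Longrightarrow> f x = g x) \<Longrightarrow> x \<in> U \<Longrightarrow> fd f x = fd g x"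
  by (meson frechet_derivative_transform_within_open smooth_on_differentiable)

lemma smooth_on_exp: "smooth_on U (exp :: real \<Rightarrow> real)"
proof -
  have d: "((exp :: real \<Rightarrow> real) has_derivative (\<lambda>v. v * exp x)) (at x)" for x :: real
    by (auto intro!: derivative_eq_intros simp: mult.commute)
  then have "fd exp x = (\<lambda>v. v * exp x)" for x :: real using fd_eqI by blast
  then have "Ck_on k UNIV (exp :: real \<Rightarrow> real)" for k
  proof (induction k)
    case 0
    then show ?case by (auto intro: continuous_intros)
  next
    case (Suc k)
    then show ?case using d
      by (auto simp: differentiable_def intro!: Ck_on_bounded_linear[OF bounded_linear_mult_right])
  qed
  then show ?thesis using smooth_on_subset by (auto simp: smooth_on_def intro: Ck_on_subset)
qed

text \<open>The derivative of \<open>inverse\<close> is a polynomial in \<open>inverse\<close>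
  itself, so each order of regularity gives the next; the general case is a composition.\<close>

lemma smooth_on_inverse:
  fixes f :: "'e::euclidean_space \<Rightarrow> real"
  assumes "open U" "smooth_on U f" "\<And>x. x \<in> U \<Longrightarrow> f x \<noteq> 0"
  shows "smooth_on U (\<lambda>x. inverse (f x))"
proof -
  let ?N = "- {0::real}"
  have d: "(inverse has_derivative (\<lambda>v. (- v) * (inverse x * inverse x))) (at x)" if "x \<in> ?N" for x :: real
    using that by (auto intro!: derivative_eq_intros)
  then have e: "fd inverse x = (\<lambda>v. (- v) * (inverse x * inverse x))" if "x \<in> ?N" for x :: real
    using fd_eqI that by blast
  have "Ck_on k ?N (inverse :: real \<Rightarrow> real)" for k
  proof (induction k)
    case 0
    then show ?case by (auto intro!: continuous_intros)
  next
    case (Suc k)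
    have "Ck_on k ?N (\<lambda>x. (- v) * (inverse x * inverse x))" for v
      using Suc by (intro Ck_on_bilinear[OF bounded_bilinear_mult] Ck_on_const) auto
    then have "Ck_on k ?N (\<lambda>x. fd inverse x v)" for v :: real
      by (rule Ck_on_cong[rotated -1]) (auto simp: e)
    then show ?case using d by (auto simp: differentiable_def)
  qed
  then have "smooth_on ?N (inverse :: real \<Rightarrow> real)" by (simp add: smooth_on_def)
  then show ?thesis using assms by (intro smooth_on_compose[of "?N" inverse U f]) auto
qed

lemma smooth_on_divide:
  fixes f g :: "'e::euclidean_space \<Rightarrow> real"
  assumes "open U" "smooth_on U f" "smooth_on U g" "\<And>x. x \<in> U \<Longrightarrow> g x \<noteq> 0"
  shows "smooth_on U (\<lambda>x. f x / g x)"
  using smooth_on_mult[OF assms(1,2) smooth_on_inverse[OF assms(1,3,4)]] by (simp add: divide_inverse)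

subsection \<open>Families of linear and bilinear maps\<close>

lemma linear_basis_expand:
  fixes f :: "'e::euclidean_space \<Rightarrow> 'g::real_vector"
  assumes "linear f"
  shows "f v = (\<Sum>i\<in>Basis. (v \<bullet> i) *\<^sub>R f i)"
  by (subst euclidean_representation[of v, symmetric])
     (simp add: linear_sum[OF assms] linear_cmul[OF assms])

context
  fixes A :: "'x::euclidean_space \<Rightarrow> 'e::euclidean_space \<Rightarrow> 'g::real_normed_vector" and U :: "'x set"
  assumes U: "open U" and lin: "\<And>x. x \<in> U \<Longrightarrow> linear (A x)"
    and smooth: "\<And>v. smooth_on U (\<lambda>x. A x v)"
begin

text \<open>Smoothness of the family is known at fixed vectors only, and the basis expansion reduces
  everything to these. The derivative of the family itself is expressed by freezing the argument at
  \<open>a x\<close>.\<close>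

lemma has_derivative_apply_linear:
  assumes "x \<in> U" "(a has_derivative a') (at x)"
  shows "((\<lambda>y. A y (a y)) has_derivative (\<lambda>v. fd (\<lambda>y. A y (a x)) x v + A x (a' v))) (at x)"
proof -
  have *: "((\<lambda>y. A y (b y)) has_derivative
      (\<lambda>v. (\<Sum>i\<in>Basis. (b x \<bullet> i) *\<^sub>R fd (\<lambda>y. A y i) x v) + A x (b' v))) (at x)"
    if b: "(b has_derivative b') (at x)" for b b'
  proof -
    have "((\<lambda>y. \<Sum>i\<in>Basis. (b y \<bullet> i) *\<^sub>R A y i) has_derivative
        (\<lambda>v. \<Sum>i\<in>Basis. (b x \<bullet> i) *\<^sub>R fd (\<lambda>y. A y i) x v + (b' v \<bullet> i) *\<^sub>R A x i)) (at x)"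
      by (intro has_derivative_sum bounded_bilinear.FDERIV[OF bounded_bilinear_scaleR]
          bounded_linear.has_derivative[OF bounded_linear_inner_left] b
          smooth_on_has_derivative[OF smooth assms(1)])
    then have "((\<lambda>y. A y (b y)) has_derivative
        (\<lambda>v. \<Sum>i\<in>Basis. (b x \<bullet> i) *\<^sub>R fd (\<lambda>y. A y i) x v + (b' v \<bullet> i) *\<^sub>R A x i)) (at x)"
      by (rule has_derivative_transform_within_open[OF _ U assms(1)])
        (rule linear_basis_expand[OF lin, symmetric])
    then show ?thesis
      by (simp add: sum.distrib linear_basis_expand[OF lin[OF assms(1)], of "b' _"])
  qed
  \<comment> \<open>A constant map in place of \<open>b\<close> identifies the sum as the derivative
    with frozen argument.\<close>
  have "fd (\<lambda>y. A y (a x)) x = (\<lambda>v. (\<Sum>i\<in>Basis. (a x \<bullet> i) *\<^sub>R fd (\<lambda>y. A y i) x v))"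
    using fd_eqI[OF *[OF has_derivative_const, of "a x"]] linear_0[OF lin[OF assms(1)]] by simp
  then show ?thesis using *[OF assms(2)] by simp
qed

lemma fd_apply_linear:
  assumes "x \<in> U" "a differentiable (at x)"
  shows "fd (\<lambda>y. A y (a y)) x v = fd (\<lambda>y. A y (a x)) x v + A x (fd a x v)"
  using fd_eqI[OF has_derivative_apply_linear[OF assms(1) differentiable_fd[OF assms(2)]]] by simp

lemma fd_basis_expand:
  assumes "x \<in> U"
  shows "fd (\<lambda>y. A y w) x v = (\<Sum>i\<in>Basis. (w \<bullet> i) *\<^sub>R fd (\<lambda>y. A y i) x v)"
proof -
  have "((\<lambda>y. \<Sum>i\<in>Basis. (w \<bullet> i) *\<^sub>R A y i) has_derivative
        (\<lambda>v. \<Sum>i\<in>Basis. (w \<bullet> i) *\<^sub>R fd (\<lambda>y. A y i) x v)) (at x)"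
    by (intro has_derivative_sum bounded_linear.has_derivative[OF bounded_linear_scaleR_right]
        smooth_on_has_derivative[OF smooth assms(1)])
  then have "((\<lambda>y. A y w) has_derivative
        (\<lambda>v. \<Sum>i\<in>Basis. (w \<bullet> i) *\<^sub>R fd (\<lambda>y. A y i) x v)) (at x)"
    by (rule has_derivative_transform_within_open[OF _ U assms(1)])
       (rule linear_basis_expand[OF lin, symmetric])
  from fd_eqI[OF this] show ?thesis by simp
qed

lemma linear_fd_param:
  assumes "x \<in> U"
  shows "linear (\<lambda>w. fd (\<lambda>y. A y w) x v)"
proof -
  have "linear (\<lambda>w. \<Sum>i\<in>Basis. (w \<bullet> i) *\<^sub>R fd (\<lambda>y. A y i) x v)"
    by (rule linearI) (simp_all add: inner_add_left scaleR_add_left sum.distrib scaleR_sum_right)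
  also have "(\<lambda>w. \<Sum>i\<in>Basis. (w \<bullet> i) *\<^sub>R fd (\<lambda>y. A y i) x v) = (\<lambda>w. fd (\<lambda>y. A y w) x v)"
    by (rule ext, rule fd_basis_expand[OF assms, symmetric])
  finally show ?thesis .
qed

lemma Ck_on_apply_linear:
  assumes "Ck_on k U a"
  shows "Ck_on k U (\<lambda>x. A x (a x))"
proof (rule Ck_on_cong[OF U])
  show "Ck_on k U (\<lambda>x. \<Sum>i\<in>Basis. (a x \<bullet> i) *\<^sub>R A x i)"
    using smooth
    by (intro Ck_on_sum[OF U] Ck_on_bilinear[OF bounded_bilinear_scaleR U]
        Ck_on_bounded_linear[OF bounded_linear_inner_left U assms]) (simp add: smooth_on_def)
qed (rule linear_basis_expand[OF lin, symmetric])

lemma smooth_on_apply_linear: "smooth_on U a \<Longrightarrow> smooth_on U (\<lambda>x. A x (a x))"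
  unfolding smooth_on_def using Ck_on_apply_linear by blast

end

context
  fixes B :: "'x::euclidean_space \<Rightarrow> 'e::euclidean_space \<Rightarrow> 'h::euclidean_space \<Rightarrow> 'g::real_normed_vector"
    and U :: "'x set"
  assumes U: "open U" and bil: "\<And>x. x \<in> U \<Longrightarrow> bilinear (B x)"
    and smooth: "\<And>u v. smooth_on U (\<lambda>x. B x u v)"
begin

lemma smooth_on_apply_bilinear:
  assumes "smooth_on U a" "smooth_on U b"
  shows "smooth_on U (\<lambda>x. B x (a x) (b x))"
proof -
  have "smooth_on U (\<lambda>x. B x (a x) w)" for w
    using bil by (intro smooth_on_apply_linear[where A = "\<lambda>x u. B x u w", OF U _ smooth assms(1)])
      (auto simp: bilinear_def)
  then show ?thesis
    using bil by (intro smooth_on_apply_linear[where A = "\<lambda>x. B x (a x)", OF U _ _ assms(2)])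
      (auto simp: bilinear_def)
qed

lemma fd_apply_bilinear:
  assumes "x \<in> U" "smooth_on U a" "smooth_on U b"
  shows "fd (\<lambda>y. B y (a y) (b y)) x v
    = fd (\<lambda>y. B y (a x) (b x)) x v + B x (fd a x v) (b x) + B x (a x) (fd b x v)"
proof -
  have s: "smooth_on U (\<lambda>x. B x (a x) w)" for w
    by (rule smooth_on_apply_bilinear[OF assms(2) smooth_on_const])
  have "fd (\<lambda>y. B y (a y) (b y)) x v = fd (\<lambda>y. B y (a y) (b x)) x v + B x (a x) (fd b x v)"
    using bil assms smooth_on_differentiable
    by (intro fd_apply_linear[where A = "\<lambda>x. B x (a x)", OF U _ s]) (auto simp: bilinear_def)
  also have "fd (\<lambda>y. B y (a y) (b x)) x v = fd (\<lambda>y. B y (a x) (b x)) x v + B x (fd a x v) (b x)"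
    using bil assms smooth_on_differentiable
    by (intro fd_apply_linear[where A = "\<lambda>y u. B y u (b x)", OF U _ smooth]) (auto simp: bilinear_def)
  finally show ?thesis .
qed

end

lemma fd_compose:
  assumes "h differentiable (at x)" "f differentiable (at (h x))"
  shows "fd (\<lambda>y. f (h y)) x v = fd f (h x) (fd h x v)"
  using fd_eqI[OF has_derivative_compose[OF differentiable_fd[OF assms(1)] differentiable_fd[OF assms(2)]]]
  by simp

subsection \<open>Smooth dependence of solutions of linear systems\<close>

lemma tendsto_nhds_if_continuous_on:
  fixes f :: "'a::t2_space \<Rightarrow> 'b::topological_space"
  assumes "continuous_on V f" "open V" "x \<in> V"
  shows "(f \<longlongrightarrow> f x) (nhds x)"
proof -
  have "(f \<longlongrightarrow> f x) (at x)"
    by (rule isContD) (use assms continuous_on_eq_continuous_at[of V f] in blast)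
  then show ?thesis by (simp add: tendsto_at_iff_tendsto_nhds)
qed

context
  fixes A :: "'x::euclidean_space \<Rightarrow> 'e::euclidean_space \<Rightarrow> 'e" and U :: "'x set"
  assumes U: "open U" and lin: "\<And>x. x \<in> U \<Longrightarrow> linear (A x)"
    and inj: "\<And>x. x \<in> U \<Longrightarrow> inj (A x)"
    and smooth: "\<And>v. smooth_on U (\<lambda>x. A x v)"
begin

text \<open>An injective linear map is bounded below by some \<open>c\<close>. The finitely many
  basis images vary continuously, so near \<open>x\<close> the operator moves by less than
  \<open>c / 2\<close>, and the bound \<open>c / 2\<close> survives.\<close>

lemma locally_bounded_below:
  assumes "x \<in> U"
  shows "\<exists>c>0. eventually (\<lambda>y. y \<in> U \<and> (\<forall>v. c * norm v \<le> norm (A y v))) (nhds x)"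
proof -
  obtain c where c: "c > 0" "\<And>v. c * norm v \<le> norm (A x v)"
    using linear_inj_bounded_below_pos[OF lin inj] assms by metis
  have "continuous_on U (\<lambda>y. \<Sum>i\<in>Basis. norm (A y i - A x i))"
    by (intro continuous_intros smooth_on_continuous[OF smooth])
  then have "((\<lambda>y. \<Sum>i\<in>Basis. norm (A y i - A x i)) \<longlongrightarrow> (\<Sum>i\<in>Basis. norm (A x i - A x i))) (nhds x)"
    by (rule tendsto_nhds_if_continuous_on[OF _ U assms])
  then have "eventually (\<lambda>y. (\<Sum>i\<in>Basis. norm (A y i - A x i)) < c / 2) (nhds x)"
    using c(1) by (intro order_tendstoD) auto
  moreover have "eventually (\<lambda>y. y \<in> U) (nhds x)"
    using U assms by (simp add: eventually_nhds) blast
  ultimately have "eventually (\<lambda>y. y \<in> U \<and> (\<forall>v. c / 2 * norm v \<le> norm (A y v))) (nhds x)"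
  proof eventually_elim
    case (elim y)
    have "c / 2 * norm v \<le> norm (A y v)" for v
    proof -
      have "A y v - A x v = (\<Sum>i\<in>Basis. (v \<bullet> i) *\<^sub>R (A y i - A x i))"
        using elim assms
        by (simp add: linear_basis_expand[OF lin, of _ v] sum_subtractf scaleR_diff_right)
      also have "norm \<dots> \<le> (\<Sum>i\<in>Basis. norm v * norm (A y i - A x i))"
        by (intro order_trans[OF norm_sum] sum_mono) (simp add: Basis_le_norm mult_right_mono)
      also have "\<dots> \<le> norm v * (c / 2)"
        unfolding sum_distrib_left[symmetric] using elim by (intro mult_left_mono) auto
      finally have "norm (A y v - A x v) \<le> norm v * (c / 2)" .
      then show ?thesis
        using c(2)[of v] norm_triangle_ineq2[of "A x v" "A y v"]
        by (simp add: norm_minus_commute field_simps)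
    qed
    then show ?case using elim by auto
  qed
  then show ?thesis using c(1) by (intro exI[of _ "c / 2"]) auto
qed

text \<open>The lower bound turns the residual \<open>b y - A y (z x)\<close>, which tends to 0,
  into a bound for \<open>z y - z x\<close>.\<close>

lemma linear_solve_continuous:
  assumes "continuous_on U b" "\<And>x. x \<in> U \<Longrightarrow> A x (z x) = b x"
  shows "continuous_on U z"
proof -
  have "isCont z x" if x: "x \<in> U" for x
  proof -
    obtain c where c: "c > 0" "eventually (\<lambda>y. y \<in> U \<and> (\<forall>v. c * norm v \<le> norm (A y v))) (nhds x)"
      using locally_bounded_below[OF x] by auto
    have "continuous_on U (\<lambda>y. norm (b y - A y (z x)) / c)"
      using c by (intro continuous_intros assms smooth_on_continuous[OF smooth]) auto
    then have "((\<lambda>y. norm (b y - A y (z x)) / c) \<longlongrightarrow> norm (b x - A x (z x)) / c) (nhds x)"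
      by (rule tendsto_nhds_if_continuous_on[OF _ U x])
    then have "((\<lambda>y. norm (b y - A y (z x)) / c) \<longlongrightarrow> 0) (nhds x)"
      using assms(2)[OF x] by simp
    then have "((\<lambda>y. z y - z x) \<longlongrightarrow> 0) (nhds x)"
    proof (rule Lim_null_comparison[rotated])
      show "eventually (\<lambda>y. norm (z y - z x) \<le> norm (b y - A y (z x)) / c) (nhds x)"
        using c(2)
      proof eventually_elim
        case (elim y)
        have "c * norm (z y - z x) \<le> norm (A y (z y - z x))" using elim by auto
        also have "A y (z y - z x) = b y - A y (z x)"
          using elim by (simp add: linear_diff[OF lin] assms(2))
        finally show ?case using c(1) by (simp add: field_simps)
      qed
    qed
    then show ?thesis
      by (simp add: isCont_def LIM_zero_cancel tendsto_nhds_iff)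
  qed
  then show ?thesis by (simp add: continuous_at_imp_continuous_on)
qed

text \<open>The candidate \<open>z'\<close> comes from differentiating
  \<open>A x (z x) = b x\<close> formally and solving for the derivative of
  \<open>z\<close>.\<close>

lemma linear_solve_has_derivative:
  assumes "x \<in> U" "b differentiable (at x)" "\<And>x. x \<in> U \<Longrightarrow> A x (z x) = b x"
  shows "\<exists>z'. (z has_derivative z') (at x)"
    and "A x (fd z x v) = fd b x v - fd (\<lambda>y. A y (z x)) x v"
proof -
  have surj: "surj (A x)" using linear_injective_imp_surjective[OF lin inj] assms(1) by auto
  have lini: "linear (inv (A x))"
    using inj_linear_imp_inv_linear[OF lin inj] assms(1) by auto
  define z' where "z' v = inv (A x) (fd b x v - fd (\<lambda>y. A y (z x)) x v)" for v
  have linz: "linear z'"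
    unfolding z'_def
    by (intro linear_compose[OF _ lini, unfolded o_def] linear_compose_sub
        linear_frechet_derivative assms(2) smooth_on_differentiable[OF smooth assms(1)])
  have Az: "A x (z' v) = fd b x v - fd (\<lambda>y. A y (z x)) x v" for v
    unfolding z'_def by (rule surj_f_inv_f[OF surj])
  obtain c where c: "c > 0" "eventually (\<lambda>y. y \<in> U \<and> (\<forall>v. c * norm v \<le> norm (A y v))) (nhds x)"
    using locally_bounded_below[OF assms(1)] by auto
  \<comment> \<open>This affine map solves the system to first order: its residual has derivative 0
    at \<open>x\<close>. The lower bound on \<open>A y\<close> carries the estimate over to
    \<open>z y - ?w y\<close>.\<close>
  let ?w = "\<lambda>y. z x + z' (y - x)"
  have w: "(?w has_derivative z') (at x)"
    using linz by (auto intro!: derivative_eq_intros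
        bounded_linear.has_derivative[of z'] simp: linear_linear)
  have "((\<lambda>y. b y - A y (?w y)) has_derivative
      (\<lambda>v. fd b x v - (fd (\<lambda>y. A y (?w x)) x v + A x (z' v)))) (at x)"
    by (intro has_derivative_diff differentiable_fd[OF assms(2)]
        has_derivative_apply_linear[OF U lin smooth assms(1) w])
  then have "((\<lambda>y. b y - A y (?w y)) has_derivative (\<lambda>v. 0)) (at x)"
    using linear_0[OF linz] by (simp add: Az)
  then have "((\<lambda>y. norm (b y - A y (?w y) - (b x - A x (?w x))) / norm (y - x)) \<longlongrightarrow> 0) (at x)"
    by (simp add: has_derivative_iff_norm)
  then have "((\<lambda>y. norm (b y - A y (?w y)) / norm (y - x)) \<longlongrightarrow> 0) (at x)"
    using linear_0[OF linz] assms(1,3) by simp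
  from tendsto_divide[OF this tendsto_const, of c]
  have lim: "((\<lambda>y. norm (b y - A y (?w y)) / norm (y - x) / c) \<longlongrightarrow> 0) (at x)" using c(1) by simp
  have "(z has_derivative z') (at x)"
    unfolding has_derivative_iff_norm
  proof (intro conjI)
    show "bounded_linear z'" using linz by (simp add: linear_linear)
    show "((\<lambda>y. norm (z y - z x - z' (y - x)) / norm (y - x)) \<longlongrightarrow> 0) (at x)"
    proof (rule Lim_null_comparison[OF _ lim])
      have "eventually (\<lambda>y. y \<in> U \<and> (\<forall>v. c * norm v \<le> norm (A y v))) (at x)"
        using c(2) by (simp add: eventually_nhds_conv_at)
      then show "eventually (\<lambda>y. norm (norm (z y - z x - z' (y - x)) / norm (y - x))
          \<le> norm (b y - A y (?w y)) / norm (y - x) / c) (at x)"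
      proof eventually_elim
        case (elim y)
        have "c * norm (z y - ?w y) \<le> norm (A y (z y - ?w y))" using elim by auto
        also have "A y (z y - ?w y) = b y - A y (?w y)"
          using elim by (simp add: linear_diff[OF lin] assms(3))
        finally have "norm (z y - z x - z' (y - x)) \<le> norm (b y - A y (?w y)) / c"
          using c(1) by (simp add: field_simps algebra_simps)
        from divide_right_mono[OF this, of "norm (y - x)"] show ?case
          by (simp add: mult.commute)
      qed
    qed
  qed
  then show "\<exists>z'. (z has_derivative z') (at x)"
    and "A x (fd z x v) = fd b x v - fd (\<lambda>y. A y (z x)) x v"
    using Az fd_eqI by blast+
qed

text \<open>The derivative of \<open>z\<close> solves a system with the same coefficients, whose
  right-hand side contains \<open>z\<close> undifferentiated. So each order of regularity gives the
  next, without a formula for the inverse.\<close>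

lemma smooth_on_linear_solve:
  assumes "smooth_on U b" "\<And>x. x \<in> U \<Longrightarrow> A x (z x) = b x"
  shows "smooth_on U z"
proof -
  have "Ck_on k U z" if "Ck_on k U b" "\<And>x. x \<in> U \<Longrightarrow> A x (z x) = b x" for k b z
    using that
  proof (induction k arbitrary: b z)
    case 0
    then show ?case using linear_solve_continuous by auto
  next
    case (Suc k)
    have "Ck_on k U z" using Suc.IH[OF Ck_on_SucD[OF Suc.prems(1)]] Suc.prems(2) by blast
    have "Ck_on k U (\<lambda>x. fd z x v)" for v
    proof (rule Suc.IH)
      show "A x (fd z x v) = fd b x v - fd (\<lambda>y. A y (z x)) x v" if "x \<in> U" for x
        using Suc.prems that by (intro linear_solve_has_derivative) auto
      have "Ck_on k U (\<lambda>x. fd (\<lambda>y. A y (z x)) x v)"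
        by (rule Ck_on_apply_linear[OF U linear_fd_param[OF U lin smooth] smooth_on_fd[OF smooth]
              \<open>Ck_on k U z\<close>])
      then have "Ck_on k U (\<lambda>x. - fd (\<lambda>y. A y (z x)) x v)"
        by (rule Ck_on_bounded_linear[OF bounded_linear_minus[OF bounded_linear_ident] U])
      then have "Ck_on k U (\<lambda>x. fd b x v + - fd (\<lambda>y. A y (z x)) x v)"
        by (intro Ck_on_add U) (use Suc.prems in auto)
      then show "Ck_on k U (\<lambda>x. fd b x v - fd (\<lambda>y. A y (z x)) x v)" by simp
    qed
    then show ?case
      using linear_solve_has_derivative(1)[of _ b z] Suc.prems by (auto simp: differentiable_def)
  qed
  then show ?thesis using assms by (auto simp: smooth_on_def)
qed

end

subsection \<open>Bump functions\<close>

text \<open>The powers of \<open>inverse t\<close> make the family closed under differentiation up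
  to linear combinations, which is what the induction on the order of differentiability
  requires.\<close>

definition exp_flat :: "nat \<Rightarrow> real \<Rightarrow> real" where
  "exp_flat n t = (if t > 0 then exp (- inverse t) * inverse t ^ n else 0)"

text \<open>Substituting the reciprocal of \<open>t\<close> reduces the right-hand limit to the
  growth of exp against powers.\<close>

lemma tendsto_exp_flat_0: "(exp_flat n \<longlongrightarrow> 0) (at 0)"
proof -
  have "((\<lambda>t::real. inverse t ^ n / exp (inverse t)) \<longlongrightarrow> 0) (at_right 0)"
    by (rule filterlim_compose[OF tendsto_power_div_exp_0 filterlim_inverse_at_top_right])
  then have "(exp_flat n \<longlongrightarrow> 0) (at_right 0)"
    by (rule Lim_transform_eventually)
       (auto simp: exp_flat_def eventually_at_filter exp_minus field_simps)
  moreover have "(exp_flat n \<longlongrightarrow> 0) (at_left 0)"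
    by (rule Lim_transform_eventually[OF tendsto_const])
       (auto simp: exp_flat_def eventually_at_filter)
  ultimately show ?thesis by (simp add: filterlim_split_at)
qed

lemma has_derivative_exp_flat:
  "(exp_flat n has_derivative (\<lambda>v. v * (exp_flat (n + 2) x - real n * exp_flat (n + 1) x))) (at x)"
proof -
  consider "x > 0" | "x < 0" | "x = 0" by linarith
  then have "(exp_flat n has_field_derivative (exp_flat (n + 2) x - real n * exp_flat (n + 1) x)) (at x)"
  proof cases
    case 1
    have "((\<lambda>t. exp (- inverse t) * inverse t ^ n) has_field_derivative
        (exp_flat (n + 2) x - real n * exp_flat (n + 1) x)) (at x)"
      using 1 by (auto intro!: derivative_eq_intros simp: exp_flat_def algebra_simps simp flip: power_Suc)
        (cases n; simp add: algebra_simps power2_eq_square)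
    then show ?thesis
      by (rule has_field_derivative_transform_within_open[of _ _ _ "{0<..}"])
         (use 1 in \<open>auto simp: exp_flat_def\<close>)
  next
    case 2
    have "((\<lambda>t. 0) has_field_derivative (exp_flat (n + 2) x - real n * exp_flat (n + 1) x)) (at x)"
      using 2 by (simp add: exp_flat_def)
    then show ?thesis
      by (rule has_field_derivative_transform_within_open[of _ _ _ "{..<0}"])
         (use 2 in \<open>auto simp: exp_flat_def\<close>)
  next
    case 3
    \<comment> \<open>The difference quotient at 0 is the next member of the family, whose limit is
      known.\<close>
    have "((\<lambda>h. (exp_flat n (0 + h) - exp_flat n 0) / h) \<longlongrightarrow> 0) (at 0)"
      by (rule Lim_transform_eventually[OF tendsto_exp_flat_0[of "Suc n"]])
         (auto simp: exp_flat_def eventually_at_filter field_simps)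
    then show ?thesis using 3 by (simp add: DERIV_def exp_flat_def)
  qed
  then show ?thesis by (simp add: has_field_derivative_def mult.commute[of _ "_ - _"])
qed

lemma smooth_on_exp_flat: "smooth_on U (exp_flat n)"
proof -
  have "Ck_on k UNIV (exp_flat n)" for k
  proof (induction k arbitrary: n)
    case 0
    then show ?case
      using has_derivative_exp_flat has_derivative_continuous continuous_at_imp_continuous_on
      by (metis Ck_on.simps(1))
  next
    case (Suc k)
    have "Ck_on k UNIV (\<lambda>x. v * (exp_flat (n + 2) x + (- real n) * exp_flat (n + 1) x))" for v
      by (rule Ck_on_bounded_linear[OF bounded_linear_mult_right open_UNIV],
          rule Ck_on_add[OF open_UNIV Suc],
          rule Ck_on_bounded_linear[OF bounded_linear_mult_right open_UNIV Suc])
    then show ?case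
      using has_derivative_exp_flat by (auto simp: differentiable_def fd_eqI[OF has_derivative_exp_flat])
  qed
  then show ?thesis by (meson Ck_on_subset smooth_on_def subset_UNIV)
qed

text \<open>The argument \<open>?h x\<close> is positive exactly inside the ball, so composing with
  the flat function makes it vanish outside. The value 1 is only arranged at the centre, which
  suffices to prescribe a vector at one point.\<close>

lemma bump_function_exists:
  fixes c :: "'e::euclidean_space"
  assumes "r > 0"
  obtains \<beta> :: "'e \<Rightarrow> real"
  where "smooth_on UNIV \<beta>" "\<beta> c = 1" "\<And>x. r \<le> dist c x \<Longrightarrow> \<beta> x = 0"
proof
  let ?h = "\<lambda>x. r\<^sup>2 - (x - c) \<bullet> (x - c)"
  let ?\<beta> = "\<lambda>x. exp_flat 0 (?h x) * inverse (exp_flat 0 (r\<^sup>2))"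
  have "smooth_on UNIV ?h"
    by (intro smooth_on_diff smooth_on_inner smooth_on_const smooth_on_ident open_UNIV)
  then have "smooth_on UNIV (\<lambda>x. exp_flat 0 (?h x))"
    by (intro smooth_on_compose[OF smooth_on_exp_flat[of UNIV]]) auto
  then show "smooth_on UNIV ?\<beta>"
    by (intro smooth_on_mult smooth_on_const open_UNIV)
  show "?\<beta> c = 1" using assms by (simp add: exp_flat_def)
  show "?\<beta> x = 0" if "r \<le> dist c x" for x
  proof -
    have "r\<^sup>2 \<le> (dist c x)\<^sup>2" using that assms by (intro power_mono) auto
    then show ?thesis
      by (simp add: exp_flat_def dist_norm norm_minus_commute[of c] power2_norm_eq_inner)
  qed
qed

subsection \<open>Symmetry of second derivatives and the Poincare lemma\<close>

text \<open>The mean value theorem is used twice: in direction \<open>u\<close> for the difference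
  of \<open>f\<close> along opposite edges of a parallelogram, then in direction \<open>v\<close>
  for the derivative so obtained. The bound on \<open>h\<close> keeps the parallelogram inside the
  ball.\<close>

lemma second_difference_eq:
  fixes f :: "'e::euclidean_space \<Rightarrow> real"
  assumes "smooth_on (ball x e) f" "h > 0" "h * (norm u + norm v) < e"
  obtains p where "p \<in> ball x e"
    "f (x + h *\<^sub>R u + h *\<^sub>R v) - f (x + h *\<^sub>R u) - f (x + h *\<^sub>R v) + f x = h * (h * fd (\<lambda>y. fd f y u) p v)"
proof -
  have inb: "x + s *\<^sub>R u + t *\<^sub>R v \<in> ball x e" if "0 \<le> s" "s \<le> h" "0 \<le> t" "t \<le> h" for s t
  proof -
    have "norm (s *\<^sub>R u + t *\<^sub>R v) \<le> s * norm u + t * norm v"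
      using that norm_triangle_ineq[of "s *\<^sub>R u" "t *\<^sub>R v"] by simp
    also have "\<dots> \<le> h * norm u + h * norm v"
      using that by (intro add_mono mult_right_mono) auto
    finally show ?thesis
      using assms(3) norm_minus_cancel[of "s *\<^sub>R u + t *\<^sub>R v"]
      by (simp add: dist_norm algebra_simps)
  qed
  have d1: "((\<lambda>s. f (x + s *\<^sub>R u + t *\<^sub>R v)) has_derivative
      (\<lambda>k. k * fd f (x + s *\<^sub>R u + t *\<^sub>R v) u)) (at s)"
    if "0 \<le> s" "s \<le> h" "0 \<le> t" "t \<le> h" for s t
  proof -
    have "((\<lambda>s. f (x + s *\<^sub>R u + t *\<^sub>R v)) has_derivative
        (\<lambda>k. fd f (x + s *\<^sub>R u + t *\<^sub>R v) (k *\<^sub>R u))) (at s)"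
      by (rule has_derivative_compose[where f = "\<lambda>s. x + s *\<^sub>R u + t *\<^sub>R v" and g = f,
            OF _ smooth_on_has_derivative[OF assms(1) inb[OF that]]])
         (auto intro!: derivative_eq_intros)
    then show ?thesis
      by (simp add: linear_cmul[OF smooth_on_linear_fd[OF assms(1) inb[OF that]]])
  qed
  have d2: "((\<lambda>t. fd f (x + s *\<^sub>R u + t *\<^sub>R v) u) has_derivative
      (\<lambda>k. k * fd (\<lambda>y. fd f y u) (x + s *\<^sub>R u + t *\<^sub>R v) v)) (at t)"
    if "0 \<le> s" "s \<le> h" "0 \<le> t" "t \<le> h" for s t
  proof -
    have "((\<lambda>t. fd f (x + s *\<^sub>R u + t *\<^sub>R v) u) has_derivative
        (\<lambda>k. fd (\<lambda>y. fd f y u) (x + s *\<^sub>R u + t *\<^sub>R v) (k *\<^sub>R v))) (at t)"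
      by (rule has_derivative_compose[where f = "\<lambda>t. x + s *\<^sub>R u + t *\<^sub>R v" and g = "\<lambda>y. fd f y u",
            OF _ smooth_on_has_derivative[OF smooth_on_fd[OF assms(1)] inb[OF that]]])
         (auto intro!: derivative_eq_intros)
    then show ?thesis
      by (simp add: linear_cmul[OF smooth_on_linear_fd[OF smooth_on_fd[OF assms(1)] inb[OF that]]])
  qed
  have "\<exists>s\<in>{0<..<h}.
      (f (x + h *\<^sub>R u + h *\<^sub>R v) - f (x + h *\<^sub>R u + 0 *\<^sub>R v)) - (f (x + 0 *\<^sub>R u + h *\<^sub>R v) - f (x + 0 *\<^sub>R u + 0 *\<^sub>R v))
      = (h - 0) * fd f (x + s *\<^sub>R u + h *\<^sub>R v) u - (h - 0) * fd f (x + s *\<^sub>R u + 0 *\<^sub>R v) u"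
  proof (rule mvt_simple[where f = "\<lambda>s. f (x + s *\<^sub>R u + h *\<^sub>R v) - f (x + s *\<^sub>R u + 0 *\<^sub>R v)"
        and f' = "\<lambda>s k. k * fd f (x + s *\<^sub>R u + h *\<^sub>R v) u - k * fd f (x + s *\<^sub>R u + 0 *\<^sub>R v) u"])
    fix s assume "0 \<le> s" "s \<le> h"
    then show "((\<lambda>s. f (x + s *\<^sub>R u + h *\<^sub>R v) - f (x + s *\<^sub>R u + 0 *\<^sub>R v)) has_derivative
        (\<lambda>k. k * fd f (x + s *\<^sub>R u + h *\<^sub>R v) u - k * fd f (x + s *\<^sub>R u + 0 *\<^sub>R v) u)) (at s within {0..h})"
      using assms(2) by (intro has_derivative_at_withinI[OF has_derivative_diff[OF d1 d1]]) auto
  qed (rule assms(2))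
  then obtain s where s: "s \<in> {0<..<h}"
    "(f (x + h *\<^sub>R u + h *\<^sub>R v) - f (x + h *\<^sub>R u + 0 *\<^sub>R v)) - (f (x + 0 *\<^sub>R u + h *\<^sub>R v) - f (x + 0 *\<^sub>R u + 0 *\<^sub>R v))
      = (h - 0) * fd f (x + s *\<^sub>R u + h *\<^sub>R v) u - (h - 0) * fd f (x + s *\<^sub>R u + 0 *\<^sub>R v) u"
    by blast
  have "\<exists>t\<in>{0<..<h}. fd f (x + s *\<^sub>R u + h *\<^sub>R v) u - fd f (x + s *\<^sub>R u + 0 *\<^sub>R v) u
      = (h - 0) * fd (\<lambda>y. fd f y u) (x + s *\<^sub>R u + t *\<^sub>R v) v"
  proof (rule mvt_simple[where f = "\<lambda>t. fd f (x + s *\<^sub>R u + t *\<^sub>R v) u"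
        and f' = "\<lambda>t k. k * fd (\<lambda>y. fd f y u) (x + s *\<^sub>R u + t *\<^sub>R v) v"])
    fix t assume "0 \<le> t" "t \<le> h"
    then show "((\<lambda>t. fd f (x + s *\<^sub>R u + t *\<^sub>R v) u) has_derivative
        (\<lambda>k. k * fd (\<lambda>y. fd f y u) (x + s *\<^sub>R u + t *\<^sub>R v) v)) (at t within {0..h})"
      using s(1) by (intro has_derivative_at_withinI[OF d2]) auto
  qed (rule assms(2))
  then obtain t where t: "t \<in> {0<..<h}"
    "fd f (x + s *\<^sub>R u + h *\<^sub>R v) u - fd f (x + s *\<^sub>R u + 0 *\<^sub>R v) u
      = (h - 0) * fd (\<lambda>y. fd f y u) (x + s *\<^sub>R u + t *\<^sub>R v) v"
    by blast
  show thesis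
  proof (rule that)
    show "x + s *\<^sub>R u + t *\<^sub>R v \<in> ball x e" using s t by (intro inb) auto
    have "f (x + h *\<^sub>R u + h *\<^sub>R v) - f (x + h *\<^sub>R u) - f (x + h *\<^sub>R v) + f x
        = h * (fd f (x + s *\<^sub>R u + h *\<^sub>R v) u - fd f (x + s *\<^sub>R u + 0 *\<^sub>R v) u)"
      using s(2) by (simp add: algebra_simps)
    also have "\<dots> = h * (h * fd (\<lambda>y. fd f y u) (x + s *\<^sub>R u + t *\<^sub>R v) v)"
      using t(2) by simp
    finally show "f (x + h *\<^sub>R u + h *\<^sub>R v) - f (x + h *\<^sub>R u) - f (x + h *\<^sub>R v) + f x = \<dots>" .
  qed
qed

text \<open>The second difference is symmetric in \<open>u\<close> and \<open>v\<close>, so the two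
  mixed derivatives agree at suitable points \<open>p\<close> and \<open>q\<close> arbitrarily close
  to \<open>x\<close>. Continuity excludes a gap at \<open>x\<close>.\<close>

lemma second_derivative_symmetric_real:
  fixes f :: "'e::euclidean_space \<Rightarrow> real"
  assumes "open U" "smooth_on U f" "x \<in> U"
  shows "fd (\<lambda>y. fd f y u) x v = fd (\<lambda>y. fd f y v) x u"
proof (rule ccontr)
  let ?F = "\<lambda>p. fd (\<lambda>y. fd f y u) p v" and ?G = "\<lambda>p. fd (\<lambda>y. fd f y v) p u"
  assume "?F x \<noteq> ?G x"
  define \<epsilon> where "\<epsilon> = \<bar>?F x - ?G x\<bar> / 2"
  have \<epsilon>: "\<epsilon> > 0" using \<open>?F x \<noteq> ?G x\<close> by (simp add: \<epsilon>_def)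
  have lim: "(?F \<longlongrightarrow> ?F x) (nhds x)" "(?G \<longlongrightarrow> ?G x) (nhds x)"
    by (intro tendsto_nhds_if_continuous_on[OF _ assms(1,3)] smooth_on_continuous
        smooth_on_fd assms)+
  have "eventually (\<lambda>y. y \<in> U \<and> dist (?F y) (?F x) < \<epsilon> \<and> dist (?G y) (?G x) < \<epsilon>) (nhds x)"
    using tendstoD[OF lim(1) \<epsilon>] tendstoD[OF lim(2) \<epsilon>] eventually_nhds_in_open[OF assms(1,3)]
    by eventually_elim auto
  then obtain e where e: "e > 0"
    "\<And>y. y \<in> ball x e \<Longrightarrow> y \<in> U \<and> dist (?F y) (?F x) < \<epsilon> \<and> dist (?G y) (?G x) < \<epsilon>"
    by (auto simp: eventually_nhds_metric dist_commute)
  \<comment> \<open>The summand 1 keeps the denominator positive when both directions vanish, and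
    makes the size condition strict.\<close>
  define h where "h = e / (norm u + norm v + 1)"
  have h: "h > 0" "h * (norm u + norm v) < e" "h * (norm v + norm u) < e"
  proof -
    have n: "0 < norm u + norm v + 1" by (simp add: add_nonneg_pos)
    then show "h > 0" using e(1) by (simp add: h_def)
    have "e * (norm u + norm v) < e * (norm u + norm v + 1)"
      using e(1) by (intro mult_strict_left_mono) auto
    then show "h * (norm u + norm v) < e"
      using n by (simp add: h_def pos_divide_less_eq)
    then show "h * (norm v + norm u) < e" by (simp add: add.commute)
  qed
  have sm: "smooth_on (ball x e) f"
    using smooth_on_subset[OF assms(2)] e(2) by blast
  obtain p where p: "p \<in> ball x e"
    "f (x + h *\<^sub>R u + h *\<^sub>R v) - f (x + h *\<^sub>R u) - f (x + h *\<^sub>R v) + f x = h * (h * ?F p)"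
    using second_difference_eq[OF sm h(1,2)] by blast
  obtain q where q: "q \<in> ball x e"
    "f (x + h *\<^sub>R v + h *\<^sub>R u) - f (x + h *\<^sub>R v) - f (x + h *\<^sub>R u) + f x = h * (h * ?G q)"
    using second_difference_eq[OF sm h(1,3)] by blast
  have "h * (h * ?F p) = h * (h * ?G q)"
    using p(2) q(2) by (simp add: algebra_simps)
  then have "?F p = ?G q" using h(1) by simp
  then show False
    using e(2)[OF p(1)] e(2)[OF q(1)] by (auto simp: \<epsilon>_def dist_real_def abs_if split: if_splits)
qed

lemma second_derivative_symmetric:
  fixes f :: "'e::euclidean_space \<Rightarrow> 'g::euclidean_space"
  assumes "open U" "smooth_on U f" "x \<in> U"
  shows "fd (\<lambda>y. fd f y u) x v = fd (\<lambda>y. fd f y v) x u"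
proof (rule euclidean_eqI)
  fix i :: 'g assume "i \<in> Basis"
  have c: "fd (\<lambda>y. F y \<bullet> i) y w = fd F y w \<bullet> i" if "smooth_on U F" "y \<in> U" for F :: "'e \<Rightarrow> 'g" and y w
    using fd_eqI[OF bounded_linear.has_derivative[OF bounded_linear_inner_left
        smooth_on_has_derivative[OF that]]] by simp
  have s: "smooth_on U (\<lambda>y. f y \<bullet> i)"
    by (rule smooth_on_bounded_linear[OF bounded_linear_inner_left assms(1,2)])
  have "fd (\<lambda>y. fd (\<lambda>y. f y \<bullet> i) y u) x v = fd (\<lambda>y. fd f y u) x v \<bullet> i" for u v
  proof -
    have "fd (\<lambda>y. fd (\<lambda>y. f y \<bullet> i) y u) x = fd (\<lambda>y. fd f y u \<bullet> i) x"
      by (rule smooth_on_cong_fd[OF assms(1) smooth_on_fd[OF s] c assms(3)]) (rule assms(2))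
    then show ?thesis using c[OF smooth_on_fd[OF assms(2)] assms(3)] by simp
  qed
  then show "fd (\<lambda>y. fd f y u) x v \<bullet> i = fd (\<lambda>y. fd f y v) x u \<bullet> i"
    using second_derivative_symmetric_real[OF assms(1) s assms(3)] by metis
qed

text \<open>The primitive \<open>G\<close> is the integral of the form along the radius from the
  centre \<open>c\<close> to \<open>x\<close>.\<close>

lemma poincare_ball:
  fixes w :: "'e::euclidean_space \<Rightarrow> 'e \<Rightarrow> real"
  assumes lin: "\<And>x. x \<in> ball c r \<Longrightarrow> linear (w x)"
    and smooth: "\<And>v. smooth_on (ball c r) (\<lambda>x. w x v)"
    and closed: "\<And>x u v. x \<in> ball c r \<Longrightarrow> fd (\<lambda>y. w y u) x v = fd (\<lambda>y. w y v) x u"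
  obtains f where "smooth_on (ball c r) f" "\<And>x v. x \<in> ball c r \<Longrightarrow> fd f x v = w x v"
proof -
  let ?B = "ball c r"
  define \<gamma> where "\<gamma> x t = c + t *\<^sub>R (x - c)" for x :: 'e and t :: real
  have \<gamma>: "\<gamma> x t \<in> ?B" if "x \<in> ?B" "t \<in> {0..1}" for x t
  proof -
    have "\<bar>t\<bar> * norm (x - c) \<le> 1 * norm (x - c)" using that by (intro mult_right_mono) auto
    then show ?thesis using that by (simp add: \<gamma>_def dist_norm norm_minus_commute)
  qed
  \<comment> \<open>\<open>F x t\<close> is the derivative of the integrand in \<open>x\<close>; the
    factor \<open>t\<close> is the derivative of the radial path with respect to its
    endpoint.\<close>
  define F where "F x t v = t * fd (\<lambda>y. w y (x - c)) (\<gamma> x t) v + w (\<gamma> x t) v" for x t v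
  define G where "G x = integral (cbox 0 1) (\<lambda>t. w (\<gamma> x t) (x - c))" for x
  have linF: "linear (F x t)" if "x \<in> ?B" "t \<in> {0..1}" for x t
    using linear_add[OF smooth_on_linear_fd[OF smooth \<gamma>[OF that]]] linear_add[OF lin[OF \<gamma>[OF that]]]
      linear_cmul[OF smooth_on_linear_fd[OF smooth \<gamma>[OF that]]] linear_cmul[OF lin[OF \<gamma>[OF that]]]
    unfolding F_def by (intro linearI) (simp_all add: algebra_simps)
  have derF: "((\<lambda>x. w (\<gamma> x t) (x - c)) has_derivative F x t) (at x)"
    if "x \<in> ?B" "t \<in> {0..1}" for x t
  proof -
    have d\<gamma>: "((\<lambda>x. \<gamma> x t) has_derivative (\<lambda>v. t *\<^sub>R v)) (at x)"
      unfolding \<gamma>_def by (auto intro!: derivative_eq_intros)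
    have sm\<gamma>: "smooth_on ?B (\<lambda>x. \<gamma> x t)"
      unfolding \<gamma>_def by (intro smooth_on_add smooth_on_scaleR smooth_on_diff smooth_on_const smooth_on_ident open_ball)
    have sm: "smooth_on ?B (\<lambda>x. w (\<gamma> x t) v)" for v
      using \<gamma> that by (intro smooth_on_compose[OF smooth _ sm\<gamma>]) auto
    have "((\<lambda>x. w (\<gamma> x t) (x - c)) has_derivative
        (\<lambda>v. fd (\<lambda>y. w (\<gamma> y t) (x - c)) x v + w (\<gamma> x t) v)) (at x)"
      using \<gamma> that lin sm
      by (intro has_derivative_apply_linear[where A = "\<lambda>x. w (\<gamma> x t)", OF open_ball]) (auto intro!: derivative_eq_intros)
    moreover have "fd (\<lambda>y. w (\<gamma> y t) (x - c)) x v = t * fd (\<lambda>y. w y (x - c)) (\<gamma> x t) v" for v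
      using fd_eqI[OF has_derivative_compose[OF d\<gamma> smooth_on_has_derivative[OF smooth \<gamma>[OF that]]]]
        linear_cmul[OF smooth_on_linear_fd[OF smooth \<gamma>[OF that]]] by simp
    ultimately show ?thesis by (simp add: F_def[abs_def])
  qed
  have cont\<gamma>: "continuous_on (?B \<times> {0..1}) (\<lambda>z. \<gamma> (fst z) (snd z))"
    unfolding \<gamma>_def by (intro continuous_intros)
  have contc: "continuous_on (?B \<times> {0..1}) (\<lambda>z. h (\<gamma> (fst z) (snd z)))"
    if "smooth_on ?B h" for h :: "'e \<Rightarrow> real"
    using \<gamma> by (intro continuous_on_compose2[OF smooth_on_continuous[OF that] cont\<gamma>]) auto
  have contF: "continuous_on (?B \<times> {0..1}) (\<lambda>z. F (fst z) (snd z) v)" for v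
  proof -
    have "continuous_on (?B \<times> {0..1}) (\<lambda>z. snd z * (\<Sum>i\<in>Basis. ((fst z - c) \<bullet> i) *\<^sub>R fd (\<lambda>y. w y i) (\<gamma> (fst z) (snd z)) v)
        + w (\<gamma> (fst z) (snd z)) v)"
      by (intro continuous_intros contc smooth smooth_on_fd)
    moreover have "F (fst z) (snd z) v = snd z * (\<Sum>i\<in>Basis. ((fst z - c) \<bullet> i) *\<^sub>R fd (\<lambda>y. w y i) (\<gamma> (fst z) (snd z)) v)
        + w (\<gamma> (fst z) (snd z)) v" if "z \<in> ?B \<times> {0..1}" for z
      using that \<gamma> unfolding F_def
      by (subst fd_basis_expand[OF open_ball lin smooth]) auto
    ultimately show ?thesis by (subst continuous_on_cong[OF refl]) auto
  qed
  have G: "(G has_derivative (\<lambda>v. integral {0..1} (\<lambda>t. F x t v))) (at x)" if x: "x \<in> ?B" for x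
  proof -
    have bl: "bounded_linear (F x t)" if "x \<in> ?B" "t \<in> {0..1}" for x t
      using linF[OF that] by (simp add: linear_linear)
    \<comment> \<open>Differentiation under the integral asks for continuity as a bounded linear
      map; in finite dimension it can be checked on basis vectors.\<close>
    have cont: "continuous_on (?B \<times> {0..1}) (\<lambda>(x, t). Blinfun (F x t))"
    proof (rule continuous_on_blinfun_componentwise)
      fix i :: 'e
      have "continuous_on (?B \<times> {0..1}) (\<lambda>z. blinfun_apply (Blinfun (F (fst z) (snd z))) i)
          = continuous_on (?B \<times> {0..1}) (\<lambda>z. F (fst z) (snd z) i)"
        by (rule continuous_on_cong[OF refl]) (auto simp: bounded_linear_Blinfun_apply bl)
      then show "continuous_on (?B \<times> {0..1}) (\<lambda>z. blinfun_apply (case z of (x, t) \<Rightarrow> Blinfun (F x t)) i)"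
        using contF by (simp add: split_beta)
    qed
    have contw: "continuous_on {0..1} (\<lambda>t. w (\<gamma> x t) (x - c))" if "x \<in> ?B" for x
    proof (rule continuous_on_compose2[OF smooth_on_continuous[OF smooth]])
      show "continuous_on {0..1} (\<gamma> x)" unfolding \<gamma>_def[abs_def] by (intro continuous_intros)
      show "\<gamma> x ` {0..1} \<subseteq> ?B" using \<gamma>[OF that] by blast
    qed
    have "(G has_derivative integral (cbox 0 1) (\<lambda>t. Blinfun (F x t))) (at x within ?B)"
      unfolding G_def
    proof (rule leibniz_rule[OF _ _ _ x convex_ball])
      show "((\<lambda>x. w (\<gamma> x t) (x - c)) has_derivative blinfun_apply (Blinfun (F x t))) (at x within ?B)"
        if "x \<in> ?B" "t \<in> cbox 0 1" for x t
        using that bl derF by (simp add: bounded_linear_Blinfun_apply has_derivative_at_withinI)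
      show "(\<lambda>t. w (\<gamma> x t) (x - c)) integrable_on cbox 0 1" if "x \<in> ?B" for x
        using contw[OF that] by (simp add: integrable_continuous_interval)
      show "continuous_on (?B \<times> cbox 0 1) (\<lambda>(x, t). Blinfun (F x t))"
        using cont by simp
    qed
    moreover have "blinfun_apply (integral (cbox 0 1) (\<lambda>t. Blinfun (F x t))) = (\<lambda>v. integral {0..1} (\<lambda>t. F x t v))"
    proof (rule ext)
      fix v
      have "continuous_on {0..1} (\<lambda>t. Blinfun (F x t))"
        using continuous_on_compose2[OF cont, of "{0..1}" "\<lambda>t. (x, t)"] x
        by (force intro: continuous_intros)
      then have "(\<lambda>t. Blinfun (F x t)) integrable_on {0..1}" by (rule integrable_continuous_interval)
      then have "blinfun_apply (integral {0..1} (\<lambda>t. Blinfun (F x t))) v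
          = integral {0..1} (\<lambda>t. blinfun_apply (Blinfun (F x t)) v)"
        by (rule blinfun_apply_integral)
      also have "\<dots> = integral {0..1} (\<lambda>t. F x t v)"
        by (rule integral_cong) (simp only: bounded_linear_Blinfun_apply bl[OF x])
      finally show "blinfun_apply (integral (cbox 0 1) (\<lambda>t. Blinfun (F x t))) v = integral {0..1} (\<lambda>t. F x t v)"
        by simp
    qed
    ultimately show ?thesis
      by (simp add: at_within_open[OF x open_ball])
  qed
  have FTC: "integral {0..1} (\<lambda>t. F x t v) = w x v" if x: "x \<in> ?B" for x v
  proof -
    \<comment> \<open>By closedness, \<open>F x t v\<close> is the derivative of
      \<open>t * w (\<gamma> x t) v\<close> in \<open>t\<close>. The factor \<open>t\<close> removes
      the boundary term at the centre.\<close>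
    have "((\<lambda>t. F x t v) has_integral 1 * w (\<gamma> x 1) v - 0 * w (\<gamma> x 0) v) {0..1}"
    proof (rule fundamental_theorem_of_calculus)
      fix t :: real assume t: "t \<in> {0..1}"
      have "((\<lambda>t. w (\<gamma> x t) v) has_derivative (\<lambda>k. fd (\<lambda>y. w y v) (\<gamma> x t) (k *\<^sub>R (x - c)))) (at t)"
        by (rule has_derivative_compose[where f = "\<gamma> x", OF _ smooth_on_has_derivative[OF smooth \<gamma>[OF x t]]])
           (auto simp: \<gamma>_def[abs_def] intro!: derivative_eq_intros)
      then have "((\<lambda>t. w (\<gamma> x t) v) has_real_derivative fd (\<lambda>y. w y v) (\<gamma> x t) (x - c)) (at t)"
        by (simp add: linear_cmul[OF smooth_on_linear_fd[OF smooth \<gamma>[OF x t]]]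
            has_field_derivative_def mult.commute[of _ "fd _ _ _"])
      then have "((\<lambda>t. t * w (\<gamma> x t) v) has_real_derivative F x t v) (at t)"
        using closed[OF \<gamma>[OF x t], of v "x - c"]
        by (auto intro!: derivative_eq_intros simp: F_def)
      then show "((\<lambda>t. t * w (\<gamma> x t) v) has_vector_derivative F x t v) (at t within {0..1})"
        by (simp add: has_real_derivative_iff_has_vector_derivative has_vector_derivative_at_within)
    qed simp
    then show ?thesis by (simp add: integral_unique \<gamma>_def)
  qed
  have G': "(G has_derivative w x) (at x)" if "x \<in> ?B" for x
    using G[OF that] FTC[OF that] by simp
  have fdG: "fd G x v = w x v" if "x \<in> ?B" for x v
    using fd_eqI[OF G'[OF that]] by simp
  have "smooth_on ?B G"
  proof (rule smooth_on_if_fd)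
    show "smooth_on ?B (\<lambda>x. fd G x v)" for v
      by (rule smooth_on_cong[OF open_ball smooth fdG[symmetric]])
  qed (use G' in \<open>auto simp: differentiable_def\<close>)
  then show thesis using that fdG by blast
qed

section \<open>Affine connections in coordinates\<close>

definition nondegenerate :: "('e::real_vector \<Rightarrow> 'e \<Rightarrow> real) \<Rightarrow> bool" where
  "nondegenerate h \<longleftrightarrow> (\<forall>z. (\<forall>w. h z w = 0) \<longrightarrow> z = 0)"

text \<open>The condition under the definite description in \<open>christoffel\<close>, with an
  abstract metric, so that existence and uniqueness can be settled on a Euclidean patch.\<close>

definition levi_civita_form ::
    "('e::euclidean_space \<Rightarrow> 'e \<Rightarrow> 'e \<Rightarrow> real) \<Rightarrow> 'e \<Rightarrow> ('e \<Rightarrow> 'e \<Rightarrow> 'e) \<Rightarrow> bool" where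
  "levi_civita_form G x \<Gamma> \<longleftrightarrow> bilinear \<Gamma> \<and> (\<forall>u v. \<Gamma> u v = \<Gamma> v u) \<and>
     (\<forall>u v w. fd (\<lambda>y. G y v w) x u = G x (\<Gamma> u v) w + G x v (\<Gamma> u w))"

lemma christoffel_levi_civita_form:
  "christoffel M g c x = (THE \<Gamma>. levi_civita_form (metric_in_chart M g c) x \<Gamma>)"
  by (simp add: christoffel_def levi_civita_form_def)

locale metric_patch =
  fixes \<Omega> :: "'e::euclidean_space set" and G :: "'e \<Rightarrow> 'e \<Rightarrow> 'e \<Rightarrow> real"
  assumes open_patch: "open \<Omega>"
    and bilinear_metric: "x \<in> \<Omega> \<Longrightarrow> bilinear (G x)"
    and metric_sym: "x \<in> \<Omega> \<Longrightarrow> G x u v = G x v u"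
    and nondegenerate_metric: "x \<in> \<Omega> \<Longrightarrow> nondegenerate (G x)"
    and smooth_metric: "smooth_on \<Omega> (\<lambda>x. G x u v)"
begin

lemma linear_metric: "x \<in> \<Omega> \<Longrightarrow> linear (G x u)" "x \<in> \<Omega> \<Longrightarrow> linear (\<lambda>u. G x u v)"
  using bilinear_metric by (auto simp: bilinear_def)

lemma metric_eqI:
  assumes "x \<in> \<Omega>" "\<And>w. G x z w = G x z' w"
  shows "z = z'"
proof -
  have "G x (z - z') w = 0" for w
    using assms(2) linear_diff[OF linear_metric(2)[OF assms(1)]] by simp
  then have "z - z' = 0" using nondegenerate_metric[OF assms(1)] unfolding nondegenerate_def by blast
  then show ?thesis by simp
qed

definition dmetric :: "'e \<Rightarrow> 'e \<Rightarrow> 'e \<Rightarrow> 'e \<Rightarrow> real" where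
  "dmetric x u v w = fd (\<lambda>y. G y v w) x u"

lemma dmetric_sym: "x \<in> \<Omega> \<Longrightarrow> dmetric x u v w = dmetric x u w v"
  unfolding dmetric_def
  by (rule fun_cong[OF smooth_on_cong_fd[OF open_patch smooth_metric metric_sym]])

lemma linear_dmetric:
  assumes "x \<in> \<Omega>"
  shows "linear (\<lambda>u. dmetric x u v w)" "linear (\<lambda>v. dmetric x u v w)" "linear (\<lambda>w. dmetric x u v w)"
proof -
  show "linear (\<lambda>u. dmetric x u v w)"
    unfolding dmetric_def using smooth_on_linear_fd[OF smooth_metric assms] by simp
  show "linear (\<lambda>v. dmetric x u v w)" unfolding dmetric_def
    by (rule linear_fd_param[where A = "\<lambda>y v. G y v w", OF open_patch linear_metric(2) smooth_metric assms])
  show "linear (\<lambda>w. dmetric x u v w)" unfolding dmetric_def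
    by (rule linear_fd_param[where A = "\<lambda>y w. G y v w", OF open_patch linear_metric(1) smooth_metric assms])
qed

text \<open>The Koszul expression for coordinate fields, whose brackets vanish. The factor is a
  scalar multiplication so that the closure rules for linear maps apply.\<close>

definition koszul :: "'e \<Rightarrow> 'e \<Rightarrow> 'e \<Rightarrow> 'e \<Rightarrow> real" where
  "koszul x u v w = (1 / 2) *\<^sub>R (dmetric x u v w + dmetric x v u w - dmetric x w u v)"

text \<open>Compatibility splits each \<open>dmetric\<close> into two values of \<open>A\<close>. By
  symmetry of \<Gamma> four of the six resulting terms cancel and the other two coincide.\<close>

lemma koszul_formula:
  assumes "x \<in> \<Omega>" "levi_civita_form G x \<Gamma>"
  shows "G x (\<Gamma> u v) w = koszul x u v w"
proof -
  define A where "A u v w = G x (\<Gamma> u v) w" for u v w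
  have "dmetric x u v w = A u v w + A u w v" for u v w
    using assms(2) metric_sym[OF assms(1)] by (simp add: levi_civita_form_def dmetric_def A_def)
  moreover have "A u v w = A v u w" for u v w
    using assms(2) unfolding levi_civita_form_def A_def by metis
  from this[of v u w] this[of w u v] this[of w v u] have "koszul x u v w = A u v w"
    unfolding koszul_def real_scaleR_def calculation by simp
  then show ?thesis by (simp add: A_def)
qed

lemma levi_civita_form_unique:
  "x \<in> \<Omega> \<Longrightarrow> levi_civita_form G x \<Gamma> \<Longrightarrow> levi_civita_form G x \<Gamma>' \<Longrightarrow> \<Gamma> = \<Gamma>'"
  by (intro ext metric_eqI[of x]) (auto simp: koszul_formula)

text \<open>The musical isomorphism, with covectors represented by means of the standard inner product.\<close>

definition flat :: "'e \<Rightarrow> 'e \<Rightarrow> 'e" where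
  "flat x z = (\<Sum>w\<in>Basis. G x z w *\<^sub>R w)"

text \<open>Both sides collect the values of a linear functional on the basis. An equation between
  covectors thus becomes one for the endomorphism \<open>flat x\<close>, for which injectivity
  implies surjectivity.\<close>

lemma flat_eq_iff:
  assumes "x \<in> \<Omega>" "linear h"
  shows "flat x z = (\<Sum>w\<in>Basis. h w *\<^sub>R w) \<longleftrightarrow> (\<forall>w. G x z w = h w)"
proof
  assume "flat x z = (\<Sum>w\<in>Basis. h w *\<^sub>R w)"
  then have eq: "(\<Sum>w\<in>Basis. G x z w *\<^sub>R w) \<bullet> i = (\<Sum>w\<in>Basis. h w *\<^sub>R w) \<bullet> i" for i
    by (simp only: flat_def)
  have *: "G x z i = h i" if "i \<in> Basis" for i
    using inner_sum_left_Basis[OF that] eq[of i] by metis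
  have "G x z w = h w" for w
    using linear_basis_expand[OF linear_metric(1)[OF assms(1)], of z w]
      linear_basis_expand[OF assms(2), of w] * by simp
  then show "\<forall>w. G x z w = h w" ..
qed (simp add: flat_def)

lemma flat_linear: "x \<in> \<Omega> \<Longrightarrow> linear (flat x)"
  unfolding flat_def
  by (rule linearI)
    (simp_all add: linear_add[OF linear_metric(2)] linear_cmul[OF linear_metric(2)]
      scaleR_add_left sum.distrib scaleR_sum_right)

lemma flat_inj:
  assumes "x \<in> \<Omega>"
  shows "inj (flat x)"
proof (rule injI)
  fix z z' assume "flat x z = flat x z'"
  then have "\<forall>w. G x z w = G x z' w"
    using flat_eq_iff[OF assms linear_metric(1)[OF assms], of z z'] by (simp add: flat_def[of x z'])
  then show "z = z'" using metric_eqI[OF assms] by blast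
qed

lemma smooth_flat: "smooth_on \<Omega> (\<lambda>x. flat x z)"
  unfolding flat_def
  by (intro smooth_on_sum[OF open_patch] smooth_on_scaleR[OF open_patch] smooth_metric smooth_on_const)

text \<open>The Koszul covector is represented by a vector since \<open>flat x\<close> is onto. All
  properties of \<Gamma> are then checked by pairing with the metric.\<close>

lemma levi_civita_form_exists:
  assumes x: "x \<in> \<Omega>"
  shows "\<exists>\<Gamma>. levi_civita_form G x \<Gamma>"
proof -
  have lin: "linear (koszul x u v)" "linear (\<lambda>v. koszul x u v w)" "linear (\<lambda>u. koszul x u v w)" for u v w
    unfolding koszul_def
    by (intro linear_compose_scale_right linear_compose_add linear_compose_sub linear_dmetric[OF x])+
  have "\<exists>z. \<forall>w. G x z w = koszul x u v w" for u v
  proof -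
    obtain z where "flat x z = (\<Sum>w\<in>Basis. koszul x u v w *\<^sub>R w)"
      using surjD[OF linear_injective_imp_surjective[OF flat_linear[OF x] flat_inj[OF x]]] by metis
    then show ?thesis using flat_eq_iff[OF x lin(1)] by blast
  qed
  then obtain \<Gamma> where \<Gamma>: "\<And>u v w. G x (\<Gamma> u v) w = koszul x u v w" by metis
  have "levi_civita_form G x \<Gamma>"
    unfolding levi_civita_form_def bilinear_def
  proof (intro conjI allI linearI)
    note G = linear_add[OF linear_metric(2)[OF x]] linear_cmul[OF linear_metric(2)[OF x]]
    show "\<Gamma> u (v + v') = \<Gamma> u v + \<Gamma> u v'" for u v v'
      by (rule metric_eqI[OF x]) (simp add: \<Gamma> G linear_add[OF lin(2)])
    show "\<Gamma> (v + v') u = \<Gamma> v u + \<Gamma> v' u" for u v v'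
      by (rule metric_eqI[OF x]) (simp add: \<Gamma> G linear_add[OF lin(3)])
    show "\<Gamma> u (r *\<^sub>R v) = r *\<^sub>R \<Gamma> u v" for u v r
      by (rule metric_eqI[OF x]) (simp add: \<Gamma> G linear_cmul[OF lin(2)])
    show "\<Gamma> (r *\<^sub>R v) u = r *\<^sub>R \<Gamma> v u" for u v r
      by (rule metric_eqI[OF x]) (simp add: \<Gamma> G linear_cmul[OF lin(3)])
    show "\<Gamma> u v = \<Gamma> v u" for u v
      by (rule metric_eqI[OF x]) (simp add: \<Gamma> koszul_def dmetric_sym[OF x, of _ u v])
    show "fd (\<lambda>y. G y v w) x u = G x (\<Gamma> u v) w + G x v (\<Gamma> u w)" for u v w
      using dmetric_sym[OF x]
      by (simp add: \<Gamma> metric_sym[OF x, of v] koszul_def dmetric_def[symmetric] field_simps)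
  qed
  then show ?thesis by blast
qed

definition Chr :: "'e \<Rightarrow> 'e \<Rightarrow> 'e \<Rightarrow> 'e" where
  "Chr x = (THE \<Gamma>. levi_civita_form G x \<Gamma>)"

lemma Chr: "x \<in> \<Omega> \<Longrightarrow> levi_civita_form G x (Chr x)"
  unfolding Chr_def using levi_civita_form_exists levi_civita_form_unique by (metis theI)

lemma Chr_eqI: "x \<in> \<Omega> \<Longrightarrow> levi_civita_form G x \<Gamma> \<Longrightarrow> Chr x = \<Gamma>"
  using Chr levi_civita_form_unique by metis

text \<open>The symbols solve a linear system with smooth coefficients \<open>flat x\<close> and the
  Koszul covector as right-hand side, so no inverse metric is formed.\<close>

lemma smooth_Chr: "smooth_on \<Omega> (\<lambda>x. Chr x u v)"
proof (rule smooth_on_linear_solve[where A = flat, OF open_patch flat_linear flat_inj smooth_flat])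
  show "flat x (Chr x u v) = (\<Sum>w\<in>Basis. koszul x u v w *\<^sub>R w)" if "x \<in> \<Omega>" for x
    using koszul_formula[OF that Chr[OF that]] by (simp add: flat_def)
  show "smooth_on \<Omega> (\<lambda>x. \<Sum>w\<in>Basis. koszul x u v w *\<^sub>R w)"
    unfolding koszul_def dmetric_def
    by (intro smooth_on_sum[OF open_patch] smooth_on_scaleR[OF open_patch]
        smooth_on_add[OF open_patch] smooth_on_diff[OF open_patch] smooth_on_fd smooth_metric smooth_on_const)
qed

end

text \<open>\<Gamma> lives on the target patch and \<open>F\<close> is the coordinate expression of
  a map into it. With \<open>F\<close> the identity this is the connection of the ambient manifold;
  with \<open>F\<close> an immersion, differentiation of fields along it.\<close>

locale connection_patch =
  fixes \<Omega> :: "'e::euclidean_space set" and \<Gamma> :: "'e \<Rightarrow> 'e \<Rightarrow> 'e \<Rightarrow> 'e"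
    and W :: "'f::euclidean_space set" and F :: "'f \<Rightarrow> 'e"
  assumes open_target: "open \<Omega>"
    and bilinear_conn: "y \<in> \<Omega> \<Longrightarrow> bilinear (\<Gamma> y)"
    and conn_sym: "y \<in> \<Omega> \<Longrightarrow> \<Gamma> y u v = \<Gamma> y v u"
    and smooth_conn: "smooth_on \<Omega> (\<lambda>y. \<Gamma> y u v)"
    and open_dom: "open W" and smooth_F: "smooth_on W F" and F_target: "F ` W \<subseteq> \<Omega>"
begin

text \<open>The curvature of constant fields, for which the bracket term vanishes; the signs follow
  the convention in \<open>curvature\<close>.\<close>

definition Rm :: "'e \<Rightarrow> 'e \<Rightarrow> 'e \<Rightarrow> 'e \<Rightarrow> 'e" where
  "Rm y u v w = fd (\<lambda>y. \<Gamma> y v w) y u - fd (\<lambda>y. \<Gamma> y u w) y v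
     + \<Gamma> y u (\<Gamma> y v w) - \<Gamma> y v (\<Gamma> y u w)"

definition D :: "('f \<Rightarrow> 'e) \<Rightarrow> 'f \<Rightarrow> 'f \<Rightarrow> 'e" where
  "D V x v = fd V x v + \<Gamma> (F x) (fd F x v) (V x)"

lemma F_in: "x \<in> W \<Longrightarrow> F x \<in> \<Omega>"
  using F_target by blast

lemma linear_conn: "y \<in> \<Omega> \<Longrightarrow> linear (\<Gamma> y u)" "y \<in> \<Omega> \<Longrightarrow> linear (\<lambda>u. \<Gamma> y u v)"
  using bilinear_conn by (auto simp: bilinear_def)

lemma smooth_conn_F: "smooth_on W (\<lambda>x. \<Gamma> (F x) u v)"
  by (rule smooth_on_compose[OF smooth_conn open_dom smooth_F F_target])

lemma bilinear_conn_F: "x \<in> W \<Longrightarrow> bilinear (\<Gamma> (F x))"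
  using bilinear_conn F_in by blast

lemma fd_conn_F:
  assumes x: "x \<in> W" and ab: "smooth_on W a" "smooth_on W b"
  shows "fd (\<lambda>y. \<Gamma> (F y) (a y) (b y)) x v
    = fd (\<lambda>y. \<Gamma> y (a x) (b x)) (F x) (fd F x v) + \<Gamma> (F x) (fd a x v) (b x) + \<Gamma> (F x) (a x) (fd b x v)"
  using fd_apply_bilinear[where B = "\<lambda>x. \<Gamma> (F x)", OF open_dom bilinear_conn_F smooth_conn_F x ab]
    fd_compose[OF smooth_on_differentiable[OF smooth_F x]
      smooth_on_differentiable[OF smooth_conn F_in[OF x]]] by simp

lemma smooth_on_D: "smooth_on W V \<Longrightarrow> smooth_on W (\<lambda>x. D V x v)"
  unfolding D_def
  by (intro smooth_on_add[OF open_dom] smooth_on_fd smooth_F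
      smooth_on_apply_bilinear[where B = "\<lambda>x. \<Gamma> (F x)", OF open_dom bilinear_conn_F smooth_conn_F])

lemma linear_D:
  assumes "smooth_on W V" "x \<in> W"
  shows "linear (D V x)"
  unfolding D_def
  by (rule linearI)
    (simp_all add: linear_add[OF smooth_on_linear_fd[OF assms]] linear_add[OF smooth_on_linear_fd[OF smooth_F assms(2)]]
      linear_cmul[OF smooth_on_linear_fd[OF assms]] linear_cmul[OF smooth_on_linear_fd[OF smooth_F assms(2)]]
      linear_add[OF linear_conn(2)[OF F_in[OF assms(2)]]] linear_cmul[OF linear_conn(2)[OF F_in[OF assms(2)]]] scaleR_add_right)

lemma smooth_on_D_field: "smooth_on W V \<Longrightarrow> smooth_on W b \<Longrightarrow> smooth_on W (\<lambda>x. D V x (b x))"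
  by (rule smooth_on_apply_linear[where A = "D V", OF open_dom linear_D smooth_on_D])

text \<open>The pulled-back form of torsion-freeness: constant fields on the domain commute. It
  removes the derivatives of tangent vectors in \<open>normal_curvature_null\<close>.\<close>

lemma D_sym: "x \<in> W \<Longrightarrow> D (\<lambda>y. fd F y v) x u = D (\<lambda>y. fd F y u) x v"
  unfolding D_def using second_derivative_symmetric[OF open_dom smooth_F] conn_sym[OF F_in] by metis

lemma D_cong:
  assumes "x \<in> W'" "open W'" "smooth_on W' V" "\<And>y. y \<in> W' \<Longrightarrow> V y = V' y"
  shows "D V x = D V' x"
  unfolding D_def using assms smooth_on_cong_fd[OF assms(2,3,4) assms(1)] by (intro ext) auto

lemma D_add:
  assumes "x \<in> W" "V differentiable (at x)" "V' differentiable (at x)"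
  shows "D (\<lambda>y. V y + V' y) x v = D V x v + D V' x v"
  unfolding D_def
  using fd_eqI[OF has_derivative_add[OF assms(2,3)[THEN differentiable_fd]]]
  by (simp add: linear_add[OF linear_conn(1)[OF F_in[OF assms(1)]]])

lemma D_scaleR:
  assumes "x \<in> W" "f differentiable (at x)" "V differentiable (at x)"
  shows "D (\<lambda>y. f y *\<^sub>R V y) x v = fd f x v *\<^sub>R V x + f x *\<^sub>R D V x v"
  unfolding D_def
  using fd_eqI[OF bounded_bilinear.FDERIV[OF bounded_bilinear_scaleR
      assms(2,3)[THEN differentiable_fd]]]
  by (simp add: linear_cmul[OF linear_conn(1)[OF F_in[OF assms(1)]]] scaleR_add_right)

text \<open>The second derivatives of \<open>V\<close> and of \<open>F\<close> cancel by symmetry;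
  derivatives of \<Gamma> and its quadratic terms remain.\<close>

lemma ricci_identity_const:
  assumes x: "x \<in> W" and V: "smooth_on W V"
  shows "D (\<lambda>y. D V y v) x u - D (\<lambda>y. D V y u) x v = Rm (F x) (fd F x u) (fd F x v) (V x)"
proof -
  have fF: "smooth_on W (\<lambda>y. fd F y v)" for v by (rule smooth_on_fd[OF smooth_F])
  have "fd (\<lambda>y. D V y v) x u = fd (\<lambda>y. fd V y v) x u + fd (\<lambda>y. \<Gamma> (F y) (fd F y v) (V y)) x u" for u v
    unfolding D_def
    using fd_eqI[OF has_derivative_add[OF smooth_on_has_derivative[OF smooth_on_fd[OF V] x]
          smooth_on_has_derivative[OF smooth_on_apply_bilinear[where B = "\<lambda>x. \<Gamma> (F x)", OF open_dom
              bilinear_conn_F smooth_conn_F fF V] x]]] by simp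
  then show ?thesis
    using second_derivative_symmetric[OF open_dom V x, of u v]
      second_derivative_symmetric[OF open_dom smooth_F x, of u v]
    unfolding D_def[of "\<lambda>y. D V y _"] Rm_def
    by (simp add: fd_conn_F[OF x fF V] D_def linear_add[OF linear_conn(1)[OF F_in[OF x]]])
qed

text \<open>Compared with constant directions, a variable direction \<open>b\<close> contributes
  only \<open>D V x (fd b x u)\<close>, and the bracket term absorbs both such
  contributions.\<close>

lemma ricci_identity:
  assumes x: "x \<in> W" and V: "smooth_on W V" and ab: "smooth_on W a" "smooth_on W b"
  shows "D (\<lambda>y. D V y (b y)) x (a x) - D (\<lambda>y. D V y (a y)) x (b x)
      - D V x (fd b x (a x) - fd a x (b x))
    = Rm (F x) (fd F x (a x)) (fd F x (b x)) (V x)"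
proof -
  have "D (\<lambda>y. D V y (b y)) x u = D (\<lambda>y. D V y (b x)) x u + D V x (fd b x u)"
    if "smooth_on W b" for b u
  proof -
    have "fd (\<lambda>y. D V y (b y)) x u = fd (\<lambda>y. D V y (b x)) x u + D V x (fd b x u)"
      by (rule fd_apply_linear[where A = "D V", OF open_dom linear_D[OF V] smooth_on_D[OF V] x
            smooth_on_differentiable[OF that x]])
    then show ?thesis
      by (simp only: D_def[of "\<lambda>y. D V y (b y)"] D_def[of "\<lambda>y. D V y (b x)"] ac_simps)
  qed
  from this[OF ab(1), of "b x"] this[OF ab(2), of "a x"]
  show ?thesis
    using ricci_identity_const[OF x V, of "b x" "a x"] linear_diff[OF linear_D[OF V x], of "fd b x (a x)"]
    by simp
qed

end

section \<open>Charts\<close>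

text \<open>The common form of \<open>components\<close> and \<open>of_components\<close>, which use
  the preferred chart on one side; stated for two arbitrary charts so that one chain rule covers
  both.\<close>

definition jac :: "('a, 'e::euclidean_space) chart \<Rightarrow> ('a, 'e) chart \<Rightarrow> 'a \<Rightarrow> 'e \<Rightarrow> 'e" where
  "jac c d p = fd (transition c d) (snd c p)"

lemma components_jac: "components M c p = jac (chart_at M p) c p"
  by (simp add: fun_eq_iff components_def jac_def)

lemma of_components_jac: "of_components M c p = jac c (chart_at M p) p"
  by (simp add: fun_eq_iff of_components_def jac_def)

locale charted_space =
  fixes M :: "('a, 'e::euclidean_space) manifold"
  assumes smooth_manifold: "smooth_manifold M"
begin

lemma chart_open: "c \<in> atlas M \<Longrightarrow> openin (mtop M) (fst c)"
  using smooth_manifold by (simp add: smooth_manifold_def)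

lemma chart_image_open: "c \<in> atlas M \<Longrightarrow> open (snd c ` fst c)"
  using smooth_manifold by (simp add: smooth_manifold_def)

lemma chart_homeo:
  "c \<in> atlas M \<Longrightarrow> homeomorphic_map (subtopology (mtop M) (fst c)) (top_of_set (snd c ` fst c)) (snd c)"
  using smooth_manifold by (simp add: smooth_manifold_def)

lemma hausdorff: "Hausdorff_space (mtop M)"
  using smooth_manifold by (simp add: smooth_manifold_def)

lemma chart_subset: "c \<in> atlas M \<Longrightarrow> fst c \<subseteq> topspace (mtop M)"
  using chart_open openin_subset by metis

lemma topspace_chart: "c \<in> atlas M \<Longrightarrow> topspace (subtopology (mtop M) (fst c)) = fst c"
  using chart_subset by (simp add: inf.absorb2)

lemma chart_inj: "c \<in> atlas M \<Longrightarrow> inj_on (snd c) (fst c)"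
  using homeomorphic_imp_injective_map[OF chart_homeo] topspace_chart by metis

lemma chart_inv [simp]: "c \<in> atlas M \<Longrightarrow> p \<in> fst c \<Longrightarrow> chart_inv c (snd c p) = p"
  by (simp add: chart_inv_def chart_inj inv_into_f_f)

lemma chart_at: "p \<in> topspace (mtop M) \<Longrightarrow> chart_at M p \<in> atlas M \<and> p \<in> fst (chart_at M p)"
proof -
  assume "p \<in> topspace (mtop M)"
  then have "\<exists>c. c \<in> atlas M \<and> p \<in> fst c"
    using smooth_manifold unfolding smooth_manifold_def by blast
  then show ?thesis unfolding chart_at_def by (rule someI_ex)
qed

lemma chart_at_of_chart:
  assumes "c \<in> atlas M" "p \<in> fst c"
  shows "chart_at M p \<in> atlas M" "p \<in> fst (chart_at M p)"
  using chart_at[of p] chart_subset[OF assms(1)] assms(2) by auto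

lemma open_image_inter:
  assumes "c \<in> atlas M" "openin (mtop M) U"
  shows "open (snd c ` (U \<inter> fst c))"
proof -
  have "openin (subtopology (mtop M) (fst c)) (U \<inter> fst c)"
    using assms(2) by (auto simp: openin_subtopology)
  then have "openin (top_of_set (snd c ` fst c)) (snd c ` (U \<inter> fst c))"
    using homeomorphic_imp_open_map[OF chart_homeo[OF assms(1)]] by (auto simp: open_map_def)
  then show ?thesis using openin_open_trans chart_image_open[OF assms(1)] by blast
qed

lemma openin_chart_preimage:
  assumes "c \<in> atlas M" "open V"
  shows "openin (mtop M) {p \<in> fst c. snd c p \<in> V}"
proof -
  have "openin (top_of_set (snd c ` fst c)) (snd c ` fst c \<inter> V)"
    using assms(2) by (auto simp: openin_open)
  from openin_continuous_map_preimage[OF homeomorphic_imp_continuous_map[OF chart_homeo[OF assms(1)]] this]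
  have "openin (subtopology (mtop M) (fst c)) {p \<in> fst c. snd c p \<in> V}"
    by (simp only: topspace_chart[OF assms(1)]) (simp add: Collect_conj_eq[symmetric] conj_commute image_iff cong: conj_cong, smt (verit) Collect_cong)
  then show ?thesis
    using chart_open[OF assms(1)] by (rule openin_trans_full)
qed

lemma transition_smooth:
  "c \<in> atlas M \<Longrightarrow> d \<in> atlas M \<Longrightarrow> smooth_on (snd c ` (fst c \<inter> fst d)) (transition c d)"
  using smooth_manifold by (simp add: smooth_manifold_def)

lemma transition_apply: "c \<in> atlas M \<Longrightarrow> p \<in> fst c \<Longrightarrow> transition c d (snd c p) = snd d p"
  by (simp add: transition_def)

lemma overlap_open: "c \<in> atlas M \<Longrightarrow> d \<in> atlas M \<Longrightarrow> open (snd c ` (fst c \<inter> fst d))"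
  using open_image_inter[OF _ chart_open] by (simp add: Int_commute)

lemma overlap3_open:
  "c \<in> atlas M \<Longrightarrow> d \<in> atlas M \<Longrightarrow> e \<in> atlas M \<Longrightarrow> open (snd c ` (fst c \<inter> fst d \<inter> fst e))"
  using open_image_inter[OF _ openin_Int[OF chart_open chart_open], of c d e] by (simp add: ac_simps)

lemma linear_jac:
  "c \<in> atlas M \<Longrightarrow> d \<in> atlas M \<Longrightarrow> p \<in> fst c \<Longrightarrow> p \<in> fst d \<Longrightarrow> linear (jac c d p)"
  unfolding jac_def by (rule smooth_on_linear_fd[OF transition_smooth]) auto

lemma jac_jac:
  assumes "c \<in> atlas M" "d \<in> atlas M" "e \<in> atlas M" "p \<in> fst c" "p \<in> fst d" "p \<in> fst e"
  shows "jac d e p (jac c d p v) = jac c e p v"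
proof -
  let ?O = "snd c ` (fst c \<inter> fst d \<inter> fst e)"
  have "((\<lambda>x. transition d e (transition c d x)) has_derivative (\<lambda>v. jac d e p (jac c d p v))) (at (snd c p))"
    unfolding jac_def
  proof (rule has_derivative_compose[where f = "transition c d" and f' = "fd (transition c d) (snd c p)"
        and g' = "fd (transition d e) (snd d p)"])
    show "(transition c d has_derivative fd (transition c d) (snd c p)) (at (snd c p))"
      by (rule smooth_on_has_derivative[OF transition_smooth]) (use assms in auto)
    show "(transition d e has_derivative fd (transition d e) (snd d p)) (at (transition c d (snd c p)))"
      unfolding transition_apply[OF assms(1,4)]
      by (rule smooth_on_has_derivative[OF transition_smooth]) (use assms in auto)
  qed
  then have "(transition c e has_derivative (\<lambda>v. jac d e p (jac c d p v))) (at (snd c p))"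
    by (rule has_derivative_transform_within_open[OF _ overlap3_open[OF assms(1-3)]])
       (use assms in \<open>auto simp: transition_apply\<close>)
  from fd_eqI[OF this] show ?thesis by (simp add: jac_def)
qed

lemma jac_self [simp]:
  assumes "c \<in> atlas M" "p \<in> fst c"
  shows "jac c c p v = v"
proof -
  have "(transition c c has_derivative (\<lambda>v. v)) (at (snd c p))"
    by (rule has_derivative_transform_within_open[OF has_derivative_ident chart_image_open[OF assms(1)]])
       (use assms in \<open>auto simp: transition_apply\<close>)
  from fd_eqI[OF this] show ?thesis by (simp add: jac_def)
qed

lemma jac_inverse [simp]:
  assumes "c \<in> atlas M" "d \<in> atlas M" "p \<in> fst c" "p \<in> fst d"
  shows "jac d c p (jac c d p v) = v"
  using assms by (simp add: jac_jac)

lemma components_of_components [simp]: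
  assumes "c \<in> atlas M" "p \<in> fst c"
  shows "components M c p (of_components M c p u) = u" "of_components M c p (components M c p u) = u"
  using chart_at_of_chart[OF assms] assms by (simp_all add: components_jac of_components_jac)

lemma components_jac_components:
  assumes "c \<in> atlas M" "d \<in> atlas M" "p \<in> fst c" "p \<in> fst d"
  shows "jac c d p (components M c p v) = components M d p v"
  using chart_at_of_chart[OF assms(1,3)] assms by (simp add: components_jac jac_jac)

lemma components_chart_at: "p \<in> topspace (mtop M) \<Longrightarrow> components M (chart_at M p) p v = v"
  using chart_at[of p] by (simp add: components_jac)

lemma of_components_chart_at: "p \<in> topspace (mtop M) \<Longrightarrow> of_components M (chart_at M p) p v = v"
  using chart_at[of p] by (simp add: of_components_jac)

lemma linear_components: "c \<in> atlas M \<Longrightarrow> p \<in> fst c \<Longrightarrow> linear (components M c p)"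
  unfolding components_jac by (intro linear_jac chart_at_of_chart)

lemma linear_of_components: "c \<in> atlas M \<Longrightarrow> p \<in> fst c \<Longrightarrow> linear (of_components M c p)"
  unfolding of_components_jac by (intro linear_jac chart_at_of_chart)

text \<open>In another chart the components are a directional derivative of a transition map, hence
  smooth. These fields serve as the local extensions in \<open>curvature\<close>.\<close>

lemma constant_field:
  assumes "c \<in> atlas M" "U \<subseteq> fst c" "openin (mtop M) U"
  shows "vector_field M U (\<lambda>p. of_components M c p u)"
  unfolding vector_field_def vector_field_along_def
proof (intro ballI)
  fix d e assume d: "d \<in> atlas M" and e: "e \<in> atlas M"
  let ?O = "snd d ` (U \<inter> fst d \<inter> id -` fst e)"
  have op: "open ?O"
    using open_image_inter[OF d openin_Int[OF assms(3) chart_open[OF e]]] by (simp add: ac_simps)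
  have "smooth_on ?O (\<lambda>x. fd (transition c e) (transition d c x) u)"
    by (rule smooth_on_compose[OF smooth_on_fd[OF transition_smooth[OF assms(1) e]] op
          smooth_on_subset[OF transition_smooth[OF d assms(1)]]])
       (use assms d in \<open>auto simp: transition_apply\<close>)
  then show "smooth_on ?O (\<lambda>x. components M e (id (chart_inv d x)) (of_components M c (chart_inv d x) u))"
  proof (rule smooth_on_cong[OF op])
    fix x assume "x \<in> ?O"
    then obtain p where p: "p \<in> U" "p \<in> fst d" "p \<in> fst e" "x = snd d p" by auto
    then have "p \<in> fst c" using assms by auto
    then show "fd (transition c e) (transition d c x) u
        = components M e (id (chart_inv d x)) (of_components M c (chart_inv d x) u)"
      using p assms(1) d e chart_at_of_chart[OF d p(2)]
      by (simp add: components_jac of_components_jac jac_jac transition_apply) (simp add: jac_def)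
  qed
qed

text \<open>A coordinate field is cut off by a bump function and extended by 0, so that any tangent
  vector is the value of a global field.\<close>

lemma smooth_bump_field:
  assumes c: "c \<in> atlas M" and p: "p \<in> fst c"
  shows "\<exists>X. vector_field M (topspace (mtop M)) X \<and> X p = of_components M c p u"
proof -
  obtain e where e: "e > 0" "cball (snd c p) e \<subseteq> snd c ` fst c"
    using chart_image_open[OF c] p by (meson image_eqI open_contains_cball)
  obtain \<beta> :: "'e \<Rightarrow> real" where \<beta>: "smooth_on UNIV \<beta>" "\<beta> (snd c p) = 1"
    "\<And>x. e \<le> dist (snd c p) x \<Longrightarrow> \<beta> x = 0"
    using bump_function_exists[OF e(1)] by blast
  define X where "X q = (if q \<in> fst c then \<beta> (snd c q) *\<^sub>R of_components M c q u else 0)" for q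
  \<comment> \<open>\<open>K\<close> contains the points where \<open>X\<close> is nonzero. It is
    compact, being the image of a closed ball under the inverse chart, and the Hausdorff property
    makes it closed; so the extension by 0 is smooth.\<close>
  define K where "K = {q \<in> fst c. snd c q \<in> cball (snd c p) e}"
  have "homeomorphic_map (subtopology (mtop M) (fst c)) (top_of_set (snd c ` fst c)) (snd c)"
    by (rule chart_homeo[OF c])
  then obtain h where h: "homeomorphic_maps (subtopology (mtop M) (fst c)) (top_of_set (snd c ` fst c)) (snd c) h"
    by (auto simp: homeomorphic_map_maps)
  have "continuous_map (top_of_set (snd c ` fst c)) (mtop M) h"
    using h by (auto simp: homeomorphic_maps_def continuous_map_in_subtopology)
  moreover have "compactin (top_of_set (snd c ` fst c)) (cball (snd c p) e)"
    using e(2) by (simp add: compactin_subtopology)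
  ultimately have "compactin (mtop M) (h ` cball (snd c p) e)"
    by (rule image_compactin[rotated])
  moreover have "h ` cball (snd c p) e = K"
  proof -
    have 1: "h (snd c q) = q" if "q \<in> fst c" for q
      using h that topspace_chart[OF c] by (auto simp: homeomorphic_maps_def)
    show ?thesis using e(2) 1 by (force simp: K_def image_iff)
  qed
  ultimately have "closedin (mtop M) K"
    using compactin_imp_closedin[OF hausdorff] by metis
  then have opK: "openin (mtop M) (topspace (mtop M) - K)"
    by (rule openin_diff[OF openin_topspace])
  have "vector_field M (topspace (mtop M)) X"
    unfolding vector_field_def vector_field_along_def
  proof (intro ballI)
    fix d f assume d: "d \<in> atlas M" and f: "f \<in> atlas M"
    let ?X = "\<lambda>x. components M f (id (chart_inv d x)) (X (chart_inv d x))"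
    show "smooth_on (snd d ` (topspace (mtop M) \<inter> fst d \<inter> id -` fst f)) ?X"
    proof (rule smooth_on_local)
      fix x assume "x \<in> snd d ` (topspace (mtop M) \<inter> fst d \<inter> id -` fst f)"
      then obtain q where q: "q \<in> fst d" "q \<in> fst f" "x = snd d q" by auto
      show "\<exists>V. open V \<and> x \<in> V \<and> smooth_on V ?X"
      proof (cases "q \<in> fst c")
        case True
        let ?V = "snd d ` (fst c \<inter> fst d \<inter> id -` fst f)"
        have op: "open ?V" using overlap3_open[OF d c f] by (simp add: ac_simps)
        have "smooth_on ?V (\<lambda>x. components M f (id (chart_inv d x)) (of_components M c (chart_inv d x) u))"
          using constant_field[OF c subset_refl chart_open[OF c], of u] d f
          unfolding vector_field_def vector_field_along_def by blast
        moreover have "smooth_on ?V (\<lambda>x. \<beta> (transition d c x))"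
          by (rule smooth_on_compose[OF \<beta>(1) op smooth_on_subset[OF transition_smooth[OF d c]]]) auto
        ultimately have "smooth_on ?V (\<lambda>x. \<beta> (transition d c x) *\<^sub>R
            components M f (id (chart_inv d x)) (of_components M c (chart_inv d x) u))"
          by (intro smooth_on_scaleR[OF op])
        then have "smooth_on ?V ?X"
          by (rule smooth_on_cong[OF op])
             (use c d f in \<open>auto simp: X_def transition_apply linear_cmul[OF linear_components[OF f]]\<close>)
        then show ?thesis using op q True by (intro exI[of _ ?V]) auto
      next
        case False
        \<comment> \<open>A point off the chart lies outside \<open>K\<close>, and so does a whole
          neighbourhood, on which the field is 0.\<close>
        let ?V = "snd d ` ((topspace (mtop M) - K) \<inter> fst f \<inter> fst d)"
        have op: "open ?V" by (rule open_image_inter[OF d openin_Int[OF opK chart_open[OF f]]])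
        have "X r = 0" if "r \<notin> K" for r
          using that \<beta>(3)[of "snd c r"] by (auto simp: X_def K_def)
        then have "smooth_on ?V ?X"
          by (intro smooth_on_cong[OF op smooth_on_const[of _ 0]])
             (use d f in \<open>auto simp: linear_0[OF linear_components[OF f]]\<close>)
        then show ?thesis using op q False chart_subset[OF d] by (intro exI[of _ ?V]) (auto simp: K_def)
      qed
    qed
  qed
  moreover have "X p = of_components M c p u" using p \<beta>(2) by (simp add: X_def)
  ultimately show ?thesis by blast
qed

lemma global_field_exists:
  "p \<in> topspace (mtop M) \<Longrightarrow> \<exists>X. vector_field M (topspace (mtop M)) X \<and> X p = u"
  using smooth_bump_field[of "chart_at M p" p u] chart_at[of p] by (simp add: of_components_chart_at)

end

section \<open>Levi-Civita connection in charts\<close>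

locale lorentzian = charted_space M
  for M :: "('a, 'e::euclidean_space) manifold" +
  fixes g :: "'a \<Rightarrow> 'e \<Rightarrow> 'e \<Rightarrow> real"
  assumes lorentzian_metric: "lorentzian_metric M g"
begin

abbreviation G :: "('a, 'e) chart \<Rightarrow> 'e \<Rightarrow> 'e \<Rightarrow> 'e \<Rightarrow> real" where
  "G \<equiv> metric_in_chart M g"

lemma bilinear_g: "p \<in> topspace (mtop M) \<Longrightarrow> bilinear (g p)"
  using lorentzian_metric by (simp add: lorentzian_metric_def)

lemma g_sym: "p \<in> topspace (mtop M) \<Longrightarrow> g p u v = g p v u"
  using lorentzian_metric by (simp add: lorentzian_metric_def)

text \<open>Pairing with the vector \<open>L j\<close> of the pseudo-orthonormal basis reads off a
  coordinate up to sign.\<close>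

lemma nondegenerate_g:
  assumes "p \<in> topspace (mtop M)"
  shows "nondegenerate (g p)"
  unfolding nondegenerate_def
proof (intro allI impI)
  fix z assume z: "\<forall>w. g p z w = 0"
  obtain L :: "'e \<Rightarrow> 'e" and e where L: "linear L" "bij L" "e \<in> Basis"
    "\<And>i j. i \<in> Basis \<Longrightarrow> j \<in> Basis \<Longrightarrow> g p (L i) (L j) = (if i = j then if i = e then -1 else 1 else 0)"
    using lorentzian_metric assms unfolding lorentzian_metric_def by blast
  obtain a where a: "z = L a" using L(2) by (metis bij_pointE)
  have "a \<bullet> j = 0" if j: "j \<in> Basis" for j
  proof -
    have lin: "linear (\<lambda>a. g p (L a) (L j))"
      using linear_compose[OF L(1), of "\<lambda>u. g p u (L j)"] bilinear_g[OF assms]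
      by (simp add: bilinear_def o_def)
    have "0 = (\<Sum>i\<in>Basis. (a \<bullet> i) *\<^sub>R g p (L i) (L j))"
      using z a linear_basis_expand[OF lin, of a] by simp
    also have "\<dots> = (\<Sum>i\<in>Basis. if i = j then (a \<bullet> i) * (if i = e then -1 else 1) else 0)"
      using j by (intro sum.cong) (auto simp: L(4))
    also have "\<dots> = (a \<bullet> j) * (if j = e then -1 else 1)"
      using j by simp
    finally show ?thesis by (simp split: if_splits)
  qed
  then have "a = 0" using euclidean_all_zero_iff by blast
  then show "z = 0" using a linear_0[OF L(1)] by simp
qed

lemma metric_in_chart_apply:
  "d \<in> atlas M \<Longrightarrow> q \<in> fst d \<Longrightarrow> G d (snd d q) u v = g q (of_components M d q u) (of_components M d q v)"
  by (simp add: metric_in_chart_def Let_def)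

lemma g_components:
  "d \<in> atlas M \<Longrightarrow> q \<in> fst d \<Longrightarrow> g q a b = G d (snd d q) (components M d q a) (components M d q b)"
  by (simp add: metric_in_chart_apply)

lemma metric_transition:
  assumes "d \<in> atlas M" "d' \<in> atlas M" "q \<in> fst d" "q \<in> fst d'"
  shows "G d (snd d q) u v = G d' (snd d' q) (jac d d' q u) (jac d d' q v)"
  using assms chart_at_of_chart[OF assms(1,3)]
  by (simp add: metric_in_chart_apply of_components_jac jac_jac)

lemma metric_patch_chart:
  assumes "d \<in> atlas M"
  shows "metric_patch (snd d ` fst d) (G d)"
proof
  show "open (snd d ` fst d)" by (rule chart_image_open[OF assms])
  fix x assume "x \<in> snd d ` fst d"
  then obtain q where q: "q \<in> fst d" "x = snd d q" by auto
  then have t: "q \<in> topspace (mtop M)" using chart_subset[OF assms] by blast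
  note lin = linear_of_components[OF assms q(1)]
  have b: "linear (g q u)" "linear (\<lambda>u. g q u v)" for u v
    using bilinear_g[OF t] by (auto simp: bilinear_def)
  show "bilinear (G d x)"
    unfolding bilinear_def q(2) metric_in_chart_apply[OF assms q(1)]
    by (intro conjI allI linear_compose[OF lin, unfolded o_def] b)
  show "G d x u v = G d x v u" for u v
    by (simp add: q metric_in_chart_apply[OF assms q(1)] g_sym[OF t])
  show "nondegenerate (G d x)"
    unfolding nondegenerate_def
  proof (intro allI impI)
    fix z assume z: "\<forall>w. G d x z w = 0"
    have "g q (of_components M d q z) w = 0" for w
      using z[rule_format, of "components M d q w"] assms q by (simp add: metric_in_chart_apply)
    then have "of_components M d q z = 0"
      using nondegenerate_g[OF t] unfolding nondegenerate_def by blast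
    then have "components M d q (of_components M d q z) = 0"
      using linear_0[OF linear_components[OF assms q(1)]] by simp
    then show "z = 0" using assms q by simp
  qed
next
  show "smooth_on (snd d ` fst d) (\<lambda>x. G d x u v)" for u v
    using lorentzian_metric assms by (simp add: lorentzian_metric_def)
qed

lemma christoffel_Chr: "christoffel M g d = metric_patch.Chr (G d)" if "d \<in> atlas M"
  using metric_patch.Chr_def[OF metric_patch_chart[OF that]]
  by (simp add: fun_eq_iff christoffel_levi_civita_form)

lemma christoffel_form:
  "d \<in> atlas M \<Longrightarrow> y \<in> snd d ` fst d \<Longrightarrow> levi_civita_form (G d) y (christoffel M g d y)"
  by (simp add: christoffel_Chr metric_patch.Chr[OF metric_patch_chart])

text \<open>The transformation law is not computed from a formula for the symbols: the symbols it
  predicts are shown to be symmetric and compatible with the metric, and uniqueness identifies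
  them.\<close>

lemma christoffel_transition:
  assumes d: "d \<in> atlas M" "d' \<in> atlas M" and q: "q \<in> fst d" "q \<in> fst d'"
  shows "jac d d' q (christoffel M g d (snd d q) u v)
    = fd (\<lambda>z. fd (transition d d') z u) (snd d q) v
      + christoffel M g d' (snd d' q) (jac d d' q u) (jac d d' q v)"
proof -
  let ?T = "transition d d'" and ?O = "snd d ` (fst d \<inter> fst d')" and ?y = "snd d q" and ?y' = "snd d' q"
  let ?J = "jac d d' q" and ?J' = "jac d' d q"
  interpret E: metric_patch "snd d ` fst d" "G d" by (rule metric_patch_chart[OF d(1)])
  interpret E': metric_patch "snd d' ` fst d'" "G d'" by (rule metric_patch_chart[OF d(2)])
  have y: "?y \<in> ?O" "?y \<in> snd d ` fst d" "?y' \<in> snd d' ` fst d'" using q by auto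
  have op: "open ?O" by (rule overlap_open[OF d])
  note smT = transition_smooth[OF d]
  have Ty: "?T ?y = ?y'" by (rule transition_apply[OF d(1) q(1)])
  have TO: "?T ` ?O \<subseteq> snd d' ` fst d'" using d by (auto simp: transition_apply)
  define H where "H u v = fd (\<lambda>z. fd ?T z u) ?y v" for u v
  have H_sym: "H u v = H v u" for u v
    unfolding H_def by (rule second_derivative_symmetric[OF op smT y(1)])
  have linH: "linear (H u)" for u
    unfolding H_def by (rule smooth_on_linear_fd[OF smooth_on_fd[OF smT] y(1)])
  have linJ: "linear ?J" "linear ?J'" using d q by (auto intro: linear_jac)
  define \<Gamma>' where "\<Gamma>' = christoffel M g d' ?y'"
  have \<Gamma>': "levi_civita_form (G d') ?y' \<Gamma>'"
    unfolding \<Gamma>'_def by (rule christoffel_form[OF d(2) y(3)])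
  then have bil: "bilinear \<Gamma>'" by (simp add: levi_civita_form_def)
  define \<Gamma> where "\<Gamma> u v = ?J' (H u v + \<Gamma>' (?J u) (?J v))" for u v
  have J\<Gamma>: "?J (\<Gamma> u v) = H u v + \<Gamma>' (?J u) (?J v)" for u v
    unfolding \<Gamma>_def using d q by simp
  have "levi_civita_form (G d) ?y \<Gamma>"
    unfolding levi_civita_form_def
  proof (intro conjI allI)
    have \<Gamma>_sym: "\<Gamma> u v = \<Gamma> v u" for u v
      using \<Gamma>' H_sym[of u v] unfolding \<Gamma>_def levi_civita_form_def by metis
    then show "\<Gamma> u v = \<Gamma> v u" for u v .
    have "linear (\<Gamma> u)" for u
      unfolding \<Gamma>_def
      using linear_compose_add[OF linH linear_compose[OF linJ(1), of "\<Gamma>' (?J u)"]] bil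
      by (intro linear_compose[OF _ linJ(2), unfolded o_def]) (auto simp: bilinear_def o_def)
    moreover have "linear (\<lambda>u. \<Gamma> u v)" for v
      using calculation[of v] by (simp add: \<Gamma>_sym[of _ v])
    ultimately show "bilinear \<Gamma>" by (simp add: bilinear_def)
    fix u v w
    have sB: "smooth_on ?O (\<lambda>z. G d' (?T z) a b)" for a b
      by (rule smooth_on_compose[OF E'.smooth_metric op smT TO])
    have bB: "bilinear (G d' (?T z))" if "z \<in> ?O" for z
      using E'.bilinear_metric TO that by blast
    have sG: "smooth_on ?O (\<lambda>z. G d' (?T z) (fd ?T z v) (fd ?T z w))"
      by (rule smooth_on_apply_bilinear[where B = "\<lambda>z. G d' (?T z)", OF op bB sB
            smooth_on_fd[OF smT] smooth_on_fd[OF smT]])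
    \<comment> \<open>The metric is written as the pullback under the transition map. Its derivative
      has one term from the metric of the other chart and two with second derivatives of the
      transition; the latter are the inhomogeneous part of the law.\<close>
    have "fd (\<lambda>z. G d z v w) ?y u = fd (\<lambda>z. G d' (?T z) (fd ?T z v) (fd ?T z w)) ?y u"
    proof (rule fun_cong[OF smooth_on_cong_fd[OF op sG _ y(1), symmetric]])
      fix z assume "z \<in> ?O"
      then obtain r where r: "r \<in> fst d" "r \<in> fst d'" "z = snd d r" by auto
      show "G d' (?T z) (fd ?T z v) (fd ?T z w) = G d z v w"
        using metric_transition[OF d r(1,2), of v w] r by (simp add: jac_def transition_apply[OF d(1)])
    qed
    also have "\<dots> = fd (\<lambda>z. G d' (?T z) (fd ?T ?y v) (fd ?T ?y w)) ?y u
        + G d' (?T ?y) (fd (\<lambda>z. fd ?T z v) ?y u) (fd ?T ?y w)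
        + G d' (?T ?y) (fd ?T ?y v) (fd (\<lambda>z. fd ?T z w) ?y u)"
      by (rule fd_apply_bilinear[where B = "\<lambda>z. G d' (?T z)", OF op bB sB y(1)
            smooth_on_fd[OF smT] smooth_on_fd[OF smT]])
    also have "fd (\<lambda>z. G d' (?T z) (fd ?T ?y v) (fd ?T ?y w)) ?y u
        = fd (\<lambda>z. G d' z (fd ?T ?y v) (fd ?T ?y w)) (?T ?y) (fd ?T ?y u)"
      by (rule fd_compose[OF smooth_on_differentiable[OF smT y(1)]])
         (rule smooth_on_differentiable[OF E'.smooth_metric], use y(3) Ty in simp)
    also have "\<dots> = G d' ?y' (\<Gamma>' (?J u) (?J v)) (?J w) + G d' ?y' (?J v) (\<Gamma>' (?J u) (?J w))"
      using \<Gamma>' unfolding Ty levi_civita_form_def jac_def by metis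
    finally have "fd (\<lambda>z. G d z v w) ?y u
        = G d' ?y' (\<Gamma>' (?J u) (?J v)) (?J w) + G d' ?y' (?J v) (\<Gamma>' (?J u) (?J w))
          + G d' ?y' (H v u) (?J w) + G d' ?y' (?J v) (H w u)"
      by (simp add: Ty H_def jac_def)
    also have "\<dots> = G d' ?y' (?J (\<Gamma> u v)) (?J w) + G d' ?y' (?J v) (?J (\<Gamma> u w))"
      by (simp add: J\<Gamma> H_sym[of u] linear_add[OF E'.linear_metric(1)[OF y(3)]]
          linear_add[OF E'.linear_metric(2)[OF y(3)]])
    also have "\<dots> = G d ?y (\<Gamma> u v) w + G d ?y v (\<Gamma> u w)"
      by (simp add: metric_transition[OF d q])
    finally show "fd (\<lambda>z. G d z v w) ?y u = G d ?y (\<Gamma> u v) w + G d ?y v (\<Gamma> u w)" .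
  qed
  then have "christoffel M g d ?y = \<Gamma>"
    by (simp add: christoffel_Chr[OF d(1)] E.Chr_eqI[OF y(2)])
  then show ?thesis using J\<Gamma> by (simp add: H_def \<Gamma>'_def)
qed

end

section \<open>Covariant derivatives along a smooth map, in charts\<close>

locale smooth_map_lorentzian = S: charted_space S + M: lorentzian M g
  for S :: "('b, 'f::euclidean_space) manifold" and M :: "('a, 'e::euclidean_space) manifold"
    and g :: "'a \<Rightarrow> 'e \<Rightarrow> 'e \<Rightarrow> real" +
  fixes \<psi> :: "'b \<Rightarrow> 'a"
  assumes smooth_map: "smooth_map S M \<psi>"
begin

definition coord :: "('b, 'f) chart \<Rightarrow> ('a, 'e) chart \<Rightarrow> 'f \<Rightarrow> 'e" where
  "coord c d = snd d \<circ> \<psi> \<circ> chart_inv c"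

definition coord_dom :: "('b, 'f) chart \<Rightarrow> ('a, 'e) chart \<Rightarrow> 'f set" where
  "coord_dom c d = snd c ` (fst c \<inter> \<psi> -` fst d)"

definition lift :: "('b, 'f) chart \<Rightarrow> ('a, 'e) chart \<Rightarrow> ('b \<Rightarrow> 'e) \<Rightarrow> 'f \<Rightarrow> 'e" where
  "lift c d V x = components M d (\<psi> (chart_inv c x)) (V (chart_inv c x))"

text \<open>The same formula as \<open>connection_patch.D\<close>, with both charts as arguments, so
  that two pairs of charts can be compared in one statement.\<close>

definition Dc :: "('b, 'f) chart \<Rightarrow> ('a, 'e) chart \<Rightarrow> ('f \<Rightarrow> 'e) \<Rightarrow> 'f \<Rightarrow> 'f \<Rightarrow> 'e" where
  "Dc c d V x v = fd V x v + christoffel M g d (coord c d x) (fd (coord c d) x v) (V x)"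

lemma psi_topspace: "p \<in> topspace (mtop S) \<Longrightarrow> \<psi> p \<in> topspace (mtop M)"
  using smooth_map by (auto simp: smooth_map_def continuous_map_def)

lemma open_preimage:
  assumes "d \<in> atlas M" "c \<in> atlas S" "openin (mtop S) U"
  shows "open (snd c ` (U \<inter> fst c \<inter> \<psi> -` fst d))"
proof -
  have "openin (mtop S) {p \<in> topspace (mtop S). \<psi> p \<in> fst d}"
    using smooth_map M.chart_open[OF assms(1)]
    by (intro openin_continuous_map_preimage[of _ "mtop M"]) (auto simp: smooth_map_def)
  then have "openin (mtop S) (U \<inter> {p \<in> topspace (mtop S). \<psi> p \<in> fst d})"
    using assms(3) by (rule openin_Int[rotated])
  then have "open (snd c ` (U \<inter> {p \<in> topspace (mtop S). \<psi> p \<in> fst d} \<inter> fst c))"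
    by (rule S.open_image_inter[OF assms(2)])
  moreover have "U \<inter> {p \<in> topspace (mtop S). \<psi> p \<in> fst d} \<inter> fst c = U \<inter> fst c \<inter> \<psi> -` fst d"
    using S.chart_subset[OF assms(2)] by auto
  ultimately show ?thesis by simp
qed

lemma open_preimage_overlap:
  assumes "d \<in> atlas M" "d' \<in> atlas M" "c \<in> atlas S" "openin (mtop S) U"
  shows "open (snd c ` (U \<inter> fst c \<inter> \<psi> -` (fst d \<inter> fst d')))"
proof -
  have "snd c ` (U \<inter> fst c \<inter> \<psi> -` (fst d \<inter> fst d'))
      = snd c ` (U \<inter> fst c \<inter> \<psi> -` fst d \<inter> (U \<inter> fst c \<inter> \<psi> -` fst d'))"
    by (rule arg_cong[of _ _ "\<lambda>A. snd c ` A"]) auto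
  also have "\<dots> = snd c ` (U \<inter> fst c \<inter> \<psi> -` fst d) \<inter> snd c ` (U \<inter> fst c \<inter> \<psi> -` fst d')"
    by (rule inj_on_image_Int[OF S.chart_inj[OF assms(3)]]) auto
  finally show ?thesis
    using open_preimage[OF assms(1,3,4)] open_preimage[OF assms(2,3,4)] by auto
qed

lemma coord_dom_open: "c \<in> atlas S \<Longrightarrow> d \<in> atlas M \<Longrightarrow> open (coord_dom c d)"
  unfolding coord_dom_def using open_preimage[OF _ _ S.chart_open, of d c c] by simp

lemma coord_smooth: "c \<in> atlas S \<Longrightarrow> d \<in> atlas M \<Longrightarrow> smooth_on (coord_dom c d) (coord c d)"
  using smooth_map by (simp add: smooth_map_def coord_def coord_dom_def)

lemma coord_apply [simp]: "c \<in> atlas S \<Longrightarrow> p \<in> fst c \<Longrightarrow> coord c d (snd c p) = snd d (\<psi> p)"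
  by (simp add: coord_def)

lemma coord_target: "c \<in> atlas S \<Longrightarrow> coord c d ` coord_dom c d \<subseteq> snd d ` fst d"
  by (auto simp: coord_dom_def)

lemma lift_apply: "c \<in> atlas S \<Longrightarrow> p \<in> fst c \<Longrightarrow> lift c d V (snd c p) = components M d (\<psi> p) (V p)"
  by (simp add: lift_def)

lemma lift_smooth:
  "vector_field_along S M \<psi> U V \<Longrightarrow> c \<in> atlas S \<Longrightarrow> d \<in> atlas M
    \<Longrightarrow> smooth_on (snd c ` (U \<inter> fst c \<inter> \<psi> -` fst d)) (lift c d V)"
  by (simp add: vector_field_along_def lift_def[abs_def])

lemma connection_patch_coord:
  assumes "c \<in> atlas S" "d \<in> atlas M" "open W" "W \<subseteq> coord_dom c d"
  shows "connection_patch (snd d ` fst d) (christoffel M g d) W (coord c d)"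
proof -
  interpret E: metric_patch "snd d ` fst d" "M.G d" by (rule M.metric_patch_chart[OF assms(2)])
  show ?thesis
  proof
    show "bilinear (christoffel M g d y)" "christoffel M g d y u v = christoffel M g d y v u"
      if "y \<in> snd d ` fst d" for y u v
      using M.christoffel_form[OF assms(2) that] by (auto simp: levi_civita_form_def)
    show "smooth_on (snd d ` fst d) (\<lambda>y. christoffel M g d y u v)" for u v
      unfolding M.christoffel_Chr[OF assms(2)] by (rule E.smooth_Chr)
    show "smooth_on W (coord c d)"
      by (rule smooth_on_subset[OF coord_smooth[OF assms(1,2)] assms(4)])
    show "coord c d ` W \<subseteq> snd d ` fst d" using coord_target[OF assms(1), of d] assms(4) by blast
  qed (use assms E.open_patch in auto)
qed

lemma Dc_eq: "Dc c d = connection_patch.D (christoffel M g d) (coord c d)"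
  if "c \<in> atlas S" "d \<in> atlas M"
  using connection_patch.D_def[OF connection_patch_coord[OF that coord_dom_open[OF that] subset_refl]]
  by (simp add: fun_eq_iff Dc_def)

text \<open>Near \<open>snd c p\<close>, both sides differentiate the same map, factored through the
  transition on the source or through that on the target.\<close>

lemma coord_change:
  assumes c: "c \<in> atlas S" "c' \<in> atlas S" and d: "d \<in> atlas M" "d' \<in> atlas M"
    and p: "p \<in> fst c" "p \<in> fst c'" "\<psi> p \<in> fst d" "\<psi> p \<in> fst d'"
  shows "fd (coord c' d') (snd c' p) (jac c c' p v) = jac d d' (\<psi> p) (fd (coord c d) (snd c p) v)"
proof -
  let ?N = "snd c ` (fst c' \<inter> fst c \<inter> \<psi> -` (fst d \<inter> fst d'))"
  have op: "open ?N"
    by (rule open_preimage_overlap[OF d c(1) S.chart_open[OF c(2)]])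
  have 1: "((\<lambda>x. coord c' d' (transition c c' x)) has_derivative
      (\<lambda>v. fd (coord c' d') (snd c' p) (jac c c' p v))) (at (snd c p))"
    unfolding jac_def
  proof (rule has_derivative_compose[where f = "transition c c'" and f' = "fd (transition c c') (snd c p)"
        and g' = "fd (coord c' d') (snd c' p)"])
    show "(transition c c' has_derivative fd (transition c c') (snd c p)) (at (snd c p))"
      by (rule smooth_on_has_derivative[OF S.transition_smooth]) (use c p in auto)
    show "(coord c' d' has_derivative fd (coord c' d') (snd c' p)) (at (transition c c' (snd c p)))"
      unfolding S.transition_apply[OF c(1) p(1)]
      by (rule smooth_on_has_derivative[OF coord_smooth]) (use c d p in \<open>auto simp: coord_dom_def\<close>)
  qed
  have 2: "((\<lambda>x. transition d d' (coord c d x)) has_derivative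
      (\<lambda>v. jac d d' (\<psi> p) (fd (coord c d) (snd c p) v))) (at (snd c p))"
    unfolding jac_def
  proof (rule has_derivative_compose[where f = "coord c d" and f' = "fd (coord c d) (snd c p)"
        and g' = "fd (transition d d') (snd d (\<psi> p))"])
    show "(coord c d has_derivative fd (coord c d) (snd c p)) (at (snd c p))"
      by (rule smooth_on_has_derivative[OF coord_smooth]) (use c d p in \<open>auto simp: coord_dom_def\<close>)
    show "(transition d d' has_derivative fd (transition d d') (snd d (\<psi> p))) (at (coord c d (snd c p)))"
      unfolding coord_apply[OF c(1) p(1)]
      by (rule smooth_on_has_derivative[OF M.transition_smooth]) (use d p in auto)
  qed
  have "((\<lambda>x. coord c' d' (transition c c' x)) has_derivative
      (\<lambda>v. jac d d' (\<psi> p) (fd (coord c d) (snd c p) v))) (at (snd c p))"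
    by (rule has_derivative_transform_within_open[OF 2 op])
       (use c d p in \<open>auto simp: S.transition_apply M.transition_apply\<close>)
  from has_derivative_unique[OF 1 this] show ?thesis by metis
qed

text \<open>Differentiating the transformed components produces a second derivative of the target
  transition, and the law for the Christoffel symbols produces it once more on the other side, so
  the two cancel.\<close>

lemma Dc_change:
  assumes c: "c \<in> atlas S" "c' \<in> atlas S" and d: "d \<in> atlas M" "d' \<in> atlas M"
    and p: "p \<in> fst c" "p \<in> fst c'" "\<psi> p \<in> fst d" "\<psi> p \<in> fst d'"
    and V: "vector_field_along S M \<psi> U V" "openin (mtop S) U" "p \<in> U"
  shows "jac d d' (\<psi> p) (Dc c d (lift c d V) (snd c p) v)
    = Dc c' d' (lift c' d' V) (snd c' p) (jac c c' p v)"
proof -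
  let ?\<sigma> = "transition c c'" and ?\<tau> = "transition d d'" and ?F = "coord c d" and ?F' = "coord c' d'"
  let ?V = "lift c d V" and ?V' = "lift c' d' V" and ?x = "snd c p" and ?x' = "snd c' p"
  let ?J = "jac d d' (\<psi> p)" and ?y = "snd d (\<psi> p)" and ?O = "snd d ` (fst d \<inter> fst d')"
  let ?N = "snd c ` (U \<inter> fst c' \<inter> fst c \<inter> \<psi> -` (fst d \<inter> fst d'))"
  have op: "open ?N"
    by (rule open_preimage_overlap[OF d c(1) openin_Int[OF V(2) S.chart_open[OF c(2)]]])
  have x: "?x \<in> ?N" using p V(3) by auto
  have inN: "\<exists>r. r \<in> U \<and> r \<in> fst c \<and> r \<in> fst c' \<and> \<psi> r \<in> fst d \<and> \<psi> r \<in> fst d' \<and> z = snd c r"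
    if "z \<in> ?N" for z
    using that by auto
  have y: "?y \<in> ?O" using p by auto
  have smV: "smooth_on ?N ?V"
    by (rule smooth_on_subset[OF lift_smooth[OF V(1) c(1) d(1)]], intro image_mono) auto
  have smF: "smooth_on ?N ?F"
    by (rule smooth_on_subset[OF coord_smooth[OF c(1) d(1)]], unfold coord_dom_def, intro image_mono) auto
  have F_in: "?F ` ?N \<subseteq> ?O"
  proof (rule image_subsetI)
    fix z assume "z \<in> ?N"
    then obtain r where "r \<in> fst c" "\<psi> r \<in> fst d" "\<psi> r \<in> fst d'" "z = snd c r" using inN by blast
    then show "?F z \<in> ?O" using c by simp
  qed
  note sm\<tau> = M.transition_smooth[OF d]
  have smA: "smooth_on ?N (\<lambda>z. fd ?\<tau> (?F z) w)" for w
    by (rule smooth_on_compose[OF smooth_on_fd[OF sm\<tau>] op smF F_in])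
  have linA: "linear (fd ?\<tau> (?F z))" if "z \<in> ?N" for z
    by (rule smooth_on_linear_fd[OF sm\<tau>]) (use F_in that in blast)
  have eq: "fd ?\<tau> (?F z) (?V z) = ?V' (?\<sigma> z)" if z: "z \<in> ?N" for z
  proof -
    obtain r where r: "r \<in> U" "r \<in> fst c" "r \<in> fst c'" "\<psi> r \<in> fst d" "\<psi> r \<in> fst d'" "z = snd c r"
      using inN[OF z] by blast
    then show ?thesis
      using c d M.components_jac_components[OF d r(4,5)]
      by (simp add: lift_apply S.transition_apply jac_def)
  qed
  have "fd ?V' ?x' (jac c c' p v) = fd (\<lambda>z. ?V' (?\<sigma> z)) ?x v"
  proof -
    have "?V' differentiable (at (?\<sigma> ?x))"
      unfolding S.transition_apply[OF c(1) p(1)]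
      by (rule smooth_on_differentiable[OF lift_smooth[OF V(1) c(2) d(2)]]) (use p V(3) in auto)
    moreover have "?\<sigma> differentiable (at ?x)"
      by (rule smooth_on_differentiable[OF S.transition_smooth[OF c]]) (use p in auto)
    ultimately show ?thesis
      using fd_compose[of ?\<sigma> ?x ?V' v] by (simp add: S.transition_apply[OF c(1) p(1)] jac_def)
  qed
  also have "\<dots> = fd (\<lambda>z. fd ?\<tau> (?F z) (?V z)) ?x v"
    using smooth_on_cong_fd[OF op smooth_on_apply_linear[where A = "\<lambda>z. fd ?\<tau> (?F z)", OF op linA smA smV]
        eq x] by simp
  also have "\<dots> = fd (\<lambda>z. fd ?\<tau> (?F z) (?V ?x)) ?x v + fd ?\<tau> (?F ?x) (fd ?V ?x v)"
    by (rule fd_apply_linear[where A = "\<lambda>z. fd ?\<tau> (?F z)", OF op linA smA x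
          smooth_on_differentiable[OF smV x]])
  also have "fd (\<lambda>z. fd ?\<tau> (?F z) (?V ?x)) ?x v = fd (\<lambda>z. fd ?\<tau> z (?V ?x)) (?F ?x) (fd ?F ?x v)"
    by (rule fd_compose[OF smooth_on_differentiable[OF smF x]])
       (rule smooth_on_differentiable[OF smooth_on_fd[OF sm\<tau>]], use F_in x in blast)
  finally have dV: "fd ?V' ?x' (jac c c' p v)
      = fd (\<lambda>z. fd ?\<tau> z (?V ?x)) ?y (fd ?F ?x v) + ?J (fd ?V ?x v)"
    using c p by (simp add: jac_def)
  have "?J (christoffel M g d ?y (fd ?F ?x v) (?V ?x))
      = fd (\<lambda>z. fd ?\<tau> z (fd ?F ?x v)) ?y (?V ?x)
        + christoffel M g d' (snd d' (\<psi> p)) (?J (fd ?F ?x v)) (?J (?V ?x))"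
    by (rule M.christoffel_transition[OF d p(3,4)])
  \<comment> \<open>The two second-derivative terms have their arguments in opposite order; symmetry
    makes them equal.\<close>
  also have "fd (\<lambda>z. fd ?\<tau> z (fd ?F ?x v)) ?y (?V ?x) = fd (\<lambda>z. fd ?\<tau> z (?V ?x)) ?y (fd ?F ?x v)"
    by (rule second_derivative_symmetric[OF M.overlap_open[OF d] sm\<tau> y])
  also have "?J (?V ?x) = ?V' ?x'"
    using eq[OF x] c p by (simp add: S.transition_apply jac_def)
  also have "?J (fd ?F ?x v) = fd ?F' ?x' (jac c c' p v)"
    by (rule coord_change[OF c d p, symmetric])
  finally show ?thesis
    unfolding Dc_def using dV c p linear_add[OF M.linear_jac[OF d p(3,4)]] by simp
qed

lemma differential_chart:
  assumes c: "c \<in> atlas S" and d: "d \<in> atlas M" and p: "p \<in> fst c" "\<psi> p \<in> fst d"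
  shows "components M d (\<psi> p) (differential S M \<psi> p v) = fd (coord c d) (snd c p) (components S c p v)"
  using coord_change[OF S.chart_at_of_chart(1)[OF c p(1)] c M.chart_at_of_chart(1)[OF d p(2)] d
      S.chart_at_of_chart(2)[OF c p(1)] p(1) M.chart_at_of_chart(2)[OF d p(2)] p(2)]
  by (simp add: differential_def components_jac coord_def o_def)

lemma cov_deriv_self:
  assumes "p \<in> topspace (mtop S)"
  shows "cov_deriv_along S M g \<psi> V p v
    = Dc (chart_at S p) (chart_at M (\<psi> p)) (lift (chart_at S p) (chart_at M (\<psi> p)) V) (snd (chart_at S p) p) v"
  using S.chart_at[OF assms] M.chart_at[OF psi_topspace[OF assms]]
    M.components_chart_at[OF psi_topspace[OF assms]]
  by (simp add: cov_deriv_along_def Let_def Dc_def lift_apply differential_def)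
     (simp add: lift_def[abs_def] coord_def o_def)

text \<open>With a fixed pair of charts the right-hand side can be differentiated again as
  \<open>p\<close> varies, unlike the defining expression.\<close>

lemma cov_deriv_chart:
  assumes c: "c \<in> atlas S" and d: "d \<in> atlas M" and p: "p \<in> fst c" "\<psi> p \<in> fst d"
    and V: "vector_field_along S M \<psi> U V" "openin (mtop S) U" "p \<in> U"
  shows "components M d (\<psi> p) (cov_deriv_along S M g \<psi> V p v)
    = Dc c d (lift c d V) (snd c p) (components S c p v)"
  using Dc_change[OF S.chart_at_of_chart(1)[OF c p(1)] c M.chart_at_of_chart(1)[OF d p(2)] d
      S.chart_at_of_chart(2)[OF c p(1)] p(1) M.chart_at_of_chart(2)[OF d p(2)] p(2) V]
    S.chart_subset[OF c] p(1)
  by (subst cov_deriv_self) (auto simp: components_jac)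

end

lemma (in charted_space) smooth_map_id: "smooth_map M M id"
  using transition_smooth by (simp add: smooth_map_def transition_def)

section \<open>The curvature tensor in a chart\<close>

text \<open>Vector fields on \<open>M\<close> are fields along the identity, so chart independence
  holds for \<open>levi_civita\<close> as well.\<close>

sublocale lorentzian \<subseteq> I: smooth_map_lorentzian M M g id
  by standard (rule smooth_map_id)

context lorentzian
begin

lemma fd_coord_id:
  assumes "d \<in> atlas M" "q \<in> fst d"
  shows "fd (I.coord d d) (snd d q) v = v"
proof -
  have "(I.coord d d has_derivative (\<lambda>v. v)) (at (snd d q))"
    by (rule has_derivative_transform_within_open[OF has_derivative_ident chart_image_open[OF assms(1)]])
      (use assms in auto)
  from fd_eqI[OF this] show ?thesis by simp
qed

lemma levi_civita_chart:
  assumes c: "c \<in> atlas M" "d \<in> atlas M" and r: "r \<in> U" "r \<in> fst c" "r \<in> fst d"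
    and Z: "vector_field M U Z" and U: "openin (mtop M) U"
  shows "components M d r (levi_civita M g Y Z r)
    = I.Dc c d (I.lift c d Z) (snd c r) (components M c r (Y r))"
  using I.cov_deriv_chart[OF c r(2) _ Z[unfolded vector_field_def] U r(1), of "Y r"] r(3)
  by (simp add: levi_civita_def)

text \<open>The second covariant derivatives in \<open>curvature\<close> apply the chart formula to
  the field \<open>levi_civita M g Y Z\<close>, which therefore has to be smooth.\<close>

lemma vector_field_levi_civita:
  assumes U: "openin (mtop M) U" and f: "vector_field M U Y" "vector_field M U Z"
  shows "vector_field M U (levi_civita M g Y Z)"
  unfolding vector_field_def vector_field_along_def
proof (intro ballI)
  fix c d assume c: "c \<in> atlas M" and d: "d \<in> atlas M"
  let ?W = "snd c ` (U \<inter> fst c \<inter> id -` fst d)"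
  have op: "open ?W" by (rule I.open_preimage[OF d c U])
  interpret P: connection_patch "snd d ` fst d" "christoffel M g d" ?W "I.coord c d"
    by (rule I.connection_patch_coord[OF c d op]) (auto simp: I.coord_dom_def)
  have "smooth_on ?W (\<lambda>x. P.D (I.lift c d Z) x (I.lift c c Y x))"
  proof (rule P.smooth_on_D_field)
    show "smooth_on ?W (I.lift c d Z)"
      by (rule I.lift_smooth[OF f(2)[unfolded vector_field_def] c d])
    show "smooth_on ?W (I.lift c c Y)"
      by (rule smooth_on_subset[OF I.lift_smooth[OF f(1)[unfolded vector_field_def] c c]], rule image_mono) auto
  qed
  then show "smooth_on ?W (\<lambda>x. components M d (id (chart_inv c x)) (levi_civita M g Y Z (chart_inv c x)))"
  proof (rule smooth_on_cong[OF op])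
    fix x assume "x \<in> ?W"
    then obtain r where r: "r \<in> U" "r \<in> fst c" "r \<in> fst d" "x = snd c r" by auto
    show "P.D (I.lift c d Z) x (I.lift c c Y x)
        = components M d (id (chart_inv c x)) (levi_civita M g Y Z (chart_inv c x))"
      using levi_civita_chart[OF c d r(1-3) f(2) U, of Y] r c
      by (simp add: I.Dc_eq[OF c d] I.lift_apply)
  qed
qed

text \<open>The torsion-freeness of the connection; it yields the transformation law of the bracket.\<close>

lemma lie_bracket_levi_civita:
  assumes q: "q \<in> topspace (mtop M)"
  shows "lie_bracket M X Y q = levi_civita M g X Y q - levi_civita M g Y X q"
proof -
  let ?d = "chart_at M q"
  have d: "?d \<in> atlas M" "q \<in> fst ?d" using chart_at[OF q] by auto
  have at_q: "I.lift ?d ?d Z (snd ?d q) = Z q" for Z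
    using components_chart_at[OF q] d by (simp add: I.lift_apply)
  have fdF: "fd (I.coord ?d ?d) (snd ?d q) v = v" for v
    by (rule fd_coord_id[OF d])
  have "christoffel M g ?d (snd ?d q) u v = christoffel M g ?d (snd ?d q) v u" for u v
    using christoffel_form[OF d(1), of "snd ?d q"] d(2) by (simp add: levi_civita_form_def)
  then show ?thesis
    using d at_q fdF I.cov_deriv_self[OF q]
    by (simp add: lie_bracket_def Let_def levi_civita_def I.Dc_def) (simp add: I.lift_def[abs_def])
qed

text \<open>By the Ricci identity for the identity map, the chart expression involves the three
  fields only through their values at \<open>q\<close>. This is tensoriality, and it makes the
  definite description in \<open>curvature\<close> well defined.\<close>

lemma curvature_chart:
  assumes d: "d \<in> atlas M" "q \<in> fst d"
  shows "components M d q (curvature M g q u v w)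
    = connection_patch.Rm (christoffel M g d) (snd d q)
        (components M d q u) (components M d q v) (components M d q w)"
proof -
  have q: "q \<in> topspace (mtop M)" using chart_subset[OF d(1)] d(2) by blast
  let ?y = "snd d q" and ?R = "connection_patch.Rm (christoffel M g d)" and ?C = "components M d q"
  let ?E = "\<lambda>X Y Z. levi_civita M g X (levi_civita M g Y Z) q
      - levi_civita M g Y (levi_civita M g X Z) q - levi_civita M g (lie_bracket M X Y) Z q"
  note C_diff = linear_diff[OF linear_components[OF d]]
  have R: "?R ?y (?C (X q)) (?C (Y q)) (?C (Z q)) = ?C (?E X Y Z)"
    if U: "openin (mtop M) U" "q \<in> U"
      and f: "vector_field M U X" "vector_field M U Y" "vector_field M U Z" for U X Y Z
  proof -
    let ?W = "snd d ` (U \<inter> fst d)" and ?X = "I.lift d d X" and ?Y = "I.lift d d Y" and ?Z = "I.lift d d Z"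
    have op: "open ?W" by (rule open_image_inter[OF d(1) U(1)])
    have y: "?y \<in> ?W" using U d by auto
    interpret P: connection_patch "snd d ` fst d" "christoffel M g d" ?W "I.coord d d"
      by (rule I.connection_patch_coord[OF d(1) d(1) op]) (auto simp: I.coord_dom_def)
    have sm: "smooth_on ?W (I.lift d d V)" if "vector_field M U V" for V
      using I.lift_smooth[OF that[unfolded vector_field_def] d(1) d(1)] by (simp add: Int_assoc)
    have fdF: "fd (I.coord d d) ?y v = v" for v
      by (rule fd_coord_id[OF d])
    have at_y: "I.lift d d V ?y = ?C (V q)" for V
      using d by (simp add: I.lift_apply)
    have lc: "I.lift d d (levi_civita M g A V) x = P.D (I.lift d d V) x (I.lift d d A x)"
      if x: "x \<in> ?W" and V: "vector_field M U V" for x A V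
    proof -
      obtain r where r: "r \<in> U" "r \<in> fst d" "x = snd d r" using x by auto
      show ?thesis
        using levi_civita_chart[OF d(1) d(1) r(1,2) r(2) V U(1), of A] r d
        by (simp add: I.lift_apply I.Dc_eq)
    qed
    have second: "?C (levi_civita M g A (levi_civita M g B V) q)
        = P.D (\<lambda>x. P.D (I.lift d d V) x (I.lift d d B x)) ?y (I.lift d d A ?y)"
      if "vector_field M U B" "vector_field M U V" for A B V
    proof -
      note s = sm[OF vector_field_levi_civita[OF U(1) that]]
      have "?C (levi_civita M g A (levi_civita M g B V) q)
          = P.D (I.lift d d (levi_civita M g B V)) ?y (I.lift d d A ?y)"
        using lc[OF y vector_field_levi_civita[OF U(1) that], of A] by (simp add: at_y)
      also have "P.D (I.lift d d (levi_civita M g B V)) ?y = P.D (\<lambda>x. P.D (I.lift d d V) x (I.lift d d B x)) ?y"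
        by (rule P.D_cong[OF y op s lc[OF _ that(2)]])
      finally show ?thesis .
    qed
    have "?C (lie_bracket M X Y q) = P.D ?Y ?y (?X ?y) - P.D ?X ?y (?Y ?y)"
      using lc[OF y f(2), of X] lc[OF y f(1), of Y]
      by (simp add: lie_bracket_levi_civita[OF q] C_diff at_y)
    also have "\<dots> = fd ?Y ?y (?X ?y) - fd ?X ?y (?Y ?y)"
      using P.conn_sym[OF P.F_in[OF y]] by (simp add: P.D_def fdF)
    finally have third: "?C (levi_civita M g (lie_bracket M X Y) Z q)
        = P.D ?Z ?y (fd ?Y ?y (?X ?y) - fd ?X ?y (?Y ?y))"
      using lc[OF y f(3), of "lie_bracket M X Y"] by (simp add: at_y)
    show ?thesis
      using P.ricci_identity[OF y sm[OF f(3)] sm[OF f(1)] sm[OF f(2)]] d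
      by (simp add: C_diff second[OF f(2,3)] second[OF f(1,3)] third fdF at_y)
  qed
  \<comment> \<open>An explicit choice of extensions: without one, the condition on \<open>z\<close>
    would hold vacuously and determine nothing.\<close>
  define K where "K u p = of_components M d p (?C u)" for u p
  have K: "vector_field M (fst d) (K u)" "K u q = u" for u
    unfolding K_def using constant_field[OF d(1) subset_refl chart_open[OF d(1)]] d by auto
  have C_inj: "x = x'" if "?C x = ?C x'" for x x'
    using that components_of_components(2)[OF d] by metis
  have "curvature M g q u v w = ?E (K u) (K v) (K w)"
    unfolding curvature_def
  proof (rule the_equality)
    show "\<forall>U X Y Z. openin (mtop M) U \<and> q \<in> U \<and> vector_field M U X \<and> vector_field M U Y \<and>
        vector_field M U Z \<and> X q = u \<and> Y q = v \<and> Z q = w \<longrightarrow> ?E (K u) (K v) (K w) = ?E X Y Z"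
    proof (intro allI impI, elim conjE)
      fix U X Y Z
      assume *: "openin (mtop M) U" "q \<in> U" "vector_field M U X" "vector_field M U Y"
        "vector_field M U Z" "X q = u" "Y q = v" "Z q = w"
      show "?E (K u) (K v) (K w) = ?E X Y Z"
        by (rule C_inj)
          (metis R[OF chart_open[OF d(1)] d(2) K(1) K(1) K(1), of u v w] R[OF *(1-5)] K(2) *(6-8))
    qed
  next
    fix z
    assume "\<forall>U X Y Z. openin (mtop M) U \<and> q \<in> U \<and> vector_field M U X \<and> vector_field M U Y \<and>
        vector_field M U Z \<and> X q = u \<and> Y q = v \<and> Z q = w \<longrightarrow> z = ?E X Y Z"
    then show "z = ?E (K u) (K v) (K w)"
      using K chart_open[OF d(1)] d(2) by blast
  qed
  then show ?thesis
    using R[OF chart_open[OF d(1)] d(2) K(1) K(1) K(1), of u v w] by (simp add: K(2))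
qed

end

section \<open>Normal projection\<close>

text \<open>\<open>nspace\<close> and \<open>npart\<close> are \<open>normal_space\<close> and
  \<open>normal_part\<close> for an arbitrary form and tangent map, to be used both at points of
  \<open>S\<close> and in coordinates.\<close>

definition nspace :: "('e \<Rightarrow> 'e \<Rightarrow> real) \<Rightarrow> ('f \<Rightarrow> 'e) \<Rightarrow> 'e set" where
  "nspace h T = {w. \<forall>v. h w (T v) = 0}"

definition npart :: "('e::real_vector \<Rightarrow> 'e \<Rightarrow> real) \<Rightarrow> ('f \<Rightarrow> 'e) \<Rightarrow> 'e \<Rightarrow> 'e" where
  "npart h T w = (THE z. z \<in> nspace h T \<and> w - z \<in> range T)"

text \<open>The Gram matrix of the tangent vectors as an endomorphism of the parameter space; the
  tangential part of a vector is found by solving a system with it.\<close>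

definition gram :: "('e \<Rightarrow> 'e \<Rightarrow> real) \<Rightarrow> ('f::euclidean_space \<Rightarrow> 'e) \<Rightarrow> 'f \<Rightarrow> 'f" where
  "gram h T t = (\<Sum>i\<in>Basis. h (T t) (T i) *\<^sub>R i)"

locale spacelike_subspace =
  fixes h :: "'e::euclidean_space \<Rightarrow> 'e \<Rightarrow> real" and T :: "'f::euclidean_space \<Rightarrow> 'e"
  assumes bilinear: "bilinear h" and sym: "h u v = h v u" and nondegenerate: "nondegenerate h"
    and linear_T: "linear T" and pos: "t \<noteq> 0 \<Longrightarrow> 0 < h (T t) (T t)"
begin

lemma linear_h: "linear (h u)" "linear (\<lambda>u. h u v)"
  using bilinear by (auto simp: bilinear_def)

lemmas h_simps = linear_add[OF linear_h(1)] linear_add[OF linear_h(2)]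
  linear_diff[OF linear_h(1)] linear_diff[OF linear_h(2)]
  linear_cmul[OF linear_h(1)] linear_cmul[OF linear_h(2)]
  linear_0[OF linear_h(1)] linear_0[OF linear_h(2)]

lemmas T_simps = linear_add[OF linear_T] linear_diff[OF linear_T] linear_cmul[OF linear_T] linear_0[OF linear_T]

lemma inj_T: "inj T"
proof (rule injI)
  fix u v assume "T u = T v"
  then have "h (T (u - v)) (T (u - v)) = 0" by (simp add: T_simps h_simps)
  then show "u = v" using pos[of "u - v"] by auto
qed

lemma linear_gram: "linear (gram h T)"
  unfolding gram_def by (rule linearI) (simp_all add: T_simps h_simps scaleR_add_left sum.distrib scaleR_sum_right)

lemma gram_eq_iff: "gram h T t = (\<Sum>i\<in>Basis. h w (T i) *\<^sub>R i) \<longleftrightarrow> w - T t \<in> nspace h T"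
proof
  have lin: "linear (\<lambda>v. h w (T v))" for w
    using linear_compose[OF linear_T linear_h(1)[of w]] by (simp add: o_def)
  assume eq: "gram h T t = (\<Sum>i\<in>Basis. h w (T i) *\<^sub>R i)"
  have "(\<Sum>i\<in>Basis. h (T t) (T i) *\<^sub>R i) \<bullet> j = (\<Sum>i\<in>Basis. h w (T i) *\<^sub>R i) \<bullet> j" for j
    using eq by (simp only: gram_def)
  then have *: "h (T t) (T j) = h w (T j)" if "j \<in> Basis" for j
    using inner_sum_left_Basis[OF that] by metis
  have "h (w - T t) (T v) = 0" for v
    using * linear_basis_expand[OF lin, of "w - T t" v] by (simp add: h_simps)
  then show "w - T t \<in> nspace h T" by (simp add: nspace_def)
qed (simp add: nspace_def gram_def h_simps)

lemma nspace_range_0: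
  assumes "z \<in> nspace h T" "z \<in> range T"
  shows "z = 0"
proof -
  obtain t where t: "z = T t" using assms(2) by blast
  then have "h (T t) (T t) = 0" using assms(1) by (simp add: nspace_def)
  then have "t = 0" using pos[of t] by auto
  then show ?thesis using t T_simps(4) by simp
qed

lemma nspace_add: "z \<in> nspace h T \<Longrightarrow> w \<in> nspace h T \<Longrightarrow> z + w \<in> nspace h T"
  and nspace_diff: "z \<in> nspace h T \<Longrightarrow> w \<in> nspace h T \<Longrightarrow> z - w \<in> nspace h T"
  and nspace_scaleR: "z \<in> nspace h T \<Longrightarrow> k *\<^sub>R z \<in> nspace h T"
  and nspace_0: "0 \<in> nspace h T"
  by (simp_all add: nspace_def h_simps)

lemma subspace_range: "subspace (range T)"
  by (rule linear_subspace_image[OF linear_T subspace_UNIV])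

lemmas range_add = subspace_add[OF subspace_range]
  and range_diff = subspace_diff[OF subspace_range]
  and range_scaleR = subspace_scale[OF subspace_range]

lemma inj_gram: "inj (gram h T)"
proof (rule injI)
  fix u v assume "gram h T u = gram h T v"
  then have "T v - T u \<in> nspace h T"
    using gram_eq_iff[of u "T v"] by (simp add: gram_def[of _ _ v])
  moreover have "T v - T u \<in> range T" by (simp flip: T_simps(2))
  ultimately show "u = v" using nspace_range_0[of "T v - T u"] injD[OF inj_T, of v u] by simp
qed

lemma npart_eqI: "z \<in> nspace h T \<Longrightarrow> w - z \<in> range T \<Longrightarrow> npart h T w = z"
  unfolding npart_def
proof (rule the_equality)
  fix z' assume z: "z \<in> nspace h T" "w - z \<in> range T" and z': "z' \<in> nspace h T \<and> w - z' \<in> range T"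
  have "z' - z \<in> nspace h T" using z z' nspace_diff by blast
  moreover have "z' - z \<in> range T" using range_diff[OF z(2), of "w - z'"] z' by simp
  ultimately show "z' = z" using nspace_range_0[of "z' - z"] by simp
qed auto

lemma npart: "npart h T w \<in> nspace h T" "w - npart h T w \<in> range T"
proof -
  obtain t where "gram h T t = (\<Sum>i\<in>Basis. h w (T i) *\<^sub>R i)"
    using surjD[OF linear_injective_imp_surjective[OF linear_gram inj_gram]] by metis
  then have t: "w - T t \<in> nspace h T" by (simp add: gram_eq_iff)
  then have "npart h T w = w - T t" by (rule npart_eqI) simp
  then show "npart h T w \<in> nspace h T" "w - npart h T w \<in> range T" using t by auto
qed

lemma npart_eq_0_iff: "npart h T w = 0 \<longleftrightarrow> w \<in> range T"
  using npart(2)[of w] npart_eqI[OF nspace_0, of w] by auto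

lemma normal_tangent: "z \<in> nspace h T \<Longrightarrow> a \<in> range T \<Longrightarrow> h z a = 0"
  by (auto simp: nspace_def)

lemma h_npart: "z \<in> nspace h T \<Longrightarrow> h (npart h T w) z = h w z"
  using normal_tangent[OF _ npart(2), of z w] by (simp add: h_simps sym[of z])

context
  fixes \<xi> \<nu> :: 'e
  assumes dim: "DIM('e) = DIM('f) + 2"
    and \<xi>: "\<xi> \<in> nspace h T" "h \<xi> \<xi> = 0" and \<nu>: "\<nu> \<in> nspace h T" "h \<xi> \<nu> \<noteq> 0"
begin

text \<open>The tangent space together with \<xi> and \<nu> is everything, by injectivity of
  \<open>L\<close> and a dimension count. A vector orthogonal to all of it vanishes by
  nondegeneracy.\<close>

lemma normal_eq_0:
  assumes n: "n \<in> nspace h T" "h n \<xi> = 0" "h n \<nu> = 0"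
  shows "n = 0"
proof -
  define L where "L = (\<lambda>(t, a, b). T t + a *\<^sub>R \<xi> + b *\<^sub>R \<nu>)"
  have lin: "linear L"
    unfolding L_def by (rule linearI) (auto simp: T_simps algebra_simps)
  have "inj L"
    unfolding linear_injective_0[OF lin]
  proof (intro allI impI)
    fix z assume z: "L z = 0"
    obtain t a b where tab: "z = (t, a, b)" by (cases z) auto
    have eq: "T t + a *\<^sub>R \<xi> + b *\<^sub>R \<nu> = 0" using z by (simp add: tab L_def)
    \<comment> \<open>As \<xi> is null, pairing with \<xi> isolates \<open>b\<close>; pairing with
      \<nu> then gives \<open>a\<close>.\<close>
    have "h \<xi> (T t + a *\<^sub>R \<xi> + b *\<^sub>R \<nu>) = 0" "h \<nu> (T t + a *\<^sub>R \<xi> + b *\<^sub>R \<nu>) = 0"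
      unfolding eq by (simp_all add: h_simps)
    then have ab: "b = 0" "a = 0"
      using \<xi> \<nu> normal_tangent[of _ "T t"] by (auto simp: h_simps sym[of \<nu> \<xi>])
    then have "t = 0" using eq injD[OF inj_T, of t 0] by (simp add: T_simps)
    then show "z = 0" using ab tab by (simp add: zero_prod_def)
  qed
  then have "dim (range L) = dim (UNIV :: ('f \<times> real \<times> real) set)"
    by (intro dim_image_eq[OF lin]) (simp add: inj_on_subset)
  then have "dim (range L) = DIM('e)" by (simp add: dim dim_UNIV)
  then have "range L = UNIV"
    using dim_eq_full[of "range L"] linear_subspace_image[OF lin subspace_UNIV]
    by (metis span_eq_iff)
  moreover have "h n (L z) = 0" for z
    using n normal_tangent[OF n(1)] by (cases z) (auto simp: L_def h_simps)
  ultimately have "h n w = 0" for w by (metis UNIV_I imageE)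
  then show ?thesis using nondegenerate unfolding nondegenerate_def by blast
qed

text \<open>In the normal plane the orthogonal complement of a null line is the line itself. The
  coefficient is chosen so that the difference is also orthogonal to \<nu>.\<close>

lemma normal_null_multiple:
  assumes "n \<in> nspace h T" "h n \<xi> = 0"
  shows "n = (h n \<nu> / h \<xi> \<nu>) *\<^sub>R \<xi>"
proof -
  have "n - (h n \<nu> / h \<xi> \<nu>) *\<^sub>R \<xi> = 0"
    by (rule normal_eq_0) (use assms \<xi> \<nu> nspace_diff nspace_scaleR in \<open>auto simp: h_simps\<close>)
  then show ?thesis by simp
qed

end

text \<open>Projecting a vector to the normal space does not change its pairing with the normal
  vector \<xi>.\<close>

lemma normal_complement_exists:
  assumes "\<xi> \<in> nspace h T" "\<xi> \<noteq> 0"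
  obtains w where "h \<xi> w \<noteq> 0" "h \<xi> (npart h T w) \<noteq> 0"
proof -
  obtain w where "h \<xi> w \<noteq> 0" using assms(2) nondegenerate unfolding nondegenerate_def by blast
  then show thesis using that[of w] h_npart[OF assms(1), of w] by (simp add: sym[of \<xi>])
qed

lemma normal_parallel_null:
  assumes "DIM('e) = DIM('f) + 2" "\<xi> \<in> nspace h T" "h \<xi> \<xi> = 0" "\<xi> \<noteq> 0"
    "n \<in> nspace h T" "h n \<xi> = 0"
  obtains k where "n = k *\<^sub>R \<xi>"
  using normal_complement_exists[OF assms(2,4)] normal_null_multiple[OF assms(1,2,3) npart(1) _ assms(5,6)]
  by metis

end

text \<open>\<open>C\<close> preserves the forms and matches the tangent maps up to the
  reparametrisation \<open>B\<close>, so it carries one orthogonal splitting to the other.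
  Surjectivity of \<open>B\<close> ensures that all tangent directions are tested.\<close>

lemma npart_transfer:
  assumes "spacelike_subspace h T" "spacelike_subspace h' T'"
    and C: "linear C" "\<And>a b. h a b = h' (C a) (C b)" and B: "\<And>v. C (T v) = T' (B v)" "surj B"
  shows "C (npart h T w) = npart h' T' (C w)"
    and "z \<in> nspace h T \<longleftrightarrow> C z \<in> nspace h' T'"
proof -
  have iff: "z \<in> nspace h T \<longleftrightarrow> C z \<in> nspace h' T'" for z
    unfolding nspace_def by (simp add: C B) (metis B(2) surjD)
  then show "z \<in> nspace h T \<longleftrightarrow> C z \<in> nspace h' T'" .
  have "C w - C (npart h T w) \<in> range T'"
    using spacelike_subspace.npart(2)[OF assms(1), of w] B(1) by (auto simp flip: linear_diff[OF C(1)])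
  then show "C (npart h T w) = npart h' T' (C w)"
    using spacelike_subspace.npart(1)[OF assms(1), of w] iff
    by (intro spacelike_subspace.npart_eqI[OF assms(2), symmetric]) auto
qed

section \<open>Codimension two spacelike immersions in coordinates\<close>

locale spacelike_patch = E: metric_patch \<Omega> G + P: connection_patch \<Omega> \<Gamma> W F
  for \<Omega> :: "'e::euclidean_space set" and G :: "'e \<Rightarrow> 'e \<Rightarrow> 'e \<Rightarrow> real" and \<Gamma> :: "'e \<Rightarrow> 'e \<Rightarrow> 'e \<Rightarrow> 'e"
    and W :: "'f::euclidean_space set" and F :: "'f \<Rightarrow> 'e" +
  assumes conn_levi_civita: "y \<in> \<Omega> \<Longrightarrow> levi_civita_form G y (\<Gamma> y)"
    and spacelike: "x \<in> W \<Longrightarrow> t \<noteq> 0 \<Longrightarrow> 0 < G (F x) (fd F x t) (fd F x t)"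
    and codim2: "DIM('e) = DIM('f) + 2"
begin

abbreviation h :: "'f \<Rightarrow> 'e \<Rightarrow> 'e \<Rightarrow> real" where "h x \<equiv> G (F x)"
abbreviation T :: "'f \<Rightarrow> 'f \<Rightarrow> 'e" where "T x \<equiv> fd F x"
abbreviation N :: "'f \<Rightarrow> 'e set" where "N x \<equiv> nspace (h x) (T x)"
abbreviation np :: "'f \<Rightarrow> 'e \<Rightarrow> 'e" where "np x \<equiv> npart (h x) (T x)"

lemma subspace_at: "x \<in> W \<Longrightarrow> spacelike_subspace (h x) (T x)"
  using P.F_in E.bilinear_metric E.metric_sym E.nondegenerate_metric smooth_on_linear_fd[OF P.smooth_F] spacelike
  by (intro spacelike_subspace.intro) auto

lemma restrict:
  assumes "open W'" "W' \<subseteq> W"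
  shows "spacelike_patch \<Omega> G \<Gamma> W' F"
  by standard
    (use assms P.bilinear_conn P.conn_sym P.smooth_conn P.F_in smooth_on_subset[OF P.smooth_F]
      conn_levi_civita spacelike codim2 P.open_target in auto)

lemma smooth_h: "smooth_on W V \<Longrightarrow> smooth_on W V' \<Longrightarrow> smooth_on W (\<lambda>x. h x (V x) (V' x))"
  by (rule smooth_on_apply_bilinear[where B = h, OF P.open_dom E.bilinear_metric[OF P.F_in]
        smooth_on_compose[OF E.smooth_metric P.open_dom P.smooth_F P.F_target]])

lemma smooth_T: "smooth_on W a \<Longrightarrow> smooth_on W (\<lambda>x. T x (a x))"
  by (rule smooth_on_apply_linear[where A = T, OF P.open_dom smooth_on_linear_fd[OF P.smooth_F] smooth_on_fd[OF P.smooth_F]])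

text \<open>Metric compatibility along \<open>F\<close>: the derivative of the metric coefficients
  supplies exactly the \<Gamma>-terms that complete the ordinary derivatives to
  \<open>P.D\<close>.\<close>

lemma fd_h:
  assumes x: "x \<in> W" and V: "smooth_on W V" "smooth_on W V'"
  shows "fd (\<lambda>x. h x (V x) (V' x)) x v = h x (P.D V x v) (V' x) + h x (V x) (P.D V' x v)"
proof -
  note Fx = P.F_in[OF x]
  have "fd (\<lambda>x. h x (V x) (V' x)) x v
      = fd (\<lambda>y. h y (V x) (V' x)) x v + h x (fd V x v) (V' x) + h x (V x) (fd V' x v)"
    by (rule fd_apply_bilinear[where B = h, OF P.open_dom E.bilinear_metric[OF P.F_in]
        smooth_on_compose[OF E.smooth_metric P.open_dom P.smooth_F P.F_target] x V])
  also have "fd (\<lambda>y. h y (V x) (V' x)) x v = fd (\<lambda>y. G y (V x) (V' x)) (F x) (T x v)"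
    by (rule fd_compose[OF smooth_on_differentiable[OF P.smooth_F x] smooth_on_differentiable[OF E.smooth_metric Fx]])
  also have "\<dots> = h x (\<Gamma> (F x) (T x v) (V x)) (V' x) + h x (V x) (\<Gamma> (F x) (T x v) (V' x))"
    using conn_levi_civita[OF Fx] by (simp add: levi_civita_form_def)
  finally show ?thesis
    by (simp add: P.D_def linear_add[OF E.linear_metric(1)[OF Fx]] linear_add[OF E.linear_metric(2)[OF Fx]])
qed

section \<open>Null normal fields in a coordinate patch\<close>

context
  fixes \<xi> :: "'f \<Rightarrow> 'e"
  assumes smooth_\<xi>: "smooth_on W \<xi>" and normal_\<xi>: "x \<in> W \<Longrightarrow> \<xi> x \<in> N x"
    and null_\<xi>: "x \<in> W \<Longrightarrow> h x (\<xi> x) (\<xi> x) = 0" and nonzero_\<xi>: "x \<in> W \<Longrightarrow> \<xi> x \<noteq> 0"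
begin

lemma h_D_null:
  assumes "x \<in> W"
  shows "h x (P.D \<xi> x v) (\<xi> x) = 0"
proof -
  have "fd (\<lambda>x. 0) x v = fd (\<lambda>x. h x (\<xi> x) (\<xi> x)) x v"
    by (rule fun_cong[OF smooth_on_cong_fd[OF P.open_dom smooth_on_const _ assms]]) (simp add: null_\<xi>)
  then show ?thesis
    using fd_h[OF assms smooth_\<xi> smooth_\<xi>, of v] E.metric_sym[OF P.F_in[OF assms], of "\<xi> x"] by simp
qed

text \<open>The umbilicity factor and the connection form of the null line bundle spanned by \<open>\<xi>\<close>. They are
  given by quotients so that their smoothness is manifest.\<close>

definition rho :: "'f \<Rightarrow> real" where
  "rho x = (let e = SOME i. i \<in> Basis in - h x (P.D \<xi> x e) (T x e) / h x (T x e) (T x e))"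

definition om :: "'f \<Rightarrow> 'f \<Rightarrow> real" where
  "om x v = ((P.D \<xi> x v + rho x *\<^sub>R T x v) \<bullet> \<xi> x) / (\<xi> x \<bullet> \<xi> x)"

lemma smooth_rho: "smooth_on W rho"
proof -
  define e where "e = (SOME i :: 'f. i \<in> Basis)"
  have "e \<in> Basis" unfolding e_def by (rule someI_ex) (use nonempty_Basis in blast)
  then have "e \<noteq> 0" by auto
  have "smooth_on W (\<lambda>x. - h x (P.D \<xi> x e) (T x e) / h x (T x e) (T x e))"
    using spacelike[OF _ \<open>e \<noteq> 0\<close>]
    by (intro smooth_on_divide[OF P.open_dom] smooth_on_minus[OF P.open_dom] smooth_h
        P.smooth_on_D smooth_\<xi> smooth_on_fd P.smooth_F) force
  then show ?thesis unfolding rho_def[abs_def] Let_def e_def .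
qed

lemma smooth_om: "smooth_on W (\<lambda>x. om x v)"
  unfolding om_def
  by (intro smooth_on_divide[OF P.open_dom] smooth_on_inner[OF P.open_dom] smooth_on_add[OF P.open_dom]
      smooth_on_scaleR[OF P.open_dom] P.smooth_on_D smooth_\<xi> smooth_rho smooth_on_fd P.smooth_F)
     (simp add: nonzero_\<xi>)

lemma linear_om:
  assumes "x \<in> W"
  shows "linear (om x)"
  unfolding om_def
  by (rule linearI)
    (simp_all add: linear_add[OF P.linear_D[OF smooth_\<xi> assms]] linear_cmul[OF P.linear_D[OF smooth_\<xi> assms]]
      linear_add[OF smooth_on_linear_fd[OF P.smooth_F assms]] linear_cmul[OF smooth_on_linear_fd[OF P.smooth_F assms]]
      inner_add_left add_divide_distrib algebra_simps)

context
  assumes umbilical: "x \<in> W \<Longrightarrow> \<exists>r. \<forall>v. P.D \<xi> x v + r *\<^sub>R T x v \<in> N x"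
begin

lemma D_umbilical:
  assumes x: "x \<in> W"
  shows "P.D \<xi> x v = om x v *\<^sub>R \<xi> x - rho x *\<^sub>R T x v"
proof -
  interpret L: spacelike_subspace "h x" "T x" by (rule subspace_at[OF x])
  obtain r where r: "\<And>v. P.D \<xi> x v + r *\<^sub>R T x v \<in> N x" using umbilical[OF x] by blast
  define e where "e = (SOME i :: 'f. i \<in> Basis)"
  have "e \<in> Basis" unfolding e_def by (rule someI_ex) (use nonempty_Basis in blast)
  then have "e \<noteq> 0" by auto
  \<comment> \<open>Testing normality against the fixed tangent vector \<open>T x e\<close>
    expresses the pointwise factor \<open>r\<close> by the smooth quotient
    \<open>rho\<close>.\<close>
  have "h x (P.D \<xi> x e + r *\<^sub>R T x e) (T x e) = 0" using r[of e] by (simp add: nspace_def)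
  then have "rho x = r"
    using L.pos[OF \<open>e \<noteq> 0\<close>] by (simp add: rho_def e_def[symmetric] L.h_simps field_simps)
  then have n: "P.D \<xi> x v + rho x *\<^sub>R T x v \<in> N x" using r by simp
  have "h x (P.D \<xi> x v + rho x *\<^sub>R T x v) (\<xi> x) = 0"
    using h_D_null[OF x, of v] L.normal_tangent[OF normal_\<xi>[OF x], of "T x v"]
    by (simp add: L.h_simps L.sym[of "T x v"])
  then obtain k where k: "P.D \<xi> x v + rho x *\<^sub>R T x v = k *\<^sub>R \<xi> x"
    using L.normal_parallel_null[OF codim2 normal_\<xi>[OF x] null_\<xi>[OF x] nonzero_\<xi>[OF x] n] by blast
  \<comment> \<open>The Euclidean inner product reads off the coefficient; the metric cannot, since
    \<xi> is null.\<close>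
  then have "om x v = k" using nonzero_\<xi>[OF x] by (simp add: om_def)
  then show ?thesis using k by (simp add: algebra_simps)
qed

lemma normal_curvature_null:
  assumes x: "x \<in> W"
  shows "np x (P.Rm (F x) (T x u) (T x v) (\<xi> x))
    = (fd (\<lambda>y. om y v) x u - fd (\<lambda>y. om y u) x v) *\<^sub>R \<xi> x"
proof -
  interpret L: spacelike_subspace "h x" "T x" by (rule subspace_at[OF x])
  have DD: "P.D (\<lambda>y. P.D \<xi> y v) x u = fd (\<lambda>y. om y v) x u *\<^sub>R \<xi> x + om x v *\<^sub>R P.D \<xi> x u
      - fd rho x u *\<^sub>R T x v - rho x *\<^sub>R P.D (\<lambda>y. T y v) x u" for u v
  proof -
    let ?R = "\<lambda>y. om y v *\<^sub>R \<xi> y + (- rho y) *\<^sub>R T y v"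
    have sm: "smooth_on W (\<lambda>y. - rho y)" "smooth_on W (\<lambda>y. T y v)"
      by (intro smooth_on_minus[OF P.open_dom] smooth_rho smooth_on_fd P.smooth_F)+
    note d = smooth_on_differentiable[OF _ x]
    have "P.D (\<lambda>y. P.D \<xi> y v) x u = P.D ?R x u"
      by (rule fun_cong[OF P.D_cong[OF x P.open_dom P.smooth_on_D[OF smooth_\<xi>]]]) (simp add: D_umbilical)
    also have "\<dots> = P.D (\<lambda>y. om y v *\<^sub>R \<xi> y) x u + P.D (\<lambda>y. (- rho y) *\<^sub>R T y v) x u"
      by (intro P.D_add x d[OF smooth_on_scaleR[OF P.open_dom]] smooth_om smooth_\<xi> sm)
    also have "P.D (\<lambda>y. om y v *\<^sub>R \<xi> y) x u = fd (\<lambda>y. om y v) x u *\<^sub>R \<xi> x + om x v *\<^sub>R P.D \<xi> x u"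
      by (intro P.D_scaleR x d smooth_om smooth_\<xi>)
    also have "P.D (\<lambda>y. (- rho y) *\<^sub>R T y v) x u
        = fd (\<lambda>y. - rho y) x u *\<^sub>R T x v + (- rho x) *\<^sub>R P.D (\<lambda>y. T y v) x u"
      by (intro P.D_scaleR x d sm)
    also have "fd (\<lambda>y. - rho y) x u = - fd rho x u"
      using fd_eqI[OF has_derivative_minus[OF smooth_on_has_derivative[OF smooth_rho x]]] by simp
    finally show ?thesis by simp
  qed
  show ?thesis
  proof (rule L.npart_eqI)
    show "(fd (\<lambda>y. om y v) x u - fd (\<lambda>y. om y u) x v) *\<^sub>R \<xi> x \<in> N x"
      by (rule L.nspace_scaleR[OF normal_\<xi>[OF x]])
    \<comment> \<open>The products of two values of \<open>om\<close> are symmetric in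
      \<open>u\<close> and \<open>v\<close> and drop out; what is left has an explicit preimage
      under \<open>T x\<close>.\<close>
    have "P.Rm (F x) (T x u) (T x v) (\<xi> x) - (fd (\<lambda>y. om y v) x u - fd (\<lambda>y. om y u) x v) *\<^sub>R \<xi> x
        = T x ((fd rho x v) *\<^sub>R u - (fd rho x u) *\<^sub>R v + (rho x * om x u) *\<^sub>R v - (rho x * om x v) *\<^sub>R u)"
      unfolding P.ricci_identity_const[OF x smooth_\<xi>, of v u, symmetric] DD
        P.D_sym[OF x, of v u] D_umbilical[OF x]
      by (simp add: L.T_simps algebra_simps)
    then show "P.Rm (F x) (T x u) (T x v) (\<xi> x) - (fd (\<lambda>y. om y v) x u - fd (\<lambda>y. om y u) x v) *\<^sub>R \<xi> x
        \<in> range (T x)" by simp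
  qed
qed

lemma np_D_rescaled:
  assumes x: "x \<in> W" and f: "f differentiable (at x)"
  shows "np x (P.D (\<lambda>y. exp (- f y) *\<^sub>R \<xi> y) x v) = (exp (- f x) * (om x v - fd f x v)) *\<^sub>R \<xi> x"
proof -
  interpret L: spacelike_subspace "h x" "T x" by (rule subspace_at[OF x])
  have df: "((\<lambda>y. exp (- f y)) has_derivative (\<lambda>v. - (exp (- f x) * fd f x v))) (at x)"
    using differentiable_fd[OF f] by (auto intro!: derivative_eq_intros)
  have "P.D (\<lambda>y. exp (- f y) *\<^sub>R \<xi> y) x v
      = (- (exp (- f x) * fd f x v)) *\<^sub>R \<xi> x + exp (- f x) *\<^sub>R (om x v *\<^sub>R \<xi> x - rho x *\<^sub>R T x v)"
    using P.D_scaleR[OF x differentiableI[OF df] smooth_on_differentiable[OF smooth_\<xi> x]]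
    by (simp add: fd_eqI[OF df] D_umbilical[OF x])
  then have "P.D (\<lambda>y. exp (- f y) *\<^sub>R \<xi> y) x v - (exp (- f x) * (om x v - fd f x v)) *\<^sub>R \<xi> x
      = T x (- (exp (- f x) * rho x) *\<^sub>R v)"
    by (simp add: L.T_simps algebra_simps linear_neg[OF L.linear_T])
  then show ?thesis
    by (intro L.npart_eqI L.nspace_scaleR normal_\<xi>[OF x]) auto
qed

end

end

end

section \<open>Parallel null frames and flatness\<close>

text \<open>The bracket acts on functions as a commutator. In a parallel frame, flatness reduces to
  this identity for the coefficient functions.\<close>

lemma fd_bracket:
  fixes a :: "'f::euclidean_space \<Rightarrow> 'g::euclidean_space"
  assumes W: "open W" "x \<in> W" and sm: "smooth_on W a" "smooth_on W X" "smooth_on W Y"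
  shows "fd (\<lambda>y. fd a y (Y y)) x (X x) - fd (\<lambda>y. fd a y (X y)) x (Y x)
    = fd a x (fd Y x (X x) - fd X x (Y x))"
proof -
  have "fd (\<lambda>y. fd a y (Z y)) x v = fd (\<lambda>y. fd a y (Z x)) x v + fd a x (fd Z x v)"
    if "smooth_on W Z" for Z v
    by (rule fd_apply_linear[where A = "fd a", OF W(1) smooth_on_linear_fd[OF sm(1)] smooth_on_fd[OF sm(1)] W(2)
          smooth_on_differentiable[OF that W(2)]])
  from this[OF sm(2)] this[OF sm(3)] show ?thesis
    using second_derivative_symmetric[OF W(1) sm(1) W(2), of "Y x" "X x"]
      linear_diff[OF smooth_on_linear_fd[OF sm(1) W(2)]] by simp
qed

context spacelike_patch
begin

text \<open>The tangential part of a constant vector solves the smooth Gram system, so subtracting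
  it yields a smooth normal field.\<close>

lemma normal_extension:
  fixes w :: 'e
  obtains t where "smooth_on W t" "\<And>x. x \<in> W \<Longrightarrow> w - T x (t x) \<in> N x"
proof -
  let ?A = "\<lambda>x. gram (h x) (T x)" and ?b = "\<lambda>x. \<Sum>i\<in>Basis. h x w (T x i) *\<^sub>R i"
  define t where "t x = inv (?A x) (?b x)" for x
  have A: "linear (?A x)" "inj (?A x)" if "x \<in> W" for x
    using spacelike_subspace.linear_gram spacelike_subspace.inj_gram subspace_at[OF that] by blast+
  have At: "?A x (t x) = ?b x" if "x \<in> W" for x
    unfolding t_def using linear_injective_imp_surjective[OF A[OF that]] by (simp add: surj_f_inv_f)
  have "smooth_on W t"
  proof (rule smooth_on_linear_solve[where A = ?A, OF P.open_dom A _ _ At])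
    show "smooth_on W (\<lambda>x. ?A x v)" for v
      unfolding gram_def
      by (intro smooth_on_sum[OF P.open_dom] smooth_on_scaleR[OF P.open_dom] smooth_h smooth_on_fd
          P.smooth_F smooth_on_const)
    show "smooth_on W ?b"
      by (intro smooth_on_sum[OF P.open_dom] smooth_on_scaleR[OF P.open_dom] smooth_h smooth_on_fd
          P.smooth_F smooth_on_const)
  qed
  moreover have "w - T x (t x) \<in> N x" if "x \<in> W" for x
    using At[OF that] by (simp add: spacelike_subspace.gram_eq_iff[OF subspace_at[OF that]])
  ultimately show thesis by (rule that)
qed

definition parallel_null_frame :: "('f \<Rightarrow> 'e) \<Rightarrow> ('f \<Rightarrow> 'e) \<Rightarrow> bool" where
  "parallel_null_frame \<xi> \<eta> \<longleftrightarrow> smooth_on W \<xi> \<and> smooth_on W \<eta> \<and>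
     (\<forall>x\<in>W. \<xi> x \<in> N x \<and> \<eta> x \<in> N x \<and> h x (\<xi> x) (\<xi> x) = 0 \<and> h x (\<eta> x) (\<eta> x) = 0 \<and> h x (\<xi> x) (\<eta> x) = 1 \<and>
        (\<forall>v. P.D \<xi> x v \<in> range (T x) \<and> P.D \<eta> x v \<in> range (T x)))"

text \<open>A normal field transversal to \<xi> at \<open>x0\<close> is corrected to the second null
  direction. The result is parallel automatically, because its products with \<xi> and with itself
  are constant.\<close>

lemma parallel_null_frame_exists:
  assumes sm: "smooth_on W \<xi>" and normal: "\<And>x. x \<in> W \<Longrightarrow> \<xi> x \<in> N x"
    and null: "\<And>x. x \<in> W \<Longrightarrow> h x (\<xi> x) (\<xi> x) = 0" and nonzero: "\<And>x. x \<in> W \<Longrightarrow> \<xi> x \<noteq> 0"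
    and par: "\<And>x v. x \<in> W \<Longrightarrow> P.D \<xi> x v \<in> range (T x)" and x0: "x0 \<in> W"
  obtains W' \<eta> where "open W'" "W' \<subseteq> W" "x0 \<in> W'"
    "spacelike_patch.parallel_null_frame G \<Gamma> W' F \<xi> \<eta>"
proof -
  obtain w where w: "h x0 (\<xi> x0) w \<noteq> 0"
    using spacelike_subspace.normal_complement_exists[OF subspace_at normal nonzero, OF x0 x0 x0] by blast
  obtain t where t: "smooth_on W t" "\<And>x. x \<in> W \<Longrightarrow> w - T x (t x) \<in> N x"
    using normal_extension by blast
  define \<nu> where "\<nu> x = w - T x (t x)" for x
  define k where "k x = h x (\<xi> x) (\<nu> x)" for x
  have sm\<nu>: "smooth_on W \<nu>"
    unfolding \<nu>_def by (intro smooth_on_diff[OF P.open_dom] smooth_T t smooth_on_const)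
  have smk: "smooth_on W k" unfolding k_def by (rule smooth_h[OF sm sm\<nu>])
  \<comment> \<open>The vector \<open>w\<close> was chosen at \<open>x0\<close> only, so
    transversality is guaranteed just near that point.\<close>
  define W' where "W' = W \<inter> k -` (- {0})"
  have op: "open W'"
    unfolding W'_def using smooth_on_continuous[OF smk] P.open_dom
    by (simp add: continuous_on_open_vimage Int_commute open_Compl)
  have sub: "W' \<subseteq> W" by (auto simp: W'_def)
  have x0': "x0 \<in> W'"
  proof -
    interpret L: spacelike_subspace "h x0" "T x0" by (rule subspace_at[OF x0])
    have "k x0 = h x0 (\<xi> x0) w"
      using L.normal_tangent[OF normal[OF x0]] by (simp add: k_def \<nu>_def L.h_simps)
    then show ?thesis using x0 w by (simp add: W'_def)
  qed
  interpret R: spacelike_patch \<Omega> G \<Gamma> W' F by (rule restrict[OF op sub])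
  \<comment> \<open>This \<open>c\<close> solves
    \<open>h x (\<nu> x) (\<nu> x) + 2 * c x * k x = 0\<close>, which makes \<nu> + c \<xi> null;
    dividing by \<open>k\<close> then normalises the pairing with \<xi> to 1.\<close>
  define c where "c x = - h x (\<nu> x) (\<nu> x) / (2 * k x)" for x
  define \<eta> where "\<eta> x = (1 / k x) *\<^sub>R (\<nu> x + c x *\<^sub>R \<xi> x)" for x
  have k0: "k x \<noteq> 0" if "x \<in> W'" for x using that by (simp add: W'_def)
  note sm' = sm[THEN smooth_on_subset, OF sub] sm\<nu>[THEN smooth_on_subset, OF sub] smk[THEN smooth_on_subset, OF sub]
  have sm\<eta>: "smooth_on W' \<eta>"
    unfolding \<eta>_def c_def
    by (intro smooth_on_scaleR[OF op] smooth_on_divide[OF op] smooth_on_add[OF op] smooth_on_minus[OF op]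
        smooth_on_mult[OF op] smooth_on_const R.smooth_h sm') (use k0 in auto)
  have al: "\<eta> x \<in> N x \<and> h x (\<eta> x) (\<eta> x) = 0 \<and> h x (\<xi> x) (\<eta> x) = 1" if x: "x \<in> W'" for x
  proof -
    have xW: "x \<in> W" using x sub by blast
    interpret L: spacelike_subspace "h x" "T x" by (rule subspace_at[OF xW])
    have n: "\<nu> x \<in> N x" using t(2)[OF xW] by (simp add: \<nu>_def)
    have "\<eta> x \<in> N x"
      unfolding \<eta>_def by (intro L.nspace_scaleR L.nspace_add n normal[OF xW])
    then show ?thesis
      using k0[OF x] null[OF xW]
      by (auto simp: \<eta>_def c_def k_def L.h_simps L.sym[of "\<nu> x" "\<xi> x"] field_simps)
  qed
  have par\<eta>: "P.D \<eta> x v \<in> range (T x)" if x: "x \<in> W'" for x v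
  proof -
    have xW: "x \<in> W" using x sub by blast
    interpret L: spacelike_subspace "h x" "T x" by (rule subspace_at[OF xW])
    let ?z = "np x (P.D \<eta> x v)"
    \<comment> \<open>Differentiating the two constant products shows that the normal part of the
      derivative of \<eta> is orthogonal to \<xi> and to \<eta>, hence 0.\<close>
    have "fd (\<lambda>x. 1) x v = fd (\<lambda>x. h x (\<xi> x) (\<eta> x)) x v"
      by (rule fun_cong[OF smooth_on_cong_fd[OF op smooth_on_const _ x]]) (simp add: al)
    then have "h x (P.D \<xi> x v) (\<eta> x) + h x (\<xi> x) (P.D \<eta> x v) = 0"
      using R.fd_h[OF x sm'(1) sm\<eta>, of v] by simp
    then have 1: "h x ?z (\<xi> x) = 0"
      using L.normal_tangent[of "\<eta> x" "P.D \<xi> x v"] par[OF xW, of v] al[OF x]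
        L.h_npart[OF normal[OF xW], of "P.D \<eta> x v"]
      by (simp add: L.sym[of "P.D \<xi> x v" "\<eta> x"] L.sym[of "P.D \<eta> x v" "\<xi> x"])
    have "fd (\<lambda>x. 0) x v = fd (\<lambda>x. h x (\<eta> x) (\<eta> x)) x v"
      by (rule fun_cong[OF smooth_on_cong_fd[OF op smooth_on_const _ x]]) (simp add: al)
    then have 2: "h x ?z (\<eta> x) = 0"
      using R.fd_h[OF x sm\<eta> sm\<eta>, of v] al[OF x] L.h_npart[of "\<eta> x" "P.D \<eta> x v"]
      by (simp add: L.sym[of "\<eta> x" "P.D \<eta> x v"])
    have "?z = 0"
      using L.normal_eq_0[OF codim2 normal[OF xW] null[OF xW], of "\<eta> x" ?z] al[OF x] L.npart(1) 1 2 by simp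
    then show ?thesis by (simp add: L.npart_eq_0_iff)
  qed
  have "R.parallel_null_frame \<xi> \<eta>"
    unfolding R.parallel_null_frame_def using sm'(1) sm\<eta> al par\<eta> par normal null sub by blast
  then show thesis using that op sub x0' by blast
qed

section \<open>The normal connection in a parallel null frame\<close>

context
  fixes \<xi> \<eta> :: "'f \<Rightarrow> 'e"
  assumes frame: "parallel_null_frame \<xi> \<eta>"
begin

lemma np_D_frame:
  assumes x: "x \<in> W" and ab: "a differentiable (at x)" "b differentiable (at x)"
  shows "np x (P.D (\<lambda>y. a y *\<^sub>R \<xi> y + b y *\<^sub>R \<eta> y) x v) = fd a x v *\<^sub>R \<xi> x + fd b x v *\<^sub>R \<eta> x"
proof -
  interpret L: spacelike_subspace "h x" "T x" by (rule subspace_at[OF x])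
  have d: "\<xi> differentiable (at x)" "\<eta> differentiable (at x)"
    using frame x smooth_on_differentiable by (auto simp: parallel_null_frame_def)
  have f: "\<xi> x \<in> N x" "\<eta> x \<in> N x" "P.D \<xi> x v \<in> range (T x)" "P.D \<eta> x v \<in> range (T x)"
    using frame x by (auto simp: parallel_null_frame_def)
  have s: "(\<lambda>y. a y *\<^sub>R \<xi> y) differentiable (at x)" "(\<lambda>y. b y *\<^sub>R \<eta> y) differentiable (at x)"
    using ab d by (auto intro: differentiable_scaleR)
  have eq: "P.D (\<lambda>y. a y *\<^sub>R \<xi> y + b y *\<^sub>R \<eta> y) x v - (fd a x v *\<^sub>R \<xi> x + fd b x v *\<^sub>R \<eta> x)
      = a x *\<^sub>R P.D \<xi> x v + b x *\<^sub>R P.D \<eta> x v"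
    by (simp add: P.D_add[OF x s] P.D_scaleR[OF x] ab d)
  show ?thesis
    by (rule L.npart_eqI, intro L.nspace_add L.nspace_scaleR f, unfold eq, intro L.range_add L.range_scaleR f)
qed

text \<open>In a null basis the coefficients are exchanged: that of \<xi> is the pairing with
  \<eta>, and conversely.\<close>

lemma normal_frame_expand:
  assumes x: "x \<in> W" and z: "z \<in> N x"
  shows "z = h x z (\<eta> x) *\<^sub>R \<xi> x + h x z (\<xi> x) *\<^sub>R \<eta> x"
proof -
  interpret L: spacelike_subspace "h x" "T x" by (rule subspace_at[OF x])
  have f: "\<xi> x \<in> N x" "\<eta> x \<in> N x" "h x (\<xi> x) (\<xi> x) = 0" "h x (\<eta> x) (\<eta> x) = 0" "h x (\<xi> x) (\<eta> x) = 1"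
    using frame x by (auto simp: parallel_null_frame_def)
  have "z - (h x z (\<eta> x) *\<^sub>R \<xi> x + h x z (\<xi> x) *\<^sub>R \<eta> x) = 0"
  proof (rule L.normal_eq_0[OF codim2 f(1,3,2)])
    show "z - (h x z (\<eta> x) *\<^sub>R \<xi> x + h x z (\<xi> x) *\<^sub>R \<eta> x) \<in> N x"
      by (intro L.nspace_diff L.nspace_add L.nspace_scaleR f z)
  qed (simp_all add: f L.h_simps L.sym[of "\<eta> x" "\<xi> x"])
  then show ?thesis by simp
qed

context
  fixes \<zeta> :: "'f \<Rightarrow> 'e" and X Y :: "'f \<Rightarrow> 'f"
  assumes sm\<zeta>: "smooth_on W \<zeta>" and normal\<zeta>: "x \<in> W \<Longrightarrow> \<zeta> x \<in> N x"
begin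

lemma np_D_normal:
  assumes x: "x \<in> W"
  shows "np x (P.D \<zeta> x v)
    = fd (\<lambda>y. h y (\<zeta> y) (\<eta> y)) x v *\<^sub>R \<xi> x + fd (\<lambda>y. h y (\<zeta> y) (\<xi> y)) x v *\<^sub>R \<eta> x"
proof -
  have sm: "smooth_on W (\<lambda>y. h y (\<zeta> y) (\<eta> y))" "smooth_on W (\<lambda>y. h y (\<zeta> y) (\<xi> y))"
    using frame by (auto simp: parallel_null_frame_def intro!: smooth_h sm\<zeta>)
  have "P.D \<zeta> x = P.D (\<lambda>y. h y (\<zeta> y) (\<eta> y) *\<^sub>R \<xi> y + h y (\<zeta> y) (\<xi> y) *\<^sub>R \<eta> y) x"
    by (rule P.D_cong[OF x P.open_dom sm\<zeta>]) (rule normal_frame_expand[OF _ normal\<zeta>])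
  then show ?thesis
    using np_D_frame[OF x sm[THEN smooth_on_differentiable, OF x]] by simp
qed

lemma smooth_np_D_normal: "smooth_on W Z \<Longrightarrow> smooth_on W (\<lambda>x. np x (P.D \<zeta> x (Z x)))"
proof -
  assume Z: "smooth_on W Z"
  have sm: "smooth_on W (\<lambda>y. h y (\<zeta> y) (\<eta> y))" "smooth_on W (\<lambda>y. h y (\<zeta> y) (\<xi> y))"
    using frame by (auto simp: parallel_null_frame_def intro!: smooth_h sm\<zeta>)
  have fr: "smooth_on W \<xi>" "smooth_on W \<eta>" using frame by (auto simp: parallel_null_frame_def)
  have d: "smooth_on W (\<lambda>x. fd a x (Z x))" if "smooth_on W a" for a :: "'f \<Rightarrow> real"
    by (rule smooth_on_apply_linear[where A = "fd a", OF P.open_dom smooth_on_linear_fd[OF that] smooth_on_fd[OF that] Z])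
  have "smooth_on W (\<lambda>x. fd (\<lambda>y. h y (\<zeta> y) (\<eta> y)) x (Z x) *\<^sub>R \<xi> x + fd (\<lambda>y. h y (\<zeta> y) (\<xi> y)) x (Z x) *\<^sub>R \<eta> x)"
    by (intro smooth_on_add[OF P.open_dom] smooth_on_scaleR[OF P.open_dom] d sm fr)
  then show ?thesis
    by (rule smooth_on_cong[OF P.open_dom]) (simp add: np_D_normal)
qed

lemma normal_curvature_frame:
  assumes x: "x \<in> W" and XY: "smooth_on W X" "smooth_on W Y"
  shows "np x (P.D (\<lambda>y. np y (P.D \<zeta> y (Y y))) x (X x)) - np x (P.D (\<lambda>y. np y (P.D \<zeta> y (X y))) x (Y x))
    = np x (P.D \<zeta> x (fd Y x (X x) - fd X x (Y x)))"
proof -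
  let ?a = "\<lambda>y. h y (\<zeta> y) (\<eta> y)" and ?b = "\<lambda>y. h y (\<zeta> y) (\<xi> y)"
  have sm: "smooth_on W ?a" "smooth_on W ?b"
    using frame by (auto simp: parallel_null_frame_def intro!: smooth_h sm\<zeta>)
  have d: "smooth_on W (\<lambda>x. fd a x (Z x))" if "smooth_on W a" "smooth_on W Z" for a :: "'f \<Rightarrow> real" and Z
    by (rule smooth_on_apply_linear[where A = "fd a", OF P.open_dom smooth_on_linear_fd[OF that(1)] smooth_on_fd[OF that(1)] that(2)])
  have second: "np x (P.D (\<lambda>y. np y (P.D \<zeta> y (Z y))) x v)
      = fd (\<lambda>y. fd ?a y (Z y)) x v *\<^sub>R \<xi> x + fd (\<lambda>y. fd ?b y (Z y)) x v *\<^sub>R \<eta> x"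
    if Z: "smooth_on W Z" for Z v
  proof -
    have "P.D (\<lambda>y. np y (P.D \<zeta> y (Z y))) x = P.D (\<lambda>y. fd ?a y (Z y) *\<^sub>R \<xi> y + fd ?b y (Z y) *\<^sub>R \<eta> y) x"
      by (rule P.D_cong[OF x P.open_dom smooth_np_D_normal[OF Z] np_D_normal])
    then show ?thesis
      using np_D_frame[OF x smooth_on_differentiable[OF d[OF sm(1) Z] x]
          smooth_on_differentiable[OF d[OF sm(2) Z] x]] by simp
  qed
  show ?thesis
    unfolding second[OF XY(1)] second[OF XY(2)] np_D_normal[OF x]
      fd_bracket[OF P.open_dom x sm(1) XY, symmetric] fd_bracket[OF P.open_dom x sm(2) XY, symmetric]
    by (simp add: scaleR_diff_left)
qed

end

end

end

section \<open>Codimension two spacelike submanifolds\<close>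

locale spacelike_immersion = smooth_map_lorentzian S M g \<psi>
  for S :: "('b, 'f::euclidean_space) manifold" and M :: "('a, 'e::euclidean_space) manifold"
    and g :: "'a \<Rightarrow> 'e \<Rightarrow> 'e \<Rightarrow> real" and \<psi> :: "'b \<Rightarrow> 'a" +
  assumes spacelike_submanifold: "spacelike_submanifold S M g \<psi>"
    and codim2: "DIM('e) = DIM('f) + 2"
begin

lemma normal_space_nspace: "normal_space S M g \<psi> p = nspace (g (\<psi> p)) (differential S M \<psi> p)"
  by (simp add: normal_space_def nspace_def)

lemma normal_part_npart: "normal_part S M g \<psi> p = npart (g (\<psi> p)) (differential S M \<psi> p)"
  by (simp add: fun_eq_iff normal_part_def npart_def normal_space_nspace)

lemma differential_pos:
  "p \<in> topspace (mtop S) \<Longrightarrow> v \<noteq> 0 \<Longrightarrow> 0 < g (\<psi> p) (differential S M \<psi> p v) (differential S M \<psi> p v)"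
  using spacelike_submanifold by (simp add: spacelike_submanifold_def)

lemma linear_differential:
  assumes p: "p \<in> topspace (mtop S)"
  shows "linear (differential S M \<psi> p)"
proof -
  let ?c = "chart_at S p" and ?d = "chart_at M (\<psi> p)"
  note cd = S.chart_at[OF p] M.chart_at[OF psi_topspace[OF p]]
  have "differential S M \<psi> p = fd (coord ?c ?d) (snd ?c p)"
    by (simp add: fun_eq_iff differential_def coord_def)
  moreover have "linear (fd (coord ?c ?d) (snd ?c p))"
    by (rule smooth_on_linear_fd[OF coord_smooth]) (use cd in \<open>auto simp: coord_dom_def\<close>)
  ultimately show ?thesis by simp
qed

lemma subspace_at_point:
  "p \<in> topspace (mtop S) \<Longrightarrow> spacelike_subspace (g (\<psi> p)) (differential S M \<psi> p)"
  using M.bilinear_g M.g_sym M.nondegenerate_g psi_topspace linear_differential differential_pos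
  by (intro spacelike_subspace.intro) auto

lemma patch:
  assumes c: "c \<in> atlas S" and d: "d \<in> atlas M" and W: "open W" "W \<subseteq> coord_dom c d"
  shows "spacelike_patch (snd d ` fst d) (M.G d) (christoffel M g d) W (coord c d)"
proof -
  interpret E: metric_patch "snd d ` fst d" "M.G d" by (rule M.metric_patch_chart[OF d])
  interpret P: connection_patch "snd d ` fst d" "christoffel M g d" W "coord c d"
    by (rule connection_patch_coord[OF c d W])
  show ?thesis
  proof
    show "levi_civita_form (M.G d) y (christoffel M g d y)" if "y \<in> snd d ` fst d" for y
      by (rule M.christoffel_form[OF d that])
    show "DIM('e) = DIM('f) + 2" by (rule codim2)
    fix x t assume x: "x \<in> W" and t: "t \<noteq> (0 :: 'f)"
    then obtain p where p: "p \<in> fst c" "\<psi> p \<in> fst d" "x = snd c p"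
      using W(2) by (auto simp: coord_dom_def)
    let ?u = "of_components S c p t"
    have "?u \<noteq> 0"
      using S.components_of_components(1)[OF c p(1), of t] linear_0[OF S.linear_components[OF c p(1)]] t by auto
    then have "0 < g (\<psi> p) (differential S M \<psi> p ?u) (differential S M \<psi> p ?u)"
      using differential_pos S.chart_subset[OF c] p(1) by blast
    then show "0 < M.G d (coord c d x) (fd (coord c d) x t) (fd (coord c d) x t)"
      using differential_chart[OF c d p(1,2), of ?u] c p
      by (simp add: M.g_components[OF d p(2)])
  qed
qed

section \<open>Normal projection and normal connection in a pair of charts\<close>

context
  fixes c d p
  assumes c: "c \<in> atlas S" and d: "d \<in> atlas M" and p: "p \<in> fst c" "\<psi> p \<in> fst d"
begin

lemma in_coord_dom: "snd c p \<in> coord_dom c d"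
  using p by (auto simp: coord_dom_def)

lemma p_topspace: "p \<in> topspace (mtop S)"
  using S.chart_subset[OF c] p(1) by blast

lemma subspace_chart:
  "spacelike_subspace (M.G d (coord c d (snd c p))) (fd (coord c d) (snd c p))"
  by (rule spacelike_patch.subspace_at[OF patch[OF c d coord_dom_open[OF c d] subset_refl] in_coord_dom])

lemma surj_components: "surj (components S c p)"
  using S.components_of_components(1)[OF c p(1)] by (rule surjI)

lemma components_normal_part:
  "components M d (\<psi> p) (normal_part S M g \<psi> p w)
    = npart (M.G d (coord c d (snd c p))) (fd (coord c d) (snd c p)) (components M d (\<psi> p) w)"
  unfolding normal_part_npart
  by (rule npart_transfer(1)[OF subspace_at_point[OF p_topspace] subspace_chart M.linear_components[OF d p(2)]
      _ differential_chart[OF c d p] surj_components])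
    (simp add: c p M.g_components[OF d p(2)])

lemma normal_space_chart:
  "z \<in> normal_space S M g \<psi> p
    \<longleftrightarrow> components M d (\<psi> p) z \<in> nspace (M.G d (coord c d (snd c p))) (fd (coord c d) (snd c p))"
  unfolding normal_space_nspace
  by (rule npart_transfer(2)[OF subspace_at_point[OF p_topspace] subspace_chart M.linear_components[OF d p(2)]
      _ differential_chart[OF c d p] surj_components])
    (simp add: c p M.g_components[OF d p(2)])

lemma components_eq_0_iff: "components M d (\<psi> p) w = 0 \<longleftrightarrow> w = 0"
  using M.components_of_components(2)[OF d p(2)] linear_0[OF M.linear_components[OF d p(2)]]
    linear_0[OF M.linear_of_components[OF d p(2)]] by metis

lemma normal_connection_chart:
  assumes "vector_field_along S M \<psi> U V" "openin (mtop S) U" "p \<in> U"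
  shows "components M d (\<psi> p) (normal_connection S M g \<psi> V p v)
    = npart (M.G d (coord c d (snd c p))) (fd (coord c d) (snd c p))
        (Dc c d (lift c d V) (snd c p) (components S c p v))"
  by (simp add: normal_connection_def components_normal_part cov_deriv_chart[OF c d p assms])

end

text \<open>The definite description in \<open>shape_operator\<close> is resolved here: the
  orthogonal splitting gives existence, injectivity of the differential gives uniqueness. Umbilicity
  then says that adding a multiple of the tangent vector leaves a normal one.\<close>

lemma umbilical_chart:
  assumes umb: "umbilical S M g \<psi> \<xi>" and c: "c \<in> atlas S" and d: "d \<in> atlas M"
    and \<xi>: "vector_field_along S M \<psi> (topspace (mtop S)) \<xi>" and x: "x \<in> coord_dom c d"
  shows "\<exists>r. \<forall>v. Dc c d (lift c d \<xi>) x v + r *\<^sub>R fd (coord c d) x v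
    \<in> nspace (M.G d (coord c d x)) (fd (coord c d) x)"
proof -
  obtain p where p: "p \<in> fst c" "\<psi> p \<in> fst d" "x = snd c p" using x by (auto simp: coord_dom_def)
  have pS: "p \<in> topspace (mtop S)" using S.chart_subset[OF c] p(1) by blast
  interpret L: spacelike_subspace "g (\<psi> p)" "differential S M \<psi> p" by (rule subspace_at_point[OF pS])
  obtain r where r: "\<And>v. shape_operator S M g \<psi> \<xi> p v = r *\<^sub>R v"
    using umb pS unfolding umbilical_def by blast
  have "Dc c d (lift c d \<xi>) x v + r *\<^sub>R fd (coord c d) x v
      \<in> nspace (M.G d (coord c d x)) (fd (coord c d) x)" for v
  proof -
    let ?u = "of_components S c p v" and ?w = "cov_deriv_along S M g \<psi> \<xi> p"
    \<comment> \<open>The Weingarten formula carries a minus sign, so a tangential part with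
      preimage \<open>a\<close> means shape operator \<open>- a\<close>.\<close>
    obtain a where a: "?w ?u - normal_part S M g \<psi> p (?w ?u) = differential S M \<psi> p a"
      using L.npart(2)[of "?w ?u"] by (auto simp: normal_part_npart)
    then have 1: "?w ?u = - differential S M \<psi> p (- a) + normal_connection S M g \<psi> \<xi> p ?u"
      by (simp add: normal_connection_def linear_neg[OF L.linear_T] algebra_simps)
    have "shape_operator S M g \<psi> \<xi> p ?u = - a"
      unfolding shape_operator_def
    proof (rule the_equality)
      fix b assume "?w ?u = - differential S M \<psi> p b + normal_connection S M g \<psi> \<xi> p ?u"
      then have "differential S M \<psi> p b = differential S M \<psi> p (- a)" using 1 by simp
      then show "b = - a" using injD[OF L.inj_T] by blast
    qed (rule 1)
    then have "r *\<^sub>R differential S M \<psi> p ?u = differential S M \<psi> p (- a)"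
      using r[of ?u] by (simp add: linear_cmul[OF L.linear_T, symmetric])
    moreover have "A = - X + B \<Longrightarrow> A + X = B" for A X B :: 'e by simp
    ultimately have "?w ?u + r *\<^sub>R differential S M \<psi> p ?u = normal_part S M g \<psi> p (?w ?u)"
      using 1 unfolding normal_connection_def by metis
    then have "?w ?u + r *\<^sub>R differential S M \<psi> p ?u \<in> normal_space S M g \<psi> p"
      using L.npart(1)[of "?w ?u"] by (simp add: normal_part_npart normal_space_nspace)
    then have "components M d (\<psi> p) (?w ?u + r *\<^sub>R differential S M \<psi> p ?u)
        \<in> nspace (M.G d (coord c d x)) (fd (coord c d) x)"
      using normal_space_chart[OF c d p(1,2)] p(3) by simp
    then show ?thesis
      using p(3) c pS
      by (simp add: linear_add[OF M.linear_components[OF d p(2)]] linear_cmul[OF M.linear_components[OF d p(2)]]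
          differential_chart[OF c d p(1,2)] cov_deriv_chart[OF c d p(1,2) \<xi> openin_topspace pS] p(1))
  qed
  then show ?thesis by blast
qed

lemma vector_field_along_scale:
  assumes V: "vector_field_along S M \<psi> U V" and U: "openin (mtop S) U"
    and f: "\<And>c. c \<in> atlas S \<Longrightarrow> smooth_on (snd c ` (U \<inter> fst c)) (\<lambda>x. f (chart_inv c x))"
  shows "vector_field_along S M \<psi> U (\<lambda>r. f r *\<^sub>R V r)"
  unfolding vector_field_along_def
proof (intro ballI)
  fix c d assume c: "c \<in> atlas S" and d: "d \<in> atlas M"
  let ?W = "snd c ` (U \<inter> fst c \<inter> \<psi> -` fst d)"
  have op: "open ?W" by (rule open_preimage[OF d c U])
  have "smooth_on ?W (\<lambda>x. f (chart_inv c x) *\<^sub>R lift c d V x)"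
    by (intro smooth_on_scaleR[OF op] smooth_on_subset[OF f[OF c]] image_mono lift_smooth[OF V c d]) auto
  then show "smooth_on ?W (\<lambda>x. components M d (\<psi> (chart_inv c x)) (f (chart_inv c x) *\<^sub>R V (chart_inv c x)))"
    by (rule smooth_on_cong[OF op])
      (use c d in \<open>auto simp: lift_def linear_cmul[OF M.linear_components[OF d]]\<close>)
qed

lemma lift_scale:
  "c \<in> atlas S \<Longrightarrow> d \<in> atlas M \<Longrightarrow> x \<in> coord_dom c d
    \<Longrightarrow> lift c d (\<lambda>r. f r *\<^sub>R V r) x = f (chart_inv c x) *\<^sub>R lift c d V x"
  by (auto simp: coord_dom_def lift_def linear_cmul[OF M.linear_components])

lemma vector_field_along_subset: "vector_field_along S M \<psi> U V \<Longrightarrow> U' \<subseteq> U \<Longrightarrow> vector_field_along S M \<psi> U' V"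
  unfolding vector_field_along_def
  by (blast intro: smooth_on_subset image_mono)

section \<open>The connection form of the null field: exactness, curvature and flatness\<close>

context
  fixes \<xi> :: "'b \<Rightarrow> 'e"
  assumes \<xi>: "umbilical_lightlike_normal_field S M g \<psi> \<xi>"
begin

lemma smooth_\<xi>: "vector_field_along S M \<psi> (topspace (mtop S)) \<xi>"
  using \<xi> by (simp add: umbilical_lightlike_normal_field_def normal_field_def)

context
  fixes c d
  assumes c: "c \<in> atlas S" and d: "d \<in> atlas M"
begin

interpretation Q: spacelike_patch "snd d ` fst d" "M.G d" "christoffel M g d" "coord_dom c d" "coord c d"
  by (rule patch[OF c d coord_dom_open[OF c d] subset_refl])

lemma lift_\<xi>:
  shows "smooth_on (coord_dom c d) (lift c d \<xi>)"
    and "x \<in> coord_dom c d \<Longrightarrow> lift c d \<xi> x \<in> Q.N x"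
    and "x \<in> coord_dom c d \<Longrightarrow> Q.h x (lift c d \<xi> x) (lift c d \<xi> x) = 0"
    and "x \<in> coord_dom c d \<Longrightarrow> lift c d \<xi> x \<noteq> 0"
    and "x \<in> coord_dom c d \<Longrightarrow> \<exists>r. \<forall>v. Q.P.D (lift c d \<xi>) x v + r *\<^sub>R Q.T x v \<in> Q.N x"
proof -
  have "topspace (mtop S) \<inter> fst c \<inter> \<psi> -` fst d = fst c \<inter> \<psi> -` fst d"
    using S.chart_subset[OF c] by blast
  then show "smooth_on (coord_dom c d) (lift c d \<xi>)"
    using lift_smooth[OF smooth_\<xi> c d] by (simp add: coord_dom_def)
  assume x: "x \<in> coord_dom c d"
  then obtain p where p: "p \<in> fst c" "\<psi> p \<in> fst d" "x = snd c p" by (auto simp: coord_dom_def)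
  have pS: "p \<in> topspace (mtop S)" using S.chart_subset[OF c] p(1) by blast
  have n: "\<xi> p \<in> normal_space S M g \<psi> p" "g (\<psi> p) (\<xi> p) (\<xi> p) = 0" "\<xi> p \<noteq> 0"
    using \<xi> pS by (auto simp: umbilical_lightlike_normal_field_def normal_field_def lightlike_def)
  show "lift c d \<xi> x \<in> Q.N x" "Q.h x (lift c d \<xi> x) (lift c d \<xi> x) = 0" "lift c d \<xi> x \<noteq> 0"
    using n c p by (simp_all add: lift_apply normal_space_chart[OF c d p(1,2)] M.g_components[OF d p(2)]
        components_eq_0_iff[OF c d p(1,2)])
  show "\<exists>r. \<forall>v. Q.P.D (lift c d \<xi>) x v + r *\<^sub>R Q.T x v \<in> Q.N x"
    using umbilical_chart[OF _ c d smooth_\<xi> x] \<xi>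
    by (simp add: umbilical_lightlike_normal_field_def Dc_eq[OF c d])
qed

text \<open>The connection form \<open>\<omega>\<close> of \<open>\<xi>\<close> in a chart, characterised by \<open>\<nabla>\<^sup>\<bottom> \<xi> = \<omega> \<otimes> \<xi>\<close>.\<close>

definition conn_form :: "'f \<Rightarrow> 'f \<Rightarrow> real" where
  "conn_form = Q.om (lift c d \<xi>)"

lemma smooth_conn_form: "smooth_on (coord_dom c d) (\<lambda>x. conn_form x v)"
  unfolding conn_form_def by (rule Q.smooth_om[OF lift_\<xi>(1,2,3,4)])

lemma linear_conn_form: "x \<in> coord_dom c d \<Longrightarrow> linear (conn_form x)"
  unfolding conn_form_def by (rule Q.linear_om[OF lift_\<xi>(1,2,3,4)])

lemma normal_curvature_conn_form:
  assumes p: "p \<in> fst c" "\<psi> p \<in> fst d"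
  shows "components M d (\<psi> p) (normal_part S M g \<psi> p (curvature M g (\<psi> p)
      (differential S M \<psi> p u) (differential S M \<psi> p v) (\<xi> p)))
    = (fd (\<lambda>y. conn_form y (components S c p v)) (snd c p) (components S c p u)
       - fd (\<lambda>y. conn_form y (components S c p u)) (snd c p) (components S c p v)) *\<^sub>R lift c d \<xi> (snd c p)"
  unfolding components_normal_part[OF c d p] M.curvature_chart[OF d p(2)] differential_chart[OF c d p]
    conn_form_def lift_apply[OF c p(1), symmetric] coord_apply[OF c p(1), symmetric]
  by (rule Q.normal_curvature_null[OF lift_\<xi> in_coord_dom[OF c d p]])

text \<open>Stated at a single point to serve both directions: a given rescaling yields df =
  \<omega>, and a primitive of \<omega> yields a parallel rescaling.\<close>

lemma normal_connection_rescaled: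
  assumes p: "p \<in> fst c" "\<psi> p \<in> fst d" and U: "openin (mtop S) U" "p \<in> U" and f: "smooth_fun S U f"
  shows "normal_connection S M g \<psi> (\<lambda>r. exp (- f r) *\<^sub>R \<xi> r) p v = 0
    \<longleftrightarrow> conn_form (snd c p) (components S c p v) = fd (\<lambda>x. f (chart_inv c x)) (snd c p) (components S c p v)"
proof -
  let ?V = "\<lambda>r. exp (- f r) *\<^sub>R \<xi> r" and ?f = "\<lambda>x. f (chart_inv c x)" and ?x = "snd c p"
  let ?W = "snd c ` (U \<inter> fst c \<inter> \<psi> -` fst d)"
  have smf: "smooth_on (snd c' ` (U \<inter> fst c')) (\<lambda>x. f (chart_inv c' x))" if "c' \<in> atlas S" for c'
    using f that by (simp add: smooth_fun_def o_def)
  have V: "vector_field_along S M \<psi> U ?V"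
  proof (rule vector_field_along_scale[OF vector_field_along_subset[OF smooth_\<xi> openin_subset[OF U(1)]] U(1)])
    fix c' assume c': "c' \<in> atlas S"
    have op: "open (snd c' ` (U \<inter> fst c'))" by (rule S.open_image_inter[OF c' U(1)])
    show "smooth_on (snd c' ` (U \<inter> fst c')) (\<lambda>x. exp (- f (chart_inv c' x)))"
      by (rule smooth_on_compose[OF smooth_on_exp[of UNIV] op smooth_on_minus[OF op smf[OF c']]]) auto
  qed
  have op: "open ?W" by (rule open_preimage[OF d c U(1)])
  have x: "?x \<in> ?W" "?x \<in> coord_dom c d" using p U by (auto simp: coord_dom_def)
  have "?f differentiable (at ?x)"
    by (rule smooth_on_differentiable[OF smf[OF c]]) (use p U in auto)
  note np = Q.np_D_rescaled[OF lift_\<xi> x(2) this, of "components S c p v"]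
  have "Q.P.D (lift c d ?V) ?x = Q.P.D (\<lambda>x. exp (- ?f x) *\<^sub>R lift c d \<xi> x) ?x"
    by (rule Q.P.D_cong[OF x(1) op lift_smooth[OF V c d] lift_scale[OF c d]]) (auto simp: coord_dom_def)
  then have "components M d (\<psi> p) (normal_connection S M g \<psi> ?V p v)
      = (exp (- ?f ?x) * (conn_form ?x (components S c p v) - fd ?f ?x (components S c p v))) *\<^sub>R lift c d \<xi> ?x"
    using np by (simp add: normal_connection_chart[OF c d p V U] Dc_eq[OF c d] conn_form_def)
  then show ?thesis
    using components_eq_0_iff[OF c d p] lift_\<xi>(4)[OF x(2)] by (metis (no_types, lifting) diff_self
        eq_iff_diff_eq_0 exp_not_eq_zero mult_eq_0_iff scaleR_eq_0_iff)
qed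

end

lemma curvature_zero_if_rescalable:
  assumes "locally_rescalable_to_parallel S M g \<psi> \<xi>" and p: "p \<in> topspace (mtop S)"
  shows "normal_part S M g \<psi> p (curvature M g (\<psi> p)
      (differential S M \<psi> p u) (differential S M \<psi> p v) (\<xi> p)) = 0"
proof -
  let ?c = "chart_at S p" and ?d = "chart_at M (\<psi> p)"
  have c: "?c \<in> atlas S" "p \<in> fst ?c" and d: "?d \<in> atlas M" "\<psi> p \<in> fst ?d"
    using S.chart_at[OF p] M.chart_at[OF psi_topspace[OF p]] by auto
  obtain U f where U: "openin (mtop S) U" "p \<in> U" and f: "smooth_fun S U f"
    and par: "\<And>q v. q \<in> U \<Longrightarrow> normal_connection S M g \<psi> (\<lambda>r. exp (- f r) *\<^sub>R \<xi> r) q v = 0"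
  proof -
    from bspec[OF assms(1)[unfolded locally_rescalable_to_parallel_def] p]
    obtain U f where "openin (mtop S) U \<and> p \<in> U \<and> smooth_fun S U f \<and>
        (\<forall>q\<in>U. \<forall>v. normal_connection S M g \<psi> (\<lambda>r. exp (- f r) *\<^sub>R \<xi> r) q v = 0)"
      by (elim exE)
    then show thesis by (intro that[of U f]) simp_all
  qed
  let ?W = "snd ?c ` (U \<inter> fst ?c \<inter> \<psi> -` fst ?d)" and ?f = "\<lambda>x. f (chart_inv ?c x)" and ?\<omega> = "conn_form ?c ?d"
  have op: "open ?W" by (rule open_preimage[OF d(1) c(1) U(1)])
  have x: "snd ?c p \<in> ?W" using c d U by auto
  have smf: "smooth_on ?W ?f"
    by (rule smooth_on_subset[of "snd ?c ` (U \<inter> fst ?c)"]) (use f c(1) in \<open>auto simp: smooth_fun_def o_def\<close>)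
  have eq: "fd ?f x v = ?\<omega> x v" if "x \<in> ?W" for x v
  proof -
    obtain q where q: "q \<in> U" "q \<in> fst ?c" "\<psi> q \<in> fst ?d" "x = snd ?c q" using \<open>x \<in> ?W\<close> by auto
    show ?thesis
      using normal_connection_rescaled[OF c(1) d(1) q(2,3) U(1) q(1) f, of "of_components S ?c q v"] par[OF q(1)]
        q(2,4) c(1) by simp
  qed
  \<comment> \<open>On \<open>?W\<close> the components of \<omega> are partial derivatives of
    \<open>?f\<close>, so its antisymmetrised derivative is a difference of mixed partials.\<close>
  have "fd (\<lambda>y. ?\<omega> y v) (snd ?c p) u = fd (\<lambda>y. fd ?f y v) (snd ?c p) u" for u v
    by (rule fun_cong[OF smooth_on_cong_fd[OF op smooth_on_fd[OF smf] eq x, symmetric]])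
  then have "fd (\<lambda>y. ?\<omega> y v) (snd ?c p) u = fd (\<lambda>y. ?\<omega> y u) (snd ?c p) v" for u v
    using second_derivative_symmetric[OF op smf x] by metis
  then show ?thesis
    using normal_curvature_conn_form[OF c(1) d(1) c(2) d(2), of u v] components_eq_0_iff[OF c(1) d(1) c(2) d(2)]
    by simp
qed

lemma rescalable_if_curvature_zero:
  assumes R: "\<And>p u v. p \<in> topspace (mtop S) \<Longrightarrow> normal_part S M g \<psi> p (curvature M g (\<psi> p)
      (differential S M \<psi> p u) (differential S M \<psi> p v) (\<xi> p)) = 0"
  shows "locally_rescalable_to_parallel S M g \<psi> \<xi>"
  unfolding locally_rescalable_to_parallel_def
proof
  fix p assume p: "p \<in> topspace (mtop S)"
  let ?c = "chart_at S p" and ?d = "chart_at M (\<psi> p)"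
  let ?\<omega> = "conn_form ?c ?d" and ?W = "coord_dom ?c ?d"
  have c: "?c \<in> atlas S" "p \<in> fst ?c" and d: "?d \<in> atlas M" "\<psi> p \<in> fst ?d"
    using S.chart_at[OF p] M.chart_at[OF psi_topspace[OF p]] by auto
  have closed: "fd (\<lambda>y. ?\<omega> y u) x v = fd (\<lambda>y. ?\<omega> y v) x u" if x: "x \<in> ?W" for x u v
  proof -
    obtain q where q: "q \<in> fst ?c" "\<psi> q \<in> fst ?d" "x = snd ?c q" using x by (auto simp: coord_dom_def)
    have "q \<in> topspace (mtop S)" using S.chart_subset[OF c(1)] q(1) by blast
    then have "(fd (\<lambda>y. ?\<omega> y v) x u - fd (\<lambda>y. ?\<omega> y u) x v) *\<^sub>R lift ?c ?d \<xi> x = 0"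
      using normal_curvature_conn_form[OF c(1) d(1) q(1,2), of "of_components S ?c q u" "of_components S ?c q v"]
        R linear_0[OF M.linear_components[OF d(1) q(2)]] c(1) q by simp
    then show ?thesis using lift_\<xi>(4)[OF c(1) d(1) x] by simp
  qed
  have x0: "snd ?c p \<in> ?W" by (rule in_coord_dom[OF c(1) d(1) c(2) d(2)])
  \<comment> \<open>A ball is star-shaped about its centre, as the Poincare lemma needs.\<close>
  obtain e where e: "e > 0" "ball (snd ?c p) e \<subseteq> ?W"
    using coord_dom_open[OF c(1) d(1)] x0 open_contains_ball by blast
  obtain F where F: "smooth_on (ball (snd ?c p) e) F"
    "\<And>x v. x \<in> ball (snd ?c p) e \<Longrightarrow> fd F x v = ?\<omega> x v"
  proof (rule poincare_ball[of "snd ?c p" e ?\<omega>])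
    show "linear (?\<omega> x)" if "x \<in> ball (snd ?c p) e" for x
      using linear_conn_form[OF c(1) d(1)] e(2) that by blast
    show "smooth_on (ball (snd ?c p) e) (\<lambda>x. ?\<omega> x v)" for v
      by (rule smooth_on_subset[OF smooth_conn_form[OF c(1) d(1)] e(2)])
    show "fd (\<lambda>y. ?\<omega> y u) x v = fd (\<lambda>y. ?\<omega> y v) x u" if "x \<in> ball (snd ?c p) e" for x u v
      using closed e(2) that by blast
  qed (rule that)
  define U where "U = {q \<in> fst ?c. snd ?c q \<in> ball (snd ?c p) e}"
  define f where "f q = F (snd ?c q)" for q
  have U: "openin (mtop S) U" unfolding U_def by (rule S.openin_chart_preimage[OF c(1) open_ball])
  have pU: "p \<in> U" using c e by (simp add: U_def)
  have smf: "smooth_fun S U f"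
    unfolding smooth_fun_def
  proof
    fix c' assume c': "c' \<in> atlas S"
    have op: "open (snd c' ` (U \<inter> fst c'))" by (rule S.open_image_inter[OF c' U])
    have "smooth_on (snd c' ` (U \<inter> fst c')) (\<lambda>x. F (transition c' ?c x))"
      by (rule smooth_on_compose[OF F(1) op smooth_on_subset[OF S.transition_smooth[OF c' c(1)]]])
        (auto simp: U_def S.transition_apply[OF c'])
    then show "smooth_on (snd c' ` (U \<inter> fst c')) (f \<circ> chart_inv c')"
      by (rule smooth_on_cong[OF op]) (use c' in \<open>auto simp: f_def transition_def\<close>)
  qed
  have "normal_connection S M g \<psi> (\<lambda>r. exp (- f r) *\<^sub>R \<xi> r) q v = 0" if q: "q \<in> U" for q v
  proof -
    have qc: "q \<in> fst ?c" "snd ?c q \<in> ball (snd ?c p) e" using q by (auto simp: U_def)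
    \<comment> \<open>Membership in \<open>coord_dom\<close> speaks of coordinates only; injectivity
      of the chart shows that the point found is \<open>q\<close> itself.\<close>
    then obtain q' where "q' \<in> fst ?c" "\<psi> q' \<in> fst ?d" "snd ?c q = snd ?c q'"
      using e(2) unfolding coord_dom_def by blast
    then have qd: "\<psi> q \<in> fst ?d" using inj_onD[OF S.chart_inj[OF c(1)], of q q'] qc(1) by simp
    have "fd (\<lambda>x. f (chart_inv ?c x)) (snd ?c q) = fd F (snd ?c q)"
    proof (rule smooth_on_cong_fd[OF open_ball F(1) _ qc(2), symmetric])
      fix x assume "x \<in> ball (snd ?c p) e"
      then have "x \<in> snd ?c ` fst ?c" using e(2) by (auto simp: coord_dom_def)
      then show "F x = f (chart_inv ?c x)" using c(1) by (auto simp: f_def)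
    qed
    then show ?thesis
      using normal_connection_rescaled[OF c(1) d(1) qc(1) qd U q smf] F(2)[OF qc(2)] by simp
  qed
  then show "\<exists>U f. openin (mtop S) U \<and> p \<in> U \<and> smooth_fun S U f \<and>
      (\<forall>q\<in>U. \<forall>v. normal_connection S M g \<psi> (\<lambda>r. exp (- f r) *\<^sub>R \<xi> r) q v = 0)"
    using U pU smf by blast
qed


lemma flat_normal_connection_if_rescalable:
  assumes res: "locally_rescalable_to_parallel S M g \<psi> \<xi>"
  shows "flat_normal_connection S M g \<psi>"
  unfolding flat_normal_connection_def
proof (intro allI impI ballI, elim conjE)
  fix U X Y \<zeta> p
  assume U: "openin (mtop S) U" and X: "vector_field S U X" and Y: "vector_field S U Y"
    and \<zeta>: "normal_field S M g \<psi> U \<zeta>" and pU: "p \<in> U"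
  have p: "p \<in> topspace (mtop S)" using openin_subset[OF U] pU by blast
  let ?c = "chart_at S p" and ?d = "chart_at M (\<psi> p)" and ?x = "snd (chart_at S p) p"
  have c: "?c \<in> atlas S" "p \<in> fst ?c" and d: "?d \<in> atlas M" "\<psi> p \<in> fst ?d"
    using S.chart_at[OF p] M.chart_at[OF psi_topspace[OF p]] by auto
  obtain U1 f where U1: "openin (mtop S) U1" "p \<in> U1" and f: "smooth_fun S U1 f"
    and par: "\<And>q v. q \<in> U1 \<Longrightarrow> normal_connection S M g \<psi> (\<lambda>r. exp (- f r) *\<^sub>R \<xi> r) q v = 0"
  proof -
    from bspec[OF res[unfolded locally_rescalable_to_parallel_def] p]
    obtain U f where "openin (mtop S) U \<and> p \<in> U \<and> smooth_fun S U f \<and>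
        (\<forall>q\<in>U. \<forall>v. normal_connection S M g \<psi> (\<lambda>r. exp (- f r) *\<^sub>R \<xi> r) q v = 0)"
      by (elim exE)
    then show thesis by (intro that[of U f]) simp_all
  qed
  let ?W = "snd ?c ` (U \<inter> U1 \<inter> fst ?c \<inter> \<psi> -` fst ?d)"
  have op: "open ?W" by (rule open_preimage[OF d(1) c(1) openin_Int[OF U U1(1)]])
  have x: "?x \<in> ?W" using c d pU U1 by auto
  have sub: "?W \<subseteq> coord_dom ?c ?d" by (auto simp: coord_dom_def)
  have inW: "\<exists>q. q \<in> U \<and> q \<in> U1 \<and> q \<in> fst ?c \<and> \<psi> q \<in> fst ?d \<and> y = snd ?c q" if "y \<in> ?W" for y
    using that by auto
  interpret R: spacelike_patch "snd ?d ` fst ?d" "M.G ?d" "christoffel M g ?d" ?W "coord ?c ?d"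
    by (rule patch[OF c(1) d(1) op sub])
  let ?f = "\<lambda>y. f (chart_inv ?c y)"
  \<comment> \<open>The coordinate expression of the parallel rescaling of \<xi>.\<close>
  define \<xi>' where "\<xi>' y = exp (- ?f y) *\<^sub>R lift ?c ?d \<xi> y" for y
  have smf: "smooth_on ?W ?f"
    by (rule smooth_on_subset[of "snd ?c ` (U1 \<inter> fst ?c)"]) (use f c(1) in \<open>auto simp: smooth_fun_def o_def\<close>)
  have sm\<xi>: "smooth_on ?W (lift ?c ?d \<xi>)" by (rule smooth_on_subset[OF lift_\<xi>(1)[OF c(1) d(1)] sub])
  have sm\<xi>': "smooth_on ?W \<xi>'"
    unfolding \<xi>'_def
    by (intro smooth_on_scaleR[OF op] sm\<xi> smooth_on_compose[OF smooth_on_exp[of UNIV] op smooth_on_minus[OF op smf]]) auto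
  have al: "\<xi>' y \<in> R.N y" "R.h y (\<xi>' y) (\<xi>' y) = 0" "\<xi>' y \<noteq> 0" "R.P.D \<xi>' y v \<in> range (R.T y)"
    if y: "y \<in> ?W" for y v
  proof -
    have yd: "y \<in> coord_dom ?c ?d" using y sub by blast
    interpret L: spacelike_subspace "R.h y" "R.T y" by (rule R.subspace_at[OF y])
    note l = lift_\<xi>[OF c(1) d(1)]
    show "\<xi>' y \<in> R.N y" unfolding \<xi>'_def by (intro L.nspace_scaleR l(2)[OF yd])
    show "R.h y (\<xi>' y) (\<xi>' y) = 0" by (simp add: \<xi>'_def L.h_simps l(3)[OF yd])
    show "\<xi>' y \<noteq> 0" by (simp add: \<xi>'_def l(4)[OF yd])
    obtain q where q: "q \<in> U1" "q \<in> fst ?c" "\<psi> q \<in> fst ?d" "y = snd ?c q" using inW[OF y] by blast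
    have om: "conn_form ?c ?d y v = fd ?f y v"
      using normal_connection_rescaled[OF c(1) d(1) q(2,3) U1(1) q(1) f, of "of_components S ?c q v"] par[OF q(1)]
        q(2,4) c(1) by simp
    \<comment> \<open>\<open>conn_form\<close> is defined over the whole \<open>coord_dom\<close>,
      so the rescaling formula is taken from this patch rather than from the one over
      \<open>?W\<close>.\<close>
    interpret Q: spacelike_patch "snd ?d ` fst ?d" "M.G ?d" "christoffel M g ?d" "coord_dom ?c ?d" "coord ?c ?d"
      by (rule patch[OF c(1) d(1) coord_dom_open[OF c(1) d(1)] subset_refl])
    have "R.np y (R.P.D \<xi>' y v) = 0"
      unfolding \<xi>'_def
      using Q.np_D_rescaled[OF l yd smooth_on_differentiable[OF smf y], of v] om
      by (simp add: conn_form_def[OF c(1) d(1)])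
    then show "R.P.D \<xi>' y v \<in> range (R.T y)" by (simp add: L.npart_eq_0_iff)
  qed
  obtain W' \<eta> where W': "open W'" "W' \<subseteq> ?W" "?x \<in> W'"
    and frame: "spacelike_patch.parallel_null_frame (M.G ?d) (christoffel M g ?d) W' (coord ?c ?d) \<xi>' \<eta>"
    using R.parallel_null_frame_exists[OF sm\<xi>' al x] by blast
  interpret R': spacelike_patch "snd ?d ` fst ?d" "M.G ?d" "christoffel M g ?d" W' "coord ?c ?d"
    by (rule R.restrict[OF W'(1,2)])
  have inW': "\<exists>q. q \<in> U \<and> q \<in> fst ?c \<and> \<psi> q \<in> fst ?d \<and> y = snd ?c q" if "y \<in> W'" for y
    using inW that W'(2) by blast
  have \<zeta>V: "vector_field_along S M \<psi> U \<zeta>" using \<zeta> by (simp add: normal_field_def)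
  let ?\<zeta> = "lift ?c ?d \<zeta>"
  have sub': "W' \<subseteq> snd ?c ` (U \<inter> fst ?c \<inter> \<psi> -` fst ?d)" using W'(2) by blast
  have sm\<zeta>: "smooth_on W' ?\<zeta>" by (rule smooth_on_subset[OF lift_smooth[OF \<zeta>V c(1) d(1)] sub'])
  have n\<zeta>: "?\<zeta> y \<in> R'.N y" if y: "y \<in> W'" for y
  proof -
    obtain q where q: "q \<in> U" "q \<in> fst ?c" "\<psi> q \<in> fst ?d" "y = snd ?c q" using inW'[OF y] by blast
    have "\<zeta> q \<in> normal_space S M g \<psi> q" using \<zeta> q(1) by (simp add: normal_field_def)
    then show ?thesis using q c(1) by (simp add: lift_apply normal_space_chart[OF c(1) d(1) q(2,3)])
  qed
  let ?loc = "\<lambda>Z y. components S ?c (chart_inv ?c y) (Z (chart_inv ?c y))"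
  have smZ: "smooth_on W' (?loc Z)" if "vector_field S U Z" for Z
  proof (rule smooth_on_subset)
    show "smooth_on (snd ?c ` (U \<inter> fst ?c \<inter> id -` fst ?c)) (?loc Z)"
      using that[unfolded vector_field_def vector_field_along_def, rule_format, OF c(1) c(1)] by simp
    show "W' \<subseteq> snd ?c ` (U \<inter> fst ?c \<inter> id -` fst ?c)" using sub' by auto
  qed
  have Zx: "?loc Z ?x = Z p" for Z using c S.components_chart_at[OF p] by simp
  have np_p: "normal_part S M g \<psi> p w = R'.np ?x w" for w
    using components_normal_part[OF c(1) d(1) c(2) d(2), of w] M.components_chart_at[OF psi_topspace[OF p]] by simp
  have first: "normal_connection S M g \<psi> \<zeta> p v = R'.np ?x (R'.P.D ?\<zeta> ?x v)" for v
    by (simp add: normal_connection_def np_p cov_deriv_self[OF p] Dc_eq[OF c(1) d(1)])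
  \<comment> \<open>The inner normal derivative is defined with preferred charts that vary with
    \<open>q\<close>. The charts of \<open>p\<close> give the same field on the open set
    \<open>W'\<close>, which is all that the outer derivative sees.\<close>
  have second: "normal_connection S M g \<psi> (\<lambda>q. normal_connection S M g \<psi> \<zeta> q (Z q)) p v
      = R'.np ?x (R'.P.D (\<lambda>y. R'.np y (R'.P.D ?\<zeta> y (?loc Z y))) ?x v)"
    if Z: "vector_field S U Z" for Z v
  proof -
    have "R'.P.D (\<lambda>y. R'.np y (R'.P.D ?\<zeta> y (?loc Z y))) ?x
        = R'.P.D (lift ?c ?d (\<lambda>q. normal_connection S M g \<psi> \<zeta> q (Z q))) ?x"
    proof (rule R'.P.D_cong[OF W'(3,1) R'.smooth_np_D_normal[OF frame sm\<zeta> n\<zeta> smZ[OF Z]]])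
      fix y assume y: "y \<in> W'"
      obtain q where q: "q \<in> U" "q \<in> fst ?c" "\<psi> q \<in> fst ?d" "y = snd ?c q" using inW'[OF y] by blast
      show "R'.np y (R'.P.D ?\<zeta> y (?loc Z y)) = lift ?c ?d (\<lambda>q. normal_connection S M g \<psi> \<zeta> q (Z q)) y"
        using normal_connection_chart[OF c(1) d(1) q(2,3) \<zeta>V U q(1), of "Z q"] q c(1)
        by (simp add: lift_apply Dc_eq[OF c(1) d(1)])
    qed
    then show ?thesis
      by (simp add: normal_connection_def[of _ _ _ _ "\<lambda>q. normal_connection S M g \<psi> \<zeta> q (Z q)"] np_p
          cov_deriv_self[OF p] Dc_eq[OF c(1) d(1)])
  qed
  \<comment> \<open>The bracket at \<open>p\<close> is already defined in the preferred chart of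
    \<open>p\<close>, so no change of chart arises.\<close>
  have "lie_bracket S X Y p = fd (?loc Y) ?x (X p) - fd (?loc X) ?x (Y p)"
    by (simp add: lie_bracket_def Let_def)
  then show "normal_curvature S M g \<psi> X Y \<zeta> p = 0"
    using R'.normal_curvature_frame[OF frame sm\<zeta> n\<zeta> W'(3) smZ[OF X] smZ[OF Y]]
    unfolding normal_curvature_def second[OF X] second[OF Y] first Zx by simp
qed

end

end

theorem proposition5p2:
  fixes M :: "('a, 'e::euclidean_space) manifold"
    and g :: "'a \<Rightarrow> 'e \<Rightarrow> 'e \<Rightarrow> real"
    and \<tau> :: "'a \<Rightarrow> 'e set"
    and S :: "('b, 'f::euclidean_space) manifold"
    and \<psi> :: "'b \<Rightarrow> 'a"
  assumes "spacetime M g \<tau>"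
    and "spacelike_submanifold S M g \<psi>"
    and "DIM('e) = DIM('f) + 2"
    and "DIM('e) \<ge> 4"
  shows "((\<exists>\<xi>. umbilical_lightlike_normal_field S M g \<psi> \<xi> \<and>
               locally_rescalable_to_parallel S M g \<psi> \<xi>)
          \<longleftrightarrow>
          (\<exists>\<xi>. umbilical_lightlike_normal_field S M g \<psi> \<xi> \<and>
               (\<forall>X Y. vector_field S (topspace (mtop S)) X \<and> vector_field S (topspace (mtop S)) Y \<longrightarrow>
                  (\<forall>p\<in>topspace (mtop S).
                     normal_part S M g \<psi> p
                       (curvature M g (\<psi> p) (differential S M \<psi> p (X p))
                          (differential S M \<psi> p (Y p)) (\<xi> p)) = 0))))
         \<and>
         ((\<exists>\<xi>. umbilical_lightlike_normal_field S M g \<psi> \<xi> \<and>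
               locally_rescalable_to_parallel S M g \<psi> \<xi>)
          \<longrightarrow> flat_normal_connection S M g \<psi>)"
proof -
  interpret spacelike_immersion S M g \<psi>
    using assms by unfold_locales
      (simp_all add: spacetime_def spacelike_submanifold_def immersion_def)
  \<comment> \<open>The two conditions are equivalent for each field \<xi>, so the same \<xi>
    witnesses both existential statements.\<close>
  have "locally_rescalable_to_parallel S M g \<psi> \<xi> \<longleftrightarrow>
      (\<forall>X Y. vector_field S (topspace (mtop S)) X \<and> vector_field S (topspace (mtop S)) Y \<longrightarrow>
        (\<forall>p\<in>topspace (mtop S). normal_part S M g \<psi> p (curvature M g (\<psi> p)
          (differential S M \<psi> p (X p)) (differential S M \<psi> p (Y p)) (\<xi> p)) = 0))"
    (is "?res \<longleftrightarrow> ?curv") if \<xi>: "umbilical_lightlike_normal_field S M g \<psi> \<xi>" for \<xi>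
  proof
    assume ?res
    then show ?curv using curvature_zero_if_rescalable[OF \<xi>] by blast
  next
    assume curv: ?curv
    show ?res
    proof (rule rescalable_if_curvature_zero[OF \<xi>])
      fix p u v assume p: "p \<in> topspace (mtop S)"
      \<comment> \<open>Global extensions turn the hypothesis on vector fields into one on arbitrary
        tangent vectors at \<open>p\<close>.\<close>
      obtain X Y where X: "vector_field S (topspace (mtop S)) X" "X p = u"
        and Y: "vector_field S (topspace (mtop S)) Y" "Y p = v"
        using S.global_field_exists[OF p] by metis
      show "normal_part S M g \<psi> p (curvature M g (\<psi> p)
          (differential S M \<psi> p u) (differential S M \<psi> p v) (\<xi> p)) = 0"
        using curv[rule_format, of X Y p] X Y p by simp
    qed
  qed
  then show ?thesis using flat_normal_connection_if_rescalable by blast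
qed

end
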